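(* The assignment sending an internal category $\mathbb{D}=(D_1\rightrightarrows D_0)\in\mathbf{Cat}(\mathcal{C})$ to its category of actions $\mathbf{Act}_{\mathcal{C}}(\mathbb{D})\in\mathbf{Cat}$ extends to a functor $$\mathbf{Act}_{\mathcal{C}}(-)\colon \mathbf{Cat}(\mathcal{C})^{\mathrm{op}}\longrightarrow\mathbf{Cat}.$$ More precisely, $\mathbf{Act}_{\mathcal{C}}(-)$ is given by the composite of functors $$\mathbf{Cat}(\mathcal{C})^{\mathrm{op}}\xrightarrow{\ \mathcal{T}^{\mathrm{op}}\ }(\mathbf{Mnd}_{\mathrm{co}}^{\mathrm{adj}})^{\mathrm{op}}\xrightarrow{\ \mathrm{Alg}(-)\ }\mathbf{Cat}$$ (where $\mathbf{Act}_{\mathcal{C}}(\mathbb{D})$ is identified with the isomorphic category $\mathrm{Alg}(\mathcal{T}_{\mathbb{D}})$).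
   Context: $\mathcal{C}$ is a fixed category with finite limits. An internal category $\mathbb{D}$ in $\mathcal{C}$ consists of objects $D_0,D_1$, source and target maps $s,t\colon D_1\to D_0$, an identity map $i\colon D_0\to D_1$ and a composition map $\mathrm{comp}\colon D_1\times_{s,D_0,t}D_1\to D_1$, satisfying the usual axioms; $\mathbf{Cat}(\mathcal{C})$ is the category of internal categories and internal functors. Actions: an action of $\mathbb{D}$ is a triple $(X,\gamma\colon X\to D_0,\ \xi\colon D_1\times_{s,D_0,\gamma}X\to X)$ with $\gamma\xi=t\pi_1$, $\xi\langle i\gamma,\mathrm{id}_X\rangle=\mathrm{id}_X$ and $\xi(\mathrm{comp}\times\mathrm{id}_X)=\xi(\mathrm{id}_{D_1}\times\xi)$ (modulo the canonical associativity isomorphism of pullbacks); morphisms of actions are morphisms over $D_0$ commuting with the $\xi$'s. They form the category $\mathbf{Act}_{\mathcal{C}}(\mathbb{D})$. Comorphisms of monads: writing $(\mathcal{E},T)$ for a monad $T=(T,\eta^T,\mu^T)$ on a category $\mathcal{E}$, a comorphism of monads $(\mathcal{E},T)\to(\mathcal{A},S)$ is a pair $(F,\chi)$ with $F\colon\mathcal{E}\to\mathcal{A}$ a functor and $\chi\colon FT\Rightarrow SF$ a natural transformation with $\chi\circ F\eta^T=\eta^SF$ and $\chi\circ F\mu^T=\mu^SF\circ S\chi\circ\chi T$. $\mathbf{Mnd}_{\mathrm{co}}^{\mathrm{adj}}$ is the category of monads and those comorphisms whose underlying functor $F$ is a left adjoint. The functor $\mathrm{Alg}(-)$: it sends a monad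 to its Eilenberg--Moore category, and a comorphism $(F,\chi)\colon(\mathcal{E},T)\to(\mathcal{A},S)$ with chosen adjunction $F\dashv G$ (unit $\iota$, counit $\varepsilon$) to the functor $\mathrm{Alg}(S)\to\mathrm{Alg}(T)$, $(Y,b)\mapsto(GY,\,Gb\circ\chi^\sharp_Y)$, where $\chi^\sharp\colon TG\Rightarrow GS$ is the mate $\chi^\sharp_Y=GS\varepsilon_Y\circ G\chi_{GY}\circ\iota_{TGY}$. After choosing right adjoints for the left adjoints occurring in $\mathbf{Mnd}_{\mathrm{co}}^{\mathrm{adj}}$, this gives the functor $\mathrm{Alg}(-)\colon(\mathbf{Mnd}_{\mathrm{co}}^{\mathrm{adj}})^{\mathrm{op}}\to\mathbf{Cat}$. The functor $\mathcal{T}\colon\mathbf{Cat}(\mathcal{C})\to\mathbf{Mnd}_{\mathrm{co}}^{\mathrm{adj}}$: it sends $\mathbb{D}$ to the monad $\mathcal{T}_{\mathbb{D}}$ on $\mathcal{C}/D_0$ with $\mathcal{T}_{\mathbb{D}}(\gamma\colon X\to D_0)=(D_1\times_{s,D_0,\gamma}X\xrightarrow{\pi_1}D_1\xrightarrow{t}D_0)$, $\mathcal{T}_{\mathbb{D}}(f)=\mathrm{id}_{D_1}\times f$, unit $\eta^{\mathbb{D}}_\gamma=\langle i\gamma,\mathrm{id}_X\rangle$ and multiplication $\mu^{\mathbb{D}}_\gamma$ the composite $D_1\times_{D_0}(D_1\times_{D_0}X)\cong(D_1\times_{D_0}D_1)\times_{D_0}X\xrightarrow{\mathrm{comp}\times\mathrm{id}}D_1\times_{D_0}X$.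 It sends an internal functor $F=(F_0,F_1)\colon\mathbb{D}\to\mathbb{E}$ to the comorphism $(F_0\circ-,\tau_F)$, where $F_0\circ-\colon\mathcal{C}/D_0\to\mathcal{C}/E_0$ is postcomposition (left adjoint to pullback $F_0^\ast$) and $(\tau_F)_\gamma=F_1\times\mathrm{id}_X\colon D_1\times_{D_0}X\to E_1\times_{E_0}X$. The isomorphism $\mathrm{Alg}(\mathcal{T}_{\mathbb{D}})\cong\mathbf{Act}_{\mathcal{C}}(\mathbb{D})$ is the evident one: an algebra $(\gamma,\xi)$ corresponds to the action $(X,\gamma,\xi)$.
   Formalization: For an arbitrary choice of right adjoints Alg(-) need not preserve identities or composition strictly, so Alg(-) and Act(-) are shown to be pseudofunctors; Act(-) is a strict functor to Cat when the chosen adjunctions respect identities and composition along T. *)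

theory Defs
  imports "HOL-Library.FuncSet"
begin

section \<open>Categories, functors, natural transformations\<close>

text \<open>
  Categories are carrier-based, with composition \<open>g \<cdot> f\<close> in applicative order. Functors carry their
  source and target and are extensional, as are natural transformations (given by their
  components), so that equality in HOL is equality of functors and of natural transformations.
\<close>

record ('o, 'a) cat =
  Ob :: "'o set"
  Ar :: "'a set"
  Dom :: "'a \<Rightarrow> 'o"
  Cod :: "'a \<Rightarrow> 'o"
  Id :: "'o \<Rightarrow> 'a"
  Comp :: "'a \<Rightarrow> 'a \<Rightarrow> 'a"  (infixr \<open>\<cdot>\<index>\<close> 70)

definition hom :: "('o, 'a) cat \<Rightarrow> 'o \<Rightarrow> 'o \<Rightarrow> 'a set" where
  "hom C x y = {f \<in> Ar C. Dom C f = x \<and> Cod C f = y}"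

locale category =
  fixes C :: "('o, 'a) cat"
  assumes dom_closed: "f \<in> Ar C \<Longrightarrow> Dom C f \<in> Ob C"
    and cod_closed: "f \<in> Ar C \<Longrightarrow> Cod C f \<in> Ob C"
    and id_hom: "x \<in> Ob C \<Longrightarrow> Id C x \<in> hom C x x"
    and comp_hom: "\<lbrakk>f \<in> hom C x y; g \<in> hom C y z\<rbrakk> \<Longrightarrow> g \<cdot>\<^bsub>C\<^esub> f \<in> hom C x z"
    and id_right: "f \<in> hom C x y \<Longrightarrow> f \<cdot>\<^bsub>C\<^esub> Id C x = f"
    and id_left: "f \<in> hom C x y \<Longrightarrow> Id C y \<cdot>\<^bsub>C\<^esub> f = f"
    and assoc: "\<lbrakk>f \<in> hom C w x; g \<in> hom C x y; h \<in> hom C y z\<rbrakk> \<Longrightarrow>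
      (h \<cdot>\<^bsub>C\<^esub> g) \<cdot>\<^bsub>C\<^esub> f = h \<cdot>\<^bsub>C\<^esub> (g \<cdot>\<^bsub>C\<^esub> f)"

definition op_cat :: "('o, 'a) cat \<Rightarrow> ('o, 'a) cat" where
  "op_cat C = \<lparr>Ob = Ob C, Ar = Ar C, Dom = Cod C, Cod = Dom C, Id = Id C,
    Comp = (\<lambda>g f. f \<cdot>\<^bsub>C\<^esub> g)\<rparr>"

definition is_iso :: "('o, 'a) cat \<Rightarrow> 'a \<Rightarrow> bool" where
  "is_iso C f \<longleftrightarrow> f \<in> Ar C \<and> (\<exists>g \<in> hom C (Cod C f) (Dom C f).
    g \<cdot>\<^bsub>C\<^esub> f = Id C (Dom C f) \<and> f \<cdot>\<^bsub>C\<^esub> g = Id C (Cod C f))"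

record ('o, 'a, 'p, 'b) functr =
  fsrc :: "('o, 'a) cat"
  ftgt :: "('p, 'b) cat"
  fob :: "'o \<Rightarrow> 'p"
  far :: "'a \<Rightarrow> 'b"

definition is_functor :: "('o, 'a, 'p, 'b) functr \<Rightarrow> bool" where
  "is_functor F \<longleftrightarrow> category (fsrc F) \<and> category (ftgt F)
    \<and> fob F \<in> Ob (fsrc F) \<rightarrow>\<^sub>E Ob (ftgt F)
    \<and> far F \<in> Ar (fsrc F) \<rightarrow>\<^sub>E Ar (ftgt F)
    \<and> (\<forall>f \<in> Ar (fsrc F). Dom (ftgt F) (far F f) = fob F (Dom (fsrc F) f)
                        \<and> Cod (ftgt F) (far F f) = fob F (Cod (fsrc F) f))
    \<and> (\<forall>x \<in> Ob (fsrc F). far F (Id (fsrc F) x) = Id (ftgt F) (fob F x))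
    \<and> (\<forall>f \<in> Ar (fsrc F). \<forall>g \<in> Ar (fsrc F). Dom (fsrc F) g = Cod (fsrc F) f \<longrightarrow>
         far F (g \<cdot>\<^bsub>fsrc F\<^esub> f) = far F g \<cdot>\<^bsub>ftgt F\<^esub> far F f)"

definition functor_between ::
  "('o, 'a) cat \<Rightarrow> ('p, 'b) cat \<Rightarrow> ('o, 'a, 'p, 'b) functr \<Rightarrow> bool" where
  "functor_between A B F \<longleftrightarrow> is_functor F \<and> fsrc F = A \<and> ftgt F = B"

definition id_functr :: "('o, 'a) cat \<Rightarrow> ('o, 'a, 'o, 'a) functr" where
  "id_functr A = \<lparr>fsrc = A, ftgt = A, fob = (\<lambda>x\<in>Ob A. x), far = (\<lambda>f\<in>Ar A. f)\<rparr>"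

definition comp_functr ::
  "('p, 'b, 'q, 'c) functr \<Rightarrow> ('o, 'a, 'p, 'b) functr \<Rightarrow> ('o, 'a, 'q, 'c) functr" where
  "comp_functr G F = \<lparr>fsrc = fsrc F, ftgt = ftgt G,
    fob = compose (Ob (fsrc F)) (fob G) (fob F),
    far = compose (Ar (fsrc F)) (far G) (far F)\<rparr>"

definition op_functr :: "('o, 'a, 'p, 'b) functr \<Rightarrow> ('o, 'a, 'p, 'b) functr" where
  "op_functr F = \<lparr>fsrc = op_cat (fsrc F), ftgt = op_cat (ftgt F), fob = fob F, far = far F\<rparr>"

definition cat_isomorphism ::
  "('o, 'a) cat \<Rightarrow> ('p, 'b) cat \<Rightarrow> ('o, 'a, 'p, 'b) functr \<Rightarrow> bool" where
  "cat_isomorphism A B F \<longleftrightarrow> functor_between A B F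
    \<and> (\<exists>G. functor_between B A G \<and> comp_functr G F = id_functr A \<and> comp_functr F G = id_functr B)"

definition nat_trans ::
  "('o, 'a, 'p, 'b) functr \<Rightarrow> ('o, 'a, 'p, 'b) functr \<Rightarrow> ('o \<Rightarrow> 'b) \<Rightarrow> bool" where
  "nat_trans F G \<tau> \<longleftrightarrow> is_functor F \<and> is_functor G \<and> fsrc G = fsrc F \<and> ftgt G = ftgt F
    \<and> \<tau> \<in> extensional (Ob (fsrc F))
    \<and> (\<forall>x \<in> Ob (fsrc F). \<tau> x \<in> hom (ftgt F) (fob F x) (fob G x))
    \<and> (\<forall>f \<in> Ar (fsrc F). \<tau> (Cod (fsrc F) f) \<cdot>\<^bsub>ftgt F\<^esub> far F f
                        = far G f \<cdot>\<^bsub>ftgt F\<^esub> \<tau> (Dom (fsrc F) f))"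

definition nat_iso ::
  "('o, 'a, 'p, 'b) functr \<Rightarrow> ('o, 'a, 'p, 'b) functr \<Rightarrow> ('o \<Rightarrow> 'b) \<Rightarrow> bool" where
  "nat_iso F G \<tau> \<longleftrightarrow> nat_trans F G \<tau> \<and> (\<forall>x \<in> Ob (fsrc F). is_iso (ftgt F) (\<tau> x))"

text \<open>The category of all categories with objects and arrows drawn from two given types.\<close>

definition CAT :: "(('o, 'a) cat, ('o, 'a, 'o, 'a) functr) cat" where
  "CAT = \<lparr>Ob = {A. category A}, Ar = {F. is_functor F}, Dom = fsrc, Cod = ftgt,
    Id = id_functr, Comp = comp_functr\<rparr>"


section \<open>Finite limits and pullbacks\<close>

definition is_cone :: "('j, 'u, 'o, 'a) functr \<Rightarrow> 'o \<Rightarrow> ('j \<Rightarrow> 'a) \<Rightarrow> bool" where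
  "is_cone F L l \<longleftrightarrow> L \<in> Ob (ftgt F)
    \<and> (\<forall>j \<in> Ob (fsrc F). l j \<in> hom (ftgt F) L (fob F j))
    \<and> (\<forall>u \<in> Ar (fsrc F). far F u \<cdot>\<^bsub>ftgt F\<^esub> l (Dom (fsrc F) u) = l (Cod (fsrc F) u))"

definition is_limit_cone :: "('j, 'u, 'o, 'a) functr \<Rightarrow> 'o \<Rightarrow> ('j \<Rightarrow> 'a) \<Rightarrow> bool" where
  "is_limit_cone F L l \<longleftrightarrow> is_cone F L l
    \<and> (\<forall>M m. is_cone F M m \<longrightarrow>
         (\<exists>!h. h \<in> hom (ftgt F) M L \<and> (\<forall>j \<in> Ob (fsrc F). l j \<cdot>\<^bsub>ftgt F\<^esub> h = m j)))"

text \<open>Up to isomorphism, every finite category has natural numbers as objects and arrows.\<close>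

definition has_finite_limits :: "('o, 'a) cat \<Rightarrow> bool" where
  "has_finite_limits C \<longleftrightarrow>
    (\<forall>(J :: (nat, nat) cat) F. finite (Ob J) \<and> finite (Ar J) \<and> functor_between J C F \<longrightarrow>
      (\<exists>L l. is_limit_cone F L l))"

definition is_pullback :: "('o, 'a) cat \<Rightarrow> 'a \<Rightarrow> 'a \<Rightarrow> 'a \<Rightarrow> 'a \<Rightarrow> bool" where
  "is_pullback C f g p q \<longleftrightarrow>
    p \<in> hom C (Dom C p) (Dom C f) \<and> q \<in> hom C (Dom C p) (Dom C g) \<and> f \<cdot>\<^bsub>C\<^esub> p = g \<cdot>\<^bsub>C\<^esub> q
    \<and> (\<forall>z a b. a \<in> hom C z (Dom C f) \<and> b \<in> hom C z (Dom C g) \<and> f \<cdot>\<^bsub>C\<^esub> a = g \<cdot>\<^bsub>C\<^esub> b \<longrightarrow>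
         (\<exists>!h. h \<in> hom C z (Dom C p) \<and> p \<cdot>\<^bsub>C\<^esub> h = a \<and> q \<cdot>\<^bsub>C\<^esub> h = b))"

text \<open>A choice \<open>pb\<close> of pullbacks returns the pair of projections of the pullback of a cospan.\<close>

definition pullback_choice :: "('o, 'a) cat \<Rightarrow> ('a \<Rightarrow> 'a \<Rightarrow> 'a \<times> 'a) \<Rightarrow> bool" where
  "pullback_choice C pb \<longleftrightarrow> (\<forall>f \<in> Ar C. \<forall>g \<in> Ar C. Cod C f = Cod C g \<longrightarrow>
    is_pullback C f g (fst (pb f g)) (snd (pb f g)))"

definition pbob :: "('o, 'a) cat \<Rightarrow> ('a \<Rightarrow> 'a \<Rightarrow> 'a \<times> 'a) \<Rightarrow> 'a \<Rightarrow> 'a \<Rightarrow> 'o" where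
  "pbob C pb f g = Dom C (fst (pb f g))"

text \<open>The arrow \<open>\<langle>a, b\<rangle>\<close> into the chosen pullback of \<open>f\<close> and \<open>g\<close>.\<close>

definition pbpair ::
  "('o, 'a) cat \<Rightarrow> ('a \<Rightarrow> 'a \<Rightarrow> 'a \<times> 'a) \<Rightarrow> 'a \<Rightarrow> 'a \<Rightarrow> 'a \<Rightarrow> 'a \<Rightarrow> 'a" where
  "pbpair C pb f g a b = (THE h. h \<in> hom C (Dom C a) (pbob C pb f g)
    \<and> fst (pb f g) \<cdot>\<^bsub>C\<^esub> h = a \<and> snd (pb f g) \<cdot>\<^bsub>C\<^esub> h = b)"

text \<open>The arrow \<open>a \<times> b\<close> from the chosen pullback of \<open>f, g\<close> to that of \<open>f', g'\<close>.\<close>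

definition pbmap ::
  "('o, 'a) cat \<Rightarrow> ('a \<Rightarrow> 'a \<Rightarrow> 'a \<times> 'a) \<Rightarrow> 'a \<Rightarrow> 'a \<Rightarrow> 'a \<Rightarrow> 'a \<Rightarrow> 'a \<Rightarrow> 'a \<Rightarrow> 'a" where
  "pbmap C pb f g f' g' a b =
    pbpair C pb f' g' (a \<cdot>\<^bsub>C\<^esub> fst (pb f g)) (b \<cdot>\<^bsub>C\<^esub> snd (pb f g))"


section \<open>Internal categories and their actions\<close>

record ('o, 'a) icat =
  iob :: 'o
  iar :: 'o
  isrc :: 'a
  itgt :: 'a
  iid :: 'a
  icomp :: 'a

text \<open>
  For \<open>\<gamma> : X \<rightarrow> D\<^sub>0\<close>: the arrow \<open>t \<pi>\<^sub>1 : D\<^sub>1 \<times> X \<rightarrow> D\<^sub>0\<close>; the canonical isomorphism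
  \<open>D\<^sub>1 \<times> (D\<^sub>1 \<times> X) \<rightarrow> (D\<^sub>1 \<times> D\<^sub>1) \<times> X\<close>; and its composite with \<open>comp \<times> id\<close>.
\<close>

definition act_tgt ::
  "('o, 'a) cat \<Rightarrow> ('a \<Rightarrow> 'a \<Rightarrow> 'a \<times> 'a) \<Rightarrow> ('o, 'a) icat \<Rightarrow> 'a \<Rightarrow> 'a" where
  "act_tgt C pb D \<gamma> = itgt D \<cdot>\<^bsub>C\<^esub> fst (pb (isrc D) \<gamma>)"

definition act_assoc ::
  "('o, 'a) cat \<Rightarrow> ('a \<Rightarrow> 'a \<Rightarrow> 'a \<times> 'a) \<Rightarrow> ('o, 'a) icat \<Rightarrow> 'a \<Rightarrow> 'a" where
  "act_assoc C pb D \<gamma> =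
    (let p = fst (pb (isrc D) (act_tgt C pb D \<gamma>)); q = snd (pb (isrc D) (act_tgt C pb D \<gamma>))
     in pbpair C pb (isrc D \<cdot>\<^bsub>C\<^esub> snd (pb (isrc D) (itgt D))) \<gamma>
          (pbpair C pb (isrc D) (itgt D) p (fst (pb (isrc D) \<gamma>) \<cdot>\<^bsub>C\<^esub> q))
          (snd (pb (isrc D) \<gamma>) \<cdot>\<^bsub>C\<^esub> q))"

definition act_mult ::
  "('o, 'a) cat \<Rightarrow> ('a \<Rightarrow> 'a \<Rightarrow> 'a \<times> 'a) \<Rightarrow> ('o, 'a) icat \<Rightarrow> 'a \<Rightarrow> 'a" where
  "act_mult C pb D \<gamma> =
    pbmap C pb (isrc D \<cdot>\<^bsub>C\<^esub> snd (pb (isrc D) (itgt D))) \<gamma> (isrc D) \<gamma> (icomp D) (Id C (Dom C \<gamma>))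
      \<cdot>\<^bsub>C\<^esub> act_assoc C pb D \<gamma>"

text \<open>The last conjunct is associativity of \<open>comp\<close>; it is the case \<open>\<gamma> = t\<close> of the above.\<close>

definition internal_category ::
  "('o, 'a) cat \<Rightarrow> ('a \<Rightarrow> 'a \<Rightarrow> 'a \<times> 'a) \<Rightarrow> ('o, 'a) icat \<Rightarrow> bool" where
  "internal_category C pb D \<longleftrightarrow> iob D \<in> Ob C \<and> iar D \<in> Ob C
    \<and> isrc D \<in> hom C (iar D) (iob D) \<and> itgt D \<in> hom C (iar D) (iob D)
    \<and> iid D \<in> hom C (iob D) (iar D)
    \<and> icomp D \<in> hom C (pbob C pb (isrc D) (itgt D)) (iar D)
    \<and> isrc D \<cdot>\<^bsub>C\<^esub> iid D = Id C (iob D) \<and> itgt D \<cdot>\<^bsub>C\<^esub> iid D = Id C (iob D)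
    \<and> isrc D \<cdot>\<^bsub>C\<^esub> icomp D = isrc D \<cdot>\<^bsub>C\<^esub> snd (pb (isrc D) (itgt D))
    \<and> itgt D \<cdot>\<^bsub>C\<^esub> icomp D = itgt D \<cdot>\<^bsub>C\<^esub> fst (pb (isrc D) (itgt D))
    \<and> icomp D \<cdot>\<^bsub>C\<^esub> pbpair C pb (isrc D) (itgt D) (iid D \<cdot>\<^bsub>C\<^esub> itgt D) (Id C (iar D)) = Id C (iar D)
    \<and> icomp D \<cdot>\<^bsub>C\<^esub> pbpair C pb (isrc D) (itgt D) (Id C (iar D)) (iid D \<cdot>\<^bsub>C\<^esub> isrc D) = Id C (iar D)
    \<and> icomp D \<cdot>\<^bsub>C\<^esub> act_mult C pb D (itgt D) =
        icomp D \<cdot>\<^bsub>C\<^esub> pbmap C pb (isrc D) (act_tgt C pb D (itgt D)) (isrc D) (itgt D)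
                       (Id C (iar D)) (icomp D)"

record ('o, 'a) ifun =
  ifsrc :: "('o, 'a) icat"
  iftgt :: "('o, 'a) icat"
  ifob :: 'a
  ifar :: 'a

definition internal_functor ::
  "('o, 'a) cat \<Rightarrow> ('a \<Rightarrow> 'a \<Rightarrow> 'a \<times> 'a) \<Rightarrow> ('o, 'a) ifun \<Rightarrow> bool" where
  "internal_functor C pb F \<longleftrightarrow> (let D = ifsrc F; E = iftgt F in
    internal_category C pb D \<and> internal_category C pb E
    \<and> ifob F \<in> hom C (iob D) (iob E) \<and> ifar F \<in> hom C (iar D) (iar E)
    \<and> isrc E \<cdot>\<^bsub>C\<^esub> ifar F = ifob F \<cdot>\<^bsub>C\<^esub> isrc D
    \<and> itgt E \<cdot>\<^bsub>C\<^esub> ifar F = ifob F \<cdot>\<^bsub>C\<^esub> itgt D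
    \<and> ifar F \<cdot>\<^bsub>C\<^esub> iid D = iid E \<cdot>\<^bsub>C\<^esub> ifob F
    \<and> ifar F \<cdot>\<^bsub>C\<^esub> icomp D =
        icomp E \<cdot>\<^bsub>C\<^esub> pbmap C pb (isrc D) (itgt D) (isrc E) (itgt E) (ifar F) (ifar F))"

definition INT_CAT ::
  "('o, 'a) cat \<Rightarrow> ('a \<Rightarrow> 'a \<Rightarrow> 'a \<times> 'a) \<Rightarrow> (('o, 'a) icat, ('o, 'a) ifun) cat" where
  "INT_CAT C pb = \<lparr>Ob = {D. internal_category C pb D}, Ar = {F. internal_functor C pb F},
    Dom = ifsrc, Cod = iftgt,
    Id = (\<lambda>D. \<lparr>ifsrc = D, iftgt = D, ifob = Id C (iob D), ifar = Id C (iar D)\<rparr>),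
    Comp = (\<lambda>G F. \<lparr>ifsrc = ifsrc F, iftgt = iftgt G,
                   ifob = ifob G \<cdot>\<^bsub>C\<^esub> ifob F, ifar = ifar G \<cdot>\<^bsub>C\<^esub> ifar F\<rparr>)\<rparr>"

definition is_action ::
  "('o, 'a) cat \<Rightarrow> ('a \<Rightarrow> 'a \<Rightarrow> 'a \<times> 'a) \<Rightarrow> ('o, 'a) icat \<Rightarrow> 'o \<times> 'a \<times> 'a \<Rightarrow> bool" where
  "is_action C pb D = (\<lambda>(X, \<gamma>, \<xi>).
    X \<in> Ob C \<and> \<gamma> \<in> hom C X (iob D) \<and> \<xi> \<in> hom C (pbob C pb (isrc D) \<gamma>) X
    \<and> \<gamma> \<cdot>\<^bsub>C\<^esub> \<xi> = itgt D \<cdot>\<^bsub>C\<^esub> fst (pb (isrc D) \<gamma>)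
    \<and> \<xi> \<cdot>\<^bsub>C\<^esub> pbpair C pb (isrc D) \<gamma> (iid D \<cdot>\<^bsub>C\<^esub> \<gamma>) (Id C X) = Id C X
    \<and> \<xi> \<cdot>\<^bsub>C\<^esub> act_mult C pb D \<gamma> =
        \<xi> \<cdot>\<^bsub>C\<^esub> pbmap C pb (isrc D) (act_tgt C pb D \<gamma>) (isrc D) \<gamma> (Id C (iar D)) \<xi>)"

text \<open>Arrows of categories of structured objects are triples (source, underlying arrow, target).\<close>

definition ACT ::
  "('o, 'a) cat \<Rightarrow> ('a \<Rightarrow> 'a \<Rightarrow> 'a \<times> 'a) \<Rightarrow> ('o, 'a) icat \<Rightarrow>
   ('o \<times> 'a \<times> 'a, ('o \<times> 'a \<times> 'a) \<times> 'a \<times> ('o \<times> 'a \<times> 'a)) cat" where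
  "ACT C pb D = \<lparr>Ob = {A. is_action C pb D A},
    Ar = {((X, \<gamma>, \<xi>), f, (X', \<gamma>', \<xi>')) | X \<gamma> \<xi> f X' \<gamma>' \<xi>'.
            is_action C pb D (X, \<gamma>, \<xi>) \<and> is_action C pb D (X', \<gamma>', \<xi>')
            \<and> f \<in> hom C X X' \<and> \<gamma>' \<cdot>\<^bsub>C\<^esub> f = \<gamma>
            \<and> f \<cdot>\<^bsub>C\<^esub> \<xi> = \<xi>' \<cdot>\<^bsub>C\<^esub> pbmap C pb (isrc D) \<gamma> (isrc D) \<gamma>' (Id C (iar D)) f},
    Dom = (\<lambda>(A, f, B). A), Cod = (\<lambda>(A, f, B). B),
    Id = (\<lambda>A. (A, Id C (fst A), A)),
    Comp = (\<lambda>(A', g, B') (A, f, B). (A, g \<cdot>\<^bsub>C\<^esub> f, B'))\<rparr>"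


section \<open>Adjunctions, monads, comorphisms of monads\<close>

record ('o, 'a, 'p, 'b) radj =
  ra_fun :: "('p, 'b, 'o, 'a) functr"
  ra_unit :: "'o \<Rightarrow> 'a"
  ra_counit :: "'p \<Rightarrow> 'b"

definition right_adjoint ::
  "('o, 'a, 'p, 'b) functr \<Rightarrow> ('o, 'a, 'p, 'b) radj \<Rightarrow> bool" where
  "right_adjoint F r \<longleftrightarrow> (let G = ra_fun r; \<iota> = ra_unit r; \<epsilon> = ra_counit r in
    functor_between (fsrc F) (ftgt F) F \<and> functor_between (ftgt F) (fsrc F) G
    \<and> nat_trans (id_functr (fsrc F)) (comp_functr G F) \<iota>
    \<and> nat_trans (comp_functr F G) (id_functr (ftgt F)) \<epsilon>
    \<and> (\<forall>x \<in> Ob (fsrc F). \<epsilon> (fob F x) \<cdot>\<^bsub>ftgt F\<^esub> far F (\<iota> x) = Id (ftgt F) (fob F x))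
    \<and> (\<forall>y \<in> Ob (ftgt F). far G (\<epsilon> y) \<cdot>\<^bsub>fsrc F\<^esub> \<iota> (fob G y) = Id (fsrc F) (fob G y)))"

definition id_radj :: "('o, 'a) cat \<Rightarrow> ('o, 'a, 'o, 'a) radj" where
  "id_radj A = \<lparr>ra_fun = id_functr A, ra_unit = (\<lambda>x\<in>Ob A. Id A x), ra_counit = (\<lambda>x\<in>Ob A. Id A x)\<rparr>"

text \<open>The composite of the adjunctions \<open>F' \<stileturn> r'\<close> and \<open>F \<stileturn> r\<close>, right adjoint to \<open>F' \<circ> F\<close>.\<close>

definition comp_radj ::
  "('p, 'b, 'q, 'c) functr \<Rightarrow> ('p, 'b, 'q, 'c) radj \<Rightarrow>
   ('o, 'a, 'p, 'b) functr \<Rightarrow> ('o, 'a, 'p, 'b) radj \<Rightarrow> ('o, 'a, 'q, 'c) radj" where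
  "comp_radj F' r' F r = \<lparr>ra_fun = comp_functr (ra_fun r) (ra_fun r'),
    ra_unit = (\<lambda>x\<in>Ob (fsrc F). far (ra_fun r) (ra_unit r' (fob F x)) \<cdot>\<^bsub>fsrc F\<^esub> ra_unit r x),
    ra_counit = (\<lambda>z\<in>Ob (ftgt F').
      ra_counit r' z \<cdot>\<^bsub>ftgt F'\<^esub> far F' (ra_counit r (fob (ra_fun r') z)))\<rparr>"

record ('o, 'a) monad =
  mfun :: "('o, 'a, 'o, 'a) functr"
  munit :: "'o \<Rightarrow> 'a"
  mmult :: "'o \<Rightarrow> 'a"

abbreviation mcat :: "('o, 'a) monad \<Rightarrow> ('o, 'a) cat" where
  "mcat T \<equiv> fsrc (mfun T)"

definition is_monad :: "('o, 'a) monad \<Rightarrow> bool" where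
  "is_monad T \<longleftrightarrow> functor_between (mcat T) (mcat T) (mfun T)
    \<and> nat_trans (id_functr (mcat T)) (mfun T) (munit T)
    \<and> nat_trans (comp_functr (mfun T) (mfun T)) (mfun T) (mmult T)
    \<and> (\<forall>x \<in> Ob (mcat T).
         mmult T x \<cdot>\<^bsub>mcat T\<^esub> munit T (fob (mfun T) x) = Id (mcat T) (fob (mfun T) x)
       \<and> mmult T x \<cdot>\<^bsub>mcat T\<^esub> far (mfun T) (munit T x) = Id (mcat T) (fob (mfun T) x)
       \<and> mmult T x \<cdot>\<^bsub>mcat T\<^esub> mmult T (fob (mfun T) x) =
           mmult T x \<cdot>\<^bsub>mcat T\<^esub> far (mfun T) (mmult T x))"

record ('o, 'a) comorphism =
  csrc :: "('o, 'a) monad"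
  ctgt :: "('o, 'a) monad"
  cfun :: "('o, 'a, 'o, 'a) functr"
  cnat :: "'o \<Rightarrow> 'a"

definition is_comorphism :: "('o, 'a) comorphism \<Rightarrow> bool" where
  "is_comorphism \<phi> \<longleftrightarrow> (let T = csrc \<phi>; S = ctgt \<phi>; F = cfun \<phi>; \<chi> = cnat \<phi>; A = mcat S in
    is_monad T \<and> is_monad S \<and> functor_between (mcat T) A F
    \<and> nat_trans (comp_functr F (mfun T)) (comp_functr (mfun S) F) \<chi>
    \<and> (\<forall>x \<in> Ob (mcat T).
         \<chi> x \<cdot>\<^bsub>A\<^esub> far F (munit T x) = munit S (fob F x)
       \<and> \<chi> x \<cdot>\<^bsub>A\<^esub> far F (mmult T x) =
           mmult S (fob F x) \<cdot>\<^bsub>A\<^esub> far (mfun S) (\<chi> x) \<cdot>\<^bsub>A\<^esub> \<chi> (fob (mfun T) x)))"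

text \<open>
  The category of monads and comorphisms with left adjoint underlying functor; as for
  \<open>CAT\<close>, the underlying categories have objects and arrows in two given types.
\<close>

definition MND_co_adj :: "(('o, 'a) monad, ('o, 'a) comorphism) cat" where
  "MND_co_adj = \<lparr>Ob = {T. is_monad T},
    Ar = {\<phi>. is_comorphism \<phi> \<and> (\<exists>r. right_adjoint (cfun \<phi>) r)},
    Dom = csrc, Cod = ctgt,
    Id = (\<lambda>T. \<lparr>csrc = T, ctgt = T, cfun = id_functr (mcat T),
                cnat = (\<lambda>x\<in>Ob (mcat T). Id (mcat T) (fob (mfun T) x))\<rparr>),
    Comp = (\<lambda>\<psi> \<phi>. \<lparr>csrc = csrc \<phi>, ctgt = ctgt \<psi>, cfun = comp_functr (cfun \<psi>) (cfun \<phi>),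
                cnat = (\<lambda>x\<in>Ob (mcat (csrc \<phi>)).
                  cnat \<psi> (fob (cfun \<phi>) x) \<cdot>\<^bsub>mcat (ctgt \<psi>)\<^esub> far (cfun \<psi>) (cnat \<phi> x))\<rparr>)\<rparr>"

text \<open>A choice of right adjoints (with unit and counit) for all left adjoints in \<open>MND_co_adj\<close>.\<close>

definition right_adjoint_choice ::
  "(('o, 'a, 'o, 'a) functr \<Rightarrow> ('o, 'a, 'o, 'a) radj) \<Rightarrow> bool" where
  "right_adjoint_choice R \<longleftrightarrow> (\<forall>\<phi> \<in> Ar MND_co_adj. right_adjoint (cfun \<phi>) (R (cfun \<phi>)))"

text \<open>
  The choice is strictly compatible with identities and composition along a functor into
  \<open>MND_co_adj\<close>.
\<close>

definition split_along ::
  "('p, 'b, ('o, 'a) monad, ('o, 'a) comorphism) functr \<Rightarrow>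
   (('o, 'a, 'o, 'a) functr \<Rightarrow> ('o, 'a, 'o, 'a) radj) \<Rightarrow> bool" where
  "split_along K R \<longleftrightarrow>
    (\<forall>d \<in> Ob (fsrc K). R (id_functr (mcat (fob K d))) = id_radj (mcat (fob K d)))
    \<and> (\<forall>f \<in> Ar (fsrc K). \<forall>g \<in> Ar (fsrc K). Dom (fsrc K) g = Cod (fsrc K) f \<longrightarrow>
        (let F = cfun (far K f); F' = cfun (far K g)
         in R (comp_functr F' F) = comp_radj F' (R F') F (R F)))"


section \<open>Pseudofunctors into \<open>CAT\<close>\<close>

text \<open>
  Pseudofunctors from an ordinary category to the 2-category of categories, with invertible
  comparison cells \<open>ps_unit b : Id \<Rightarrow> P(id\<^sub>b)\<close> and \<open>ps_comp g f : P(g) \<circ> P(f) \<Rightarrow> P(g \<circ> f)\<close>.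
\<close>

record ('o, 'a, 'p, 'b) psfun =
  ps_ob :: "'o \<Rightarrow> ('p, 'b) cat"
  ps_ar :: "'a \<Rightarrow> ('p, 'b, 'p, 'b) functr"
  ps_unit :: "'o \<Rightarrow> 'p \<Rightarrow> 'b"
  ps_comp :: "'a \<Rightarrow> 'a \<Rightarrow> 'p \<Rightarrow> 'b"

definition pseudofunctor :: "('o, 'a) cat \<Rightarrow> ('o, 'a, 'p, 'b) psfun \<Rightarrow> bool" where
  "pseudofunctor B P \<longleftrightarrow> category B
    \<and> (\<forall>b \<in> Ob B. category (ps_ob P b))
    \<and> (\<forall>f \<in> Ar B. functor_between (ps_ob P (Dom B f)) (ps_ob P (Cod B f)) (ps_ar P f))
    \<and> (\<forall>b \<in> Ob B. nat_iso (id_functr (ps_ob P b)) (ps_ar P (Id B b)) (ps_unit P b))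
    \<and> (\<forall>f \<in> Ar B. \<forall>g \<in> Ar B. Dom B g = Cod B f \<longrightarrow>
         nat_iso (comp_functr (ps_ar P g) (ps_ar P f)) (ps_ar P (g \<cdot>\<^bsub>B\<^esub> f)) (ps_comp P g f))
    \<and> (\<forall>f \<in> Ar B. \<forall>x \<in> Ob (ps_ob P (Dom B f)).
         ps_comp P f (Id B (Dom B f)) x \<cdot>\<^bsub>ps_ob P (Cod B f)\<^esub> far (ps_ar P f) (ps_unit P (Dom B f) x)
           = Id (ps_ob P (Cod B f)) (fob (ps_ar P f) x)
       \<and> ps_comp P (Id B (Cod B f)) f x \<cdot>\<^bsub>ps_ob P (Cod B f)\<^esub> ps_unit P (Cod B f) (fob (ps_ar P f) x)
           = Id (ps_ob P (Cod B f)) (fob (ps_ar P f) x))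
    \<and> (\<forall>f \<in> Ar B. \<forall>g \<in> Ar B. \<forall>h \<in> Ar B. Dom B g = Cod B f \<and> Dom B h = Cod B g \<longrightarrow>
         (\<forall>x \<in> Ob (ps_ob P (Dom B f)).
            ps_comp P (h \<cdot>\<^bsub>B\<^esub> g) f x \<cdot>\<^bsub>ps_ob P (Cod B h)\<^esub> ps_comp P h g (fob (ps_ar P f) x)
          = ps_comp P h (g \<cdot>\<^bsub>B\<^esub> f) x \<cdot>\<^bsub>ps_ob P (Cod B h)\<^esub> far (ps_ar P h) (ps_comp P g f x)))"

text \<open>The composite of a pseudofunctor with an ordinary functor.\<close>

definition ps_precomp ::
  "('p, 'b, 'q, 'c) psfun \<Rightarrow> ('o, 'a, 'p, 'b) functr \<Rightarrow> ('o, 'a, 'q, 'c) psfun" where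
  "ps_precomp P K = \<lparr>ps_ob = (\<lambda>x. ps_ob P (fob K x)), ps_ar = (\<lambda>f. ps_ar P (far K f)),
    ps_unit = (\<lambda>x. ps_unit P (fob K x)), ps_comp = (\<lambda>g f. ps_comp P (far K g) (far K f))\<rparr>"

text \<open>
  Strictly natural isomorphisms of pseudofunctors: families of isomorphisms of categories
  commuting on the nose with the functors and the comparison cells.
\<close>

definition ps_isomorphism ::
  "('o, 'a) cat \<Rightarrow> ('o, 'a, 'p, 'b) psfun \<Rightarrow> ('o, 'a, 'q, 'c) psfun \<Rightarrow>
   ('o \<Rightarrow> ('p, 'b, 'q, 'c) functr) \<Rightarrow> bool" where
  "ps_isomorphism B P Q \<Phi> \<longleftrightarrow>
    (\<forall>b \<in> Ob B. cat_isomorphism (ps_ob P b) (ps_ob Q b) (\<Phi> b))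
    \<and> (\<forall>f \<in> Ar B. comp_functr (\<Phi> (Cod B f)) (ps_ar P f) = comp_functr (ps_ar Q f) (\<Phi> (Dom B f)))
    \<and> (\<forall>b \<in> Ob B. \<forall>x \<in> Ob (ps_ob P b). ps_unit Q b (fob (\<Phi> b) x) = far (\<Phi> b) (ps_unit P b x))
    \<and> (\<forall>f \<in> Ar B. \<forall>g \<in> Ar B. Dom B g = Cod B f \<longrightarrow> (\<forall>x \<in> Ob (ps_ob P (Dom B f)).
         ps_comp Q g f (fob (\<Phi> (Dom B f)) x) = far (\<Phi> (Cod B g)) (ps_comp P g f x)))"

text \<open>The assignment underlying a pseudofunctor, as a candidate for an ordinary functor.\<close>

definition ps_functr ::
  "('o, 'a) cat \<Rightarrow> ('o, 'a, 'p, 'b) psfun \<Rightarrow> ('o, 'a, ('p, 'b) cat, ('p, 'b, 'p, 'b) functr) functr"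
  where
  "ps_functr B P = \<lparr>fsrc = B, ftgt = CAT, fob = restrict (ps_ob P) (Ob B),
    far = restrict (ps_ar P) (Ar B)\<rparr>"


section \<open>Eilenberg-Moore categories and \<open>Alg(-)\<close>\<close>

definition is_algebra :: "('o, 'a) monad \<Rightarrow> 'o \<times> 'a \<Rightarrow> bool" where
  "is_algebra T = (\<lambda>(Y, b). Y \<in> Ob (mcat T) \<and> b \<in> hom (mcat T) (fob (mfun T) Y) Y
    \<and> b \<cdot>\<^bsub>mcat T\<^esub> munit T Y = Id (mcat T) Y
    \<and> b \<cdot>\<^bsub>mcat T\<^esub> mmult T Y = b \<cdot>\<^bsub>mcat T\<^esub> far (mfun T) b)"

definition ALG :: "('o, 'a) monad \<Rightarrow> ('o \<times> 'a, ('o \<times> 'a) \<times> 'a \<times> ('o \<times> 'a)) cat" where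
  "ALG T = \<lparr>Ob = {A. is_algebra T A},
    Ar = {((Y, b), f, (Y', b')) | Y b f Y' b'. is_algebra T (Y, b) \<and> is_algebra T (Y', b')
            \<and> f \<in> hom (mcat T) Y Y' \<and> f \<cdot>\<^bsub>mcat T\<^esub> b = b' \<cdot>\<^bsub>mcat T\<^esub> far (mfun T) f},
    Dom = (\<lambda>(A, f, B). A), Cod = (\<lambda>(A, f, B). B),
    Id = (\<lambda>A. (A, Id (mcat T) (fst A), A)),
    Comp = (\<lambda>(A', g, B') (A, f, B). (A, g \<cdot>\<^bsub>mcat T\<^esub> f, B'))\<rparr>"

definition mate :: "('o, 'a) comorphism \<Rightarrow> ('o, 'a, 'o, 'a) radj \<Rightarrow> 'o \<Rightarrow> 'a" where
  "mate \<phi> r Y = (let T = csrc \<phi>; S = ctgt \<phi>; G = ra_fun r in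
    far G (far (mfun S) (ra_counit r Y))
      \<cdot>\<^bsub>mcat T\<^esub> far G (cnat \<phi> (fob G Y))
      \<cdot>\<^bsub>mcat T\<^esub> ra_unit r (fob (mfun T) (fob G Y)))"

definition alg_ob :: "('o, 'a) comorphism \<Rightarrow> ('o, 'a, 'o, 'a) radj \<Rightarrow> 'o \<times> 'a \<Rightarrow> 'o \<times> 'a" where
  "alg_ob \<phi> r = (\<lambda>(Y, b).
    (fob (ra_fun r) Y, far (ra_fun r) b \<cdot>\<^bsub>mcat (csrc \<phi>)\<^esub> mate \<phi> r Y))"

definition alg_functr ::
  "('o, 'a) comorphism \<Rightarrow> ('o, 'a, 'o, 'a) radj \<Rightarrow>
   ('o \<times> 'a, ('o \<times> 'a) \<times> 'a \<times> ('o \<times> 'a), 'o \<times> 'a, ('o \<times> 'a) \<times> 'a \<times> ('o \<times> 'a)) functr" where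
  "alg_functr \<phi> r = \<lparr>fsrc = ALG (ctgt \<phi>), ftgt = ALG (csrc \<phi>),
    fob = restrict (alg_ob \<phi> r) (Ob (ALG (ctgt \<phi>))),
    far = (\<lambda>(A, f, B)\<in>Ar (ALG (ctgt \<phi>)). (alg_ob \<phi> r A, far (ra_fun r) f, alg_ob \<phi> r B))\<rparr>"

text \<open>
  \<open>Alg(-)\<close> for a choice \<open>R\<close> of right adjoints, as a pseudofunctor on the opposite of
  \<open>MND_co_adj\<close>. The comparison cells are the canonical ones between right adjoints of the same
  functor: \<open>\<iota>\<^sub>Y : Y \<rightarrow> G\<^sub>i\<^sub>d Y\<close> and
  \<open>G''(\<epsilon>'\<^sub>Y \<circ> F'(\<epsilon>\<^bsub>G'Y\<^esub>)) \<circ> \<iota>''\<^bsub>GG'Y\<^esub> : G G' Y \<rightarrow> G'' Y\<close>, where \<open>G, G', G''\<close> are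
  the chosen right adjoints of \<open>F, F', F' \<circ> F\<close>.
  In \<open>ps_comp \<phi> \<phi>'\<close>, \<open>\<phi>'\<close> is applied first in the opposite category, so the composite
  comorphism is \<open>\<phi>' \<circ> \<phi>\<close>.
\<close>

definition ALG_ps ::
  "(('o, 'a, 'o, 'a) functr \<Rightarrow> ('o, 'a, 'o, 'a) radj) \<Rightarrow>
   (('o, 'a) monad, ('o, 'a) comorphism, 'o \<times> 'a, ('o \<times> 'a) \<times> 'a \<times> ('o \<times> 'a)) psfun" where
  "ALG_ps R = \<lparr>ps_ob = ALG, ps_ar = (\<lambda>\<phi>. alg_functr \<phi> (R (cfun \<phi>))),
    ps_unit = (\<lambda>T. \<lambda>A\<in>Ob (ALG T).
      (let \<phi> = Id MND_co_adj T; r = R (cfun \<phi>) in (A, ra_unit r (fst A), alg_ob \<phi> r A))),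
    ps_comp = (\<lambda>\<phi> \<phi>'. \<lambda>A\<in>Ob (ALG (ctgt \<phi>')).
      (let \<psi> = \<phi>' \<cdot>\<^bsub>MND_co_adj\<^esub> \<phi>; r = R (cfun \<phi>); r' = R (cfun \<phi>'); r'' = R (cfun \<psi>);
           Y = fst A; Y' = fob (ra_fun r') Y
       in (alg_ob \<phi> r (alg_ob \<phi>' r' A),
           far (ra_fun r'') (ra_counit r' Y \<cdot>\<^bsub>mcat (ctgt \<phi>')\<^esub> far (cfun \<phi>') (ra_counit r Y'))
             \<cdot>\<^bsub>mcat (csrc \<phi>)\<^esub> ra_unit r'' (fob (ra_fun r) Y'),
           alg_ob \<psi> r'' A)))\<rparr>"


section \<open>The monad of an internal category\<close>

text \<open>An object of the slice over \<open>x\<close> is an arrow with codomain \<open>x\<close>.\<close>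

definition slice :: "('o, 'a) cat \<Rightarrow> 'o \<Rightarrow> ('a, 'a \<times> 'a \<times> 'a) cat" where
  "slice C x = \<lparr>Ob = {\<gamma> \<in> Ar C. Cod C \<gamma> = x},
    Ar = {(\<gamma>, f, \<gamma>'). \<gamma> \<in> Ar C \<and> Cod C \<gamma> = x \<and> \<gamma>' \<in> Ar C \<and> Cod C \<gamma>' = x
            \<and> f \<in> hom C (Dom C \<gamma>) (Dom C \<gamma>') \<and> \<gamma>' \<cdot>\<^bsub>C\<^esub> f = \<gamma>},
    Dom = (\<lambda>(\<gamma>, f, \<gamma>'). \<gamma>), Cod = (\<lambda>(\<gamma>, f, \<gamma>'). \<gamma>'),
    Id = (\<lambda>\<gamma>. (\<gamma>, Id C (Dom C \<gamma>), \<gamma>)),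
    Comp = (\<lambda>(\<gamma>', g, \<gamma>'') (\<gamma>, f, \<delta>). (\<gamma>, g \<cdot>\<^bsub>C\<^esub> f, \<gamma>''))\<rparr>"

definition T_monad ::
  "('o, 'a) cat \<Rightarrow> ('a \<Rightarrow> 'a \<Rightarrow> 'a \<times> 'a) \<Rightarrow> ('o, 'a) icat \<Rightarrow> ('a, 'a \<times> 'a \<times> 'a) monad" where
  "T_monad C pb D = (let E = slice C (iob D); T = act_tgt C pb D in
    \<lparr>mfun = \<lparr>fsrc = E, ftgt = E, fob = restrict T (Ob E),
       far = (\<lambda>(\<gamma>, f, \<gamma>')\<in>Ar E. (T \<gamma>, pbmap C pb (isrc D) \<gamma> (isrc D) \<gamma>' (Id C (iar D)) f, T \<gamma>'))\<rparr>,
     munit = (\<lambda>\<gamma>\<in>Ob E. (\<gamma>, pbpair C pb (isrc D) \<gamma> (iid D \<cdot>\<^bsub>C\<^esub> \<gamma>) (Id C (Dom C \<gamma>)), T \<gamma>)),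
     mmult = (\<lambda>\<gamma>\<in>Ob E. (T (T \<gamma>), act_mult C pb D \<gamma>, T \<gamma>))\<rparr>)"

definition postcomp :: "('o, 'a) cat \<Rightarrow> 'a \<Rightarrow> ('a, 'a \<times> 'a \<times> 'a, 'a, 'a \<times> 'a \<times> 'a) functr" where
  "postcomp C u = \<lparr>fsrc = slice C (Dom C u), ftgt = slice C (Cod C u),
    fob = (\<lambda>\<gamma>\<in>Ob (slice C (Dom C u)). u \<cdot>\<^bsub>C\<^esub> \<gamma>),
    far = (\<lambda>(\<gamma>, f, \<gamma>')\<in>Ar (slice C (Dom C u)). (u \<cdot>\<^bsub>C\<^esub> \<gamma>, f, u \<cdot>\<^bsub>C\<^esub> \<gamma>'))\<rparr>"

definition T_comorphism ::
  "('o, 'a) cat \<Rightarrow> ('a \<Rightarrow> 'a \<Rightarrow> 'a \<times> 'a) \<Rightarrow> ('o, 'a) ifun \<Rightarrow> ('a, 'a \<times> 'a \<times> 'a) comorphism" where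
  "T_comorphism C pb F = (let D = ifsrc F; E = iftgt F in
    \<lparr>csrc = T_monad C pb D, ctgt = T_monad C pb E, cfun = postcomp C (ifob F),
     cnat = (\<lambda>\<gamma>\<in>Ob (slice C (iob D)).
       (ifob F \<cdot>\<^bsub>C\<^esub> act_tgt C pb D \<gamma>,
        pbmap C pb (isrc D) \<gamma> (isrc E) (ifob F \<cdot>\<^bsub>C\<^esub> \<gamma>) (ifar F) (Id C (Dom C \<gamma>)),
        act_tgt C pb E (ifob F \<cdot>\<^bsub>C\<^esub> \<gamma>)))\<rparr>)"

definition T_functr ::
  "('o, 'a) cat \<Rightarrow> ('a \<Rightarrow> 'a \<Rightarrow> 'a \<times> 'a) \<Rightarrow>
   (('o, 'a) icat, ('o, 'a) ifun,
    ('a, 'a \<times> 'a \<times> 'a) monad, ('a, 'a \<times> 'a \<times> 'a) comorphism) functr" where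
  "T_functr C pb = \<lparr>fsrc = INT_CAT C pb, ftgt = MND_co_adj,
    fob = restrict (T_monad C pb) (Ob (INT_CAT C pb)),
    far = restrict (T_comorphism C pb) (Ar (INT_CAT C pb))\<rparr>"

text \<open>
  The evident isomorphism from algebras to actions. The structure map of an algebra is an
  arrow of the slice, i.e. a triple \<open>(t \<pi>\<^sub>1, \<xi>, \<gamma>)\<close>, of which an action retains \<open>\<xi>\<close>.
\<close>

definition alg_to_act ::
  "('o, 'a) cat \<Rightarrow> ('a \<Rightarrow> 'a \<Rightarrow> 'a \<times> 'a) \<Rightarrow> ('o, 'a) icat \<Rightarrow>
   ('a \<times> ('a \<times> 'a \<times> 'a),
    ('a \<times> ('a \<times> 'a \<times> 'a)) \<times> ('a \<times> 'a \<times> 'a) \<times> ('a \<times> ('a \<times> 'a \<times> 'a)),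
    'o \<times> 'a \<times> 'a, ('o \<times> 'a \<times> 'a) \<times> 'a \<times> ('o \<times> 'a \<times> 'a)) functr" where
  "alg_to_act C pb D = (let A = ALG (T_monad C pb D);
      \<Phi> = (\<lambda>(\<gamma>, (_, \<xi>, _)). (Dom C \<gamma>, \<gamma>, \<xi>)) in
    \<lparr>fsrc = A, ftgt = ACT C pb D, fob = restrict \<Phi> (Ob A),
     far = (\<lambda>(M, (_, f, _), N)\<in>Ar A. (\<Phi> M, f, \<Phi> N))\<rparr>)"

end

theory Submission
  imports Defs
begin

text \<open>
  The two functors \<open>Alg(-)\<close> and \<open>T\<close> are treated separately, and \<open>Act(-)\<close> is obtained from their composite
  by transport along the isomorphisms between algebras and actions.

  For \<open>Alg(-)\<close>, the idea is to replace an arrow \<open>k : X \<rightarrow> G y\<close> into the image of a right adjoint by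
  its transpose \<open>\<epsilon> \<circ> F k : F X \<rightarrow> y\<close>, which determines it (\<open>transpose_inject\<close>). The structure map of
  \<open>Alg(F, \<chi>)(Y, b)\<close> has transpose \<open>b \<circ> S \<epsilon> \<circ> \<chi>\<close> (\<open>alg_ob_transpose\<close>). On transposes the laws of an
  algebra become the laws of the comorphism \<open>\<chi>\<close> combined with those of \<open>b\<close>. Two right adjoints of
  \<open>F\<close> are related by a comparison isomorphism, the arrow whose transpose is a counit; it is a
  morphism of algebras by the same formula. If one uses the identity adjunction for an identity and
  the composite adjunction for a composite, then \<open>Alg\<close> is strictly functorial (\<open>alg_functr_id\<close>,
  \<open>alg_functr_comp\<close>). For an arbitrary choice of right adjoints the unit and composition cells are
  therefore comparisons from these adjunctions to the chosen ones, and the coherence laws follow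
  from three identities between comparisons (\<open>comparison_id_left\<close>, \<open>comparison_id_right\<close>,
  \<open>comparison_comp_assoc\<close>), each checked on transposes. For a choice that is split along \<open>T\<close> the
  strict laws apply directly, and \<open>Act(-)\<close> is an ordinary functor.

  For \<open>T\<close>, an arrow into a pullback is a pair of arrows, and the axioms of an internal category say
  that its generalised elements \<open>Z \<rightarrow> D\<^sub>1\<close> have a unital and associative partial composition. In
  these terms the monad sends \<open>X\<close> to pairs \<open>(a, x)\<close>, with unit \<open>x \<mapsto> (1, x)\<close> and multiplication
  \<open>(a, (b, x)) \<mapsto> (a \<circ> b, x)\<close>, and an internal functor acts by \<open>(a, x) \<mapsto> (F\<^sub>1 a, x)\<close>. The laws of monads
  and comorphisms are then immediate, and \<open>F\<^sub>0 \<circ> -\<close> is a left adjoint because pullbacks provide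
  universal arrows (\<open>postcomp_right_adjoint\<close>). An algebra for this monad is an action up to the
  bookkeeping of triples in the slice category (\<open>algebra_iff_action\<close>).
\<close>

section \<open>Categories, functors and natural transformations\<close>
lemma hom_iff: "f \<in> hom C x y \<longleftrightarrow> f \<in> Ar C \<and> Dom C f = x \<and> Cod C f = y"
  by (simp add: hom_def)

text \<open>
  The rules below ask for membership in the set of arrows and for matching endpoints, instead of
  membership in a hom-set with named endpoints. The simplifier discharges such conditions by
  itself, so it normalises every well-typed composite to its right-nested form.
\<close>

context category
begin

lemma comp_ar [simp]:
  assumes "f \<in> Ar C" "g \<in> Ar C" "Dom C g = Cod C f"
  shows "g \<cdot>\<^bsub>C\<^esub> f \<in> Ar C" "Dom C (g \<cdot>\<^bsub>C\<^esub> f) = Dom C f" "Cod C (g \<cdot>\<^bsub>C\<^esub> f) = Cod C g"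
  using comp_hom[of f "Dom C f" "Cod C f" g "Cod C g"] assms by (simp_all add: hom_iff)

lemma id_ar [simp]:
  assumes "x \<in> Ob C"
  shows "Id C x \<in> Ar C" "Dom C (Id C x) = x" "Cod C (Id C x) = x"
  using id_hom[OF assms] by (simp_all add: hom_iff)

lemma id_comp [simp]: "f \<in> Ar C \<Longrightarrow> Cod C f = x \<Longrightarrow> Id C x \<cdot>\<^bsub>C\<^esub> f = f"
  using id_left[of f "Dom C f" x] by (simp add: hom_iff)

lemma comp_id [simp]: "f \<in> Ar C \<Longrightarrow> Dom C f = x \<Longrightarrow> f \<cdot>\<^bsub>C\<^esub> Id C x = f"
  using id_right[of f x "Cod C f"] by (simp add: hom_iff)

lemma comp_assoc [simp]:
  assumes "f \<in> Ar C" "g \<in> Ar C" "h \<in> Ar C" "Dom C g = Cod C f" "Dom C h = Cod C g"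
  shows "(h \<cdot>\<^bsub>C\<^esub> g) \<cdot>\<^bsub>C\<^esub> f = h \<cdot>\<^bsub>C\<^esub> (g \<cdot>\<^bsub>C\<^esub> f)"
  using assoc[of f "Dom C f" "Cod C f" g "Cod C g" h "Cod C h"] assms by (simp add: hom_iff)

declare dom_closed [simp] cod_closed [simp]

text \<open>
  In right-nested form the factor \<open>a \<cdot> b\<close> of a longer composite is not a subterm; this is the shape
  in which an equation \<open>a \<cdot> b = c\<close> can still be applied there.
\<close>

lemma comp_eq_extend:
  assumes "a \<cdot>\<^bsub>C\<^esub> b = c" "a \<in> Ar C" "b \<in> Ar C" "Dom C a = Cod C b"
    and "z \<in> Ar C" "Cod C z = Dom C b"
  shows "a \<cdot>\<^bsub>C\<^esub> (b \<cdot>\<^bsub>C\<^esub> z) = c \<cdot>\<^bsub>C\<^esub> z"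
  using assms comp_assoc[of z b a] by simp

lemma is_isoI:
  assumes "f \<in> hom C x y" "g \<in> hom C y x" "g \<cdot>\<^bsub>C\<^esub> f = Id C x" "f \<cdot>\<^bsub>C\<^esub> g = Id C y"
  shows "is_iso C f"
  using assms unfolding is_iso_def by (metis hom_iff)

end

lemma categoryI:
  assumes "\<And>f. f \<in> Ar C \<Longrightarrow> Dom C f \<in> Ob C" "\<And>f. f \<in> Ar C \<Longrightarrow> Cod C f \<in> Ob C"
    and "\<And>x. x \<in> Ob C \<Longrightarrow> Id C x \<in> Ar C \<and> Dom C (Id C x) = x \<and> Cod C (Id C x) = x"
    and "\<And>f g. \<lbrakk>f \<in> Ar C; g \<in> Ar C; Dom C g = Cod C f\<rbrakk> \<Longrightarrow>
      g \<cdot>\<^bsub>C\<^esub> f \<in> Ar C \<and> Dom C (g \<cdot>\<^bsub>C\<^esub> f) = Dom C f \<and> Cod C (g \<cdot>\<^bsub>C\<^esub> f) = Cod C g"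
    and "\<And>f. f \<in> Ar C \<Longrightarrow> f \<cdot>\<^bsub>C\<^esub> Id C (Dom C f) = f"
    and "\<And>f. f \<in> Ar C \<Longrightarrow> Id C (Cod C f) \<cdot>\<^bsub>C\<^esub> f = f"
    and "\<And>f g h. \<lbrakk>f \<in> Ar C; g \<in> Ar C; h \<in> Ar C; Dom C g = Cod C f; Dom C h = Cod C g\<rbrakk> \<Longrightarrow>
      (h \<cdot>\<^bsub>C\<^esub> g) \<cdot>\<^bsub>C\<^esub> f = h \<cdot>\<^bsub>C\<^esub> (g \<cdot>\<^bsub>C\<^esub> f)"
  shows "category C"
  by unfold_locales (use assms in \<open>auto simp: hom_iff\<close>)

lemma op_cat_simps [simp]:
  "Ob (op_cat C) = Ob C" "Ar (op_cat C) = Ar C" "Dom (op_cat C) = Cod C" "Cod (op_cat C) = Dom C"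
  "Id (op_cat C) = Id C" "g \<cdot>\<^bsub>op_cat C\<^esub> f = f \<cdot>\<^bsub>C\<^esub> g"
  by (simp_all add: op_cat_def)

lemma category_op: "category C \<Longrightarrow> category (op_cat C)"
proof -
  assume "category C"
  then interpret category C .
  show ?thesis by (rule categoryI) auto
qed

lemma functor_betweenI:
  assumes "category A" "category B" "fsrc F = A" "ftgt F = B"
    and "fob F \<in> extensional (Ob A)" "far F \<in> extensional (Ar A)"
    and "\<And>x. x \<in> Ob A \<Longrightarrow> fob F x \<in> Ob B"
    and "\<And>f. f \<in> Ar A \<Longrightarrow> far F f \<in> Ar B \<and> Dom B (far F f) = fob F (Dom A f)
           \<and> Cod B (far F f) = fob F (Cod A f)"
    and "\<And>x. x \<in> Ob A \<Longrightarrow> far F (Id A x) = Id B (fob F x)"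
    and "\<And>f g. \<lbrakk>f \<in> Ar A; g \<in> Ar A; Dom A g = Cod A f\<rbrakk> \<Longrightarrow>
      far F (g \<cdot>\<^bsub>A\<^esub> f) = far F g \<cdot>\<^bsub>B\<^esub> far F f"
  shows "functor_between A B F"
  using assms unfolding functor_between_def is_functor_def PiE_def by auto

lemma functor_between_cat:
  assumes "functor_between A B F"
  shows "category A" "category B"
  using assms by (auto simp: functor_between_def is_functor_def)

lemma functor_between_is_functor:
  assumes "functor_between A B F"
  shows "is_functor F" "fsrc F = A" "ftgt F = B"
  using assms by (auto simp: functor_between_def)

lemma functor_between_ext:
  assumes "functor_between A B F"
  shows "fob F \<in> extensional (Ob A)" "far F \<in> extensional (Ar A)"
  using assms by (auto simp: functor_between_def is_functor_def PiE_def)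

lemma functor_between_simps:
  assumes "functor_between A B F"
  shows "fsrc F = A" "ftgt F = B"
    and "\<And>x. x \<in> Ob A \<Longrightarrow> fob F x \<in> Ob B"
    and "\<And>f. f \<in> Ar A \<Longrightarrow> far F f \<in> Ar B"
    and "\<And>f. f \<in> Ar A \<Longrightarrow> Dom B (far F f) = fob F (Dom A f)"
    and "\<And>f. f \<in> Ar A \<Longrightarrow> Cod B (far F f) = fob F (Cod A f)"
    and "\<And>x. x \<in> Ob A \<Longrightarrow> far F (Id A x) = Id B (fob F x)"
    and "\<And>f g. f \<in> Ar A \<Longrightarrow> g \<in> Ar A \<Longrightarrow> Dom A g = Cod A f \<Longrightarrow>
       far F (g \<cdot>\<^bsub>A\<^esub> f) = far F g \<cdot>\<^bsub>B\<^esub> far F f"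
  using assms by (auto simp: functor_between_def is_functor_def PiE_def)

lemma functor_between_eqI:
  assumes "functor_between A B F" "functor_between A B G"
    and "\<And>x. x \<in> Ob A \<Longrightarrow> fob F x = fob G x" "\<And>f. f \<in> Ar A \<Longrightarrow> far F f = far G f"
  shows "F = G"
proof -
  have "fob F = fob G" "far F = far G"
    using functor_between_ext[OF assms(1)] functor_between_ext[OF assms(2)] assms(3,4)
    by (auto intro: extensionalityI)
  then show ?thesis using functor_between_is_functor[OF assms(1)] functor_between_is_functor[OF assms(2)]
    by (cases F; cases G) simp
qed

lemma comp_functr_simps [simp]:
  "fsrc (comp_functr G F) = fsrc F" "ftgt (comp_functr G F) = ftgt G"
  "x \<in> Ob (fsrc F) \<Longrightarrow> fob (comp_functr G F) x = fob G (fob F x)"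
  "f \<in> Ar (fsrc F) \<Longrightarrow> far (comp_functr G F) f = far G (far F f)"
  by (simp_all add: comp_functr_def compose_def)

lemma id_functr_simps [simp]:
  "fsrc (id_functr A) = A" "ftgt (id_functr A) = A"
  "x \<in> Ob A \<Longrightarrow> fob (id_functr A) x = x"
  "f \<in> Ar A \<Longrightarrow> far (id_functr A) f = f"
  by (simp_all add: id_functr_def)

lemma functor_between_comp:
  assumes "functor_between A B F" "functor_between B D G"
  shows "functor_between A D (comp_functr G F)"
proof -
  note FS = functor_between_simps[OF assms(1)] functor_between_simps[OF assms(2)]
  interpret A: category A by (rule functor_between_cat[OF assms(1)])
  show ?thesis
    by (rule functor_betweenI)
      (use assms in \<open>auto simp: FS functor_between_cat comp_functr_def compose_def\<close>)
qed

lemma functor_between_id: "category A \<Longrightarrow> functor_between A A (id_functr A)"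
proof -
  assume "category A"
  then interpret category A .
  show ?thesis by (rule functor_betweenI) (auto simp: category_axioms id_functr_def)
qed

lemma comp_functr_id:
  assumes "functor_between A B F"
  shows "comp_functr F (id_functr A) = F" "comp_functr (id_functr B) F = F"
proof -
  note FS = functor_between_simps[OF assms]
  show "comp_functr F (id_functr A) = F"
    by (rule functor_between_eqI[OF functor_between_comp[OF functor_between_id assms] assms])
      (use functor_between_cat[OF assms] in \<open>auto simp: FS\<close>)
  show "comp_functr (id_functr B) F = F"
    by (rule functor_between_eqI[OF functor_between_comp[OF assms functor_between_id] assms])
      (use functor_between_cat[OF assms] in \<open>auto simp: FS\<close>)
qed

lemma comp_functr_assoc:
  assumes "functor_between A B F" "functor_between B D G" "functor_between D E H"
  shows "comp_functr (comp_functr H G) F = comp_functr H (comp_functr G F)"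
proof -
  note FS = functor_between_simps[OF assms(1)] functor_between_simps[OF assms(2)]
  note comp = functor_between_comp
  show ?thesis
    by (rule functor_between_eqI[OF comp[OF assms(1) comp[OF assms(2,3)]]
          comp[OF comp[OF assms(1,2)] assms(3)]]) (auto simp: FS)
qed

lemma category_CAT: "category (CAT :: (('o, 'a) cat, ('o, 'a, 'o, 'a) functr) cat)"
proof -
  have fb: "functor_between (fsrc F) (ftgt F) F" if "is_functor F" for F :: "('o, 'a, 'o, 'a) functr"
    using that by (simp add: functor_between_def)
  show ?thesis
  proof (rule categoryI, goal_cases)
    case (1 f) then show ?case using functor_between_cat[OF fb] by (simp add: CAT_def)
  next
    case (2 f) then show ?case using functor_between_cat[OF fb] by (simp add: CAT_def)
  next
    case (3 x) then show ?case
      using functor_between_is_functor[OF functor_between_id] by (simp add: CAT_def)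
  next
    case (4 f g)
    then have "functor_between (fsrc f) (ftgt g) (comp_functr g f)"
      using functor_between_comp fb by (fastforce simp: CAT_def)
    then show ?case using functor_between_is_functor by (auto simp: CAT_def)
  next
    case (5 f) then show ?case using comp_functr_id[OF fb] by (simp add: CAT_def)
  next
    case (6 f) then show ?case using comp_functr_id[OF fb] by (simp add: CAT_def)
  next
    case (7 f g h)
    then have "functor_between (fsrc f) (ftgt f) f" "functor_between (ftgt f) (ftgt g) g"
      "functor_between (ftgt g) (ftgt h) h" by (auto simp: CAT_def functor_between_def)
    then show ?case using comp_functr_assoc by (simp add: CAT_def)
  qed
qed

lemma functor_between_op:
  assumes "functor_between A B F"
  shows "functor_between (op_cat A) (op_cat B) (op_functr F)"
  by (rule functor_betweenI)
    (use functor_between_cat[OF assms] functor_between_ext[OF assms] in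
      \<open>auto simp: functor_between_simps[OF assms] op_functr_def category_op\<close>)

lemma nat_transI:
  assumes "functor_between A B F" "functor_between A B G" "\<tau> \<in> extensional (Ob A)"
    and "\<And>x. x \<in> Ob A \<Longrightarrow> \<tau> x \<in> hom B (fob F x) (fob G x)"
    and "\<And>f. f \<in> Ar A \<Longrightarrow> \<tau> (Cod A f) \<cdot>\<^bsub>B\<^esub> far F f = far G f \<cdot>\<^bsub>B\<^esub> \<tau> (Dom A f)"
  shows "nat_trans F G \<tau>"
  using assms by (auto simp: nat_trans_def functor_between_def)

lemma nat_trans_simps:
  assumes "nat_trans F G \<tau>" "functor_between A B F"
  shows "\<And>x. x \<in> Ob A \<Longrightarrow> \<tau> x \<in> Ar B"
    and "\<And>x. x \<in> Ob A \<Longrightarrow> Dom B (\<tau> x) = fob F x"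
    and "\<And>x. x \<in> Ob A \<Longrightarrow> Cod B (\<tau> x) = fob G x"
    and "\<tau> \<in> extensional (Ob A)"
  using assms by (auto simp: nat_trans_def functor_between_def hom_iff)

lemma nat_trans_natural:
  assumes "nat_trans F G \<tau>" "functor_between A B F" "f \<in> Ar A" "Dom A f = x" "Cod A f = y"
  shows "\<tau> y \<cdot>\<^bsub>B\<^esub> far F f = far G f \<cdot>\<^bsub>B\<^esub> \<tau> x"
  using assms by (auto simp: nat_trans_def functor_between_def)

section \<open>Adjunctions and comparison of right adjoints\<close>
locale adjunction =
  fixes A :: "('o, 'a) cat" and B :: "('p, 'b) cat" and F and r :: "('o, 'a, 'p, 'b) radj"
  assumes F_functor: "functor_between A B F" and adj: "right_adjoint F r"
begin

abbreviation G where "G \<equiv> ra_fun r"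
abbreviation \<iota> where "\<iota> \<equiv> ra_unit r"
abbreviation \<epsilon> where "\<epsilon> \<equiv> ra_counit r"

lemmas F_simps [simp] = functor_between_simps[OF F_functor]

lemma G_functor: "functor_between B A G"
  using adj by (simp add: right_adjoint_def Let_def)

lemmas G_simps [simp] = functor_between_simps[OF G_functor]

sublocale A: category A by (rule functor_between_cat[OF F_functor])
sublocale B: category B by (rule functor_between_cat[OF F_functor])

lemma unit_nat: "nat_trans (id_functr A) (comp_functr G F) \<iota>"
  and counit_nat: "nat_trans (comp_functr F G) (id_functr B) \<epsilon>"
  using adj by (simp_all add: right_adjoint_def Let_def)

lemma unit_simps [simp]:
  assumes "x \<in> Ob A"
  shows "\<iota> x \<in> Ar A" "Dom A (\<iota> x) = x" "Cod A (\<iota> x) = fob G (fob F x)"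
  using nat_trans_simps[OF unit_nat functor_between_id[OF A.category_axioms]] assms by simp_all

lemma counit_simps [simp]:
  assumes "y \<in> Ob B"
  shows "\<epsilon> y \<in> Ar B" "Dom B (\<epsilon> y) = fob F (fob G y)" "Cod B (\<epsilon> y) = y"
  using nat_trans_simps[OF counit_nat functor_between_comp[OF G_functor F_functor]] assms by simp_all

lemma unit_natural:
  "f \<in> Ar A \<Longrightarrow> \<iota> (Cod A f) \<cdot>\<^bsub>A\<^esub> f = far G (far F f) \<cdot>\<^bsub>A\<^esub> \<iota> (Dom A f)"
  using nat_trans_natural[OF unit_nat functor_between_id[OF A.category_axioms]] by simp

lemma counit_natural:
  "f \<in> Ar B \<Longrightarrow> \<epsilon> (Cod B f) \<cdot>\<^bsub>B\<^esub> far F (far G f) = f \<cdot>\<^bsub>B\<^esub> \<epsilon> (Dom B f)"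
  using nat_trans_natural[OF counit_nat functor_between_comp[OF G_functor F_functor]] by simp

lemma triangle_F [simp]: "x \<in> Ob A \<Longrightarrow> \<epsilon> (fob F x) \<cdot>\<^bsub>B\<^esub> far F (\<iota> x) = Id B (fob F x)"
  and triangle_G [simp]: "y \<in> Ob B \<Longrightarrow> far G (\<epsilon> y) \<cdot>\<^bsub>A\<^esub> \<iota> (fob G y) = Id A (fob G y)"
  using adj by (simp_all add: right_adjoint_def Let_def)

text \<open>
  \<open>G h \<circ> \<iota>\<close> is the adjunct of \<open>h : F x \<rightarrow> y\<close>, and \<open>k \<mapsto> \<epsilon> \<circ> F k\<close>, here called transposition, is
  inverse to the passage to adjuncts, by naturality of the counit and a triangle identity.
\<close>

lemma transpose_inverse:
  assumes "h \<in> hom B (fob F x) y" "x \<in> Ob A"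
  shows "\<epsilon> y \<cdot>\<^bsub>B\<^esub> far F (far G h \<cdot>\<^bsub>A\<^esub> \<iota> x) = h"
proof -
  have h: "h \<in> Ar B" "Dom B h = fob F x" "Cod B h = y" using assms by (auto simp: hom_iff)
  then have y: "y \<in> Ob B" using B.cod_closed by blast
  have "\<epsilon> y \<cdot>\<^bsub>B\<^esub> far F (far G h \<cdot>\<^bsub>A\<^esub> \<iota> x) = (\<epsilon> y \<cdot>\<^bsub>B\<^esub> far F (far G h)) \<cdot>\<^bsub>B\<^esub> far F (\<iota> x)"
    using h y assms(2) by simp
  also have "\<dots> = (h \<cdot>\<^bsub>B\<^esub> \<epsilon> (fob F x)) \<cdot>\<^bsub>B\<^esub> far F (\<iota> x)"
    using counit_natural[of h] h by simp
  also have "\<dots> = h" using h assms(2) by simp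
  finally show ?thesis .
qed

text \<open>
  The main tool for everything that concerns right adjoints: to compare two arrows into \<open>G y\<close> it
  suffices to compare their transposes, from which the unit disappears by a triangle identity and
  images of arrows under \<open>G\<close> by naturality of the counit.
  It holds because \<open>G (\<epsilon> \<circ> F h) \<circ> \<iota> = G \<epsilon> \<circ> \<iota> \<circ> h = h\<close>.
\<close>

lemma transpose_inject:
  assumes "\<epsilon> y \<cdot>\<^bsub>B\<^esub> far F f = \<epsilon> y \<cdot>\<^bsub>B\<^esub> far F g"
    and "f \<in> hom A x (fob G y)" "g \<in> hom A x (fob G y)" "y \<in> Ob B"
  shows "f = g"
proof -
  have "far G (\<epsilon> y \<cdot>\<^bsub>B\<^esub> far F h) \<cdot>\<^bsub>A\<^esub> \<iota> x = h" if "h \<in> hom A x (fob G y)" for h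
  proof -
    have h: "h \<in> Ar A" "Dom A h = x" "Cod A h = fob G y" using that by (auto simp: hom_iff)
    then have x: "x \<in> Ob A" using A.dom_closed by blast
    have n: "far G (far F h) \<cdot>\<^bsub>A\<^esub> \<iota> x = \<iota> (fob G y) \<cdot>\<^bsub>A\<^esub> h"
      using unit_natural[OF h(1)] h by simp
    have "far G (\<epsilon> y \<cdot>\<^bsub>B\<^esub> far F h) \<cdot>\<^bsub>A\<^esub> \<iota> x = far G (\<epsilon> y) \<cdot>\<^bsub>A\<^esub> (\<iota> (fob G y) \<cdot>\<^bsub>A\<^esub> h)"
      using h x assms(4) by (simp add: n)
    also have "\<dots> = (far G (\<epsilon> y) \<cdot>\<^bsub>A\<^esub> \<iota> (fob G y)) \<cdot>\<^bsub>A\<^esub> h"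
      using h x assms(4) by (simp del: triangle_G)
    also have "\<dots> = h" using h assms(4) by simp
    finally show ?thesis .
  qed
  from this[OF assms(2)] this[OF assms(3)] show ?thesis unfolding assms(1) by (rule trans[OF sym])
qed

end

text \<open>
  The canonical isomorphism between two right adjoints of the same functor, at \<open>Y\<close>: the arrow whose
  transpose with respect to \<open>r'\<close> is the counit of \<open>r\<close>.
\<close>

definition comparison ::
  "('o, 'a) cat \<Rightarrow> ('o, 'a, 'p, 'b) radj \<Rightarrow> ('o, 'a, 'p, 'b) radj \<Rightarrow> 'p \<Rightarrow> 'a" where
  "comparison A r r' Y = far (ra_fun r') (ra_counit r Y) \<cdot>\<^bsub>A\<^esub> ra_unit r' (fob (ra_fun r) Y)"

locale two_right_adjoints = P: adjunction A B F r + Q: adjunction A B F r'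
  for A :: "('o, 'a) cat" and B :: "('p, 'b) cat" and F and r r' :: "('o, 'a, 'p, 'b) radj"
begin

lemma comparison_simps [simp]:
  assumes "Y \<in> Ob B"
  shows "comparison A r r' Y \<in> Ar A" "Dom A (comparison A r r' Y) = fob P.G Y"
    "Cod A (comparison A r r' Y) = fob Q.G Y"
  using assms by (simp_all add: comparison_def)

lemma comparison_transpose:
  "Y \<in> Ob B \<Longrightarrow> Q.\<epsilon> Y \<cdot>\<^bsub>B\<^esub> far F (comparison A r r' Y) = P.\<epsilon> Y"
  unfolding comparison_def by (rule Q.transpose_inverse) (simp_all add: hom_iff)

lemma comparison_natural:
  assumes "f \<in> Ar B"
  shows "comparison A r r' (Cod B f) \<cdot>\<^bsub>A\<^esub> far P.G f = far Q.G f \<cdot>\<^bsub>A\<^esub> comparison A r r' (Dom B f)"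
proof -
  let ?c = "comparison A r r'"
  have "Q.\<epsilon> (Cod B f) \<cdot>\<^bsub>B\<^esub> far F (?c (Cod B f) \<cdot>\<^bsub>A\<^esub> far P.G f)
      = (Q.\<epsilon> (Cod B f) \<cdot>\<^bsub>B\<^esub> far F (?c (Cod B f))) \<cdot>\<^bsub>B\<^esub> far F (far P.G f)"
    using assms by simp
  also have "\<dots> = f \<cdot>\<^bsub>B\<^esub> (Q.\<epsilon> (Dom B f) \<cdot>\<^bsub>B\<^esub> far F (?c (Dom B f)))"
    using assms P.counit_natural[OF assms] by (simp add: comparison_transpose)
  also have "\<dots> = (f \<cdot>\<^bsub>B\<^esub> Q.\<epsilon> (Dom B f)) \<cdot>\<^bsub>B\<^esub> far F (?c (Dom B f))"
    using assms by simp
  also have "\<dots> = Q.\<epsilon> (Cod B f) \<cdot>\<^bsub>B\<^esub> far F (far Q.G f \<cdot>\<^bsub>A\<^esub> ?c (Dom B f))"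
    unfolding Q.counit_natural[OF assms, symmetric] using assms by simp
  finally show ?thesis
    by (rule Q.transpose_inject[where x = "fob P.G (Dom B f)" and y = "Cod B f"])
      (use assms in \<open>simp_all add: hom_iff\<close>)
qed

text \<open>
  The transpose of the composite is the counit of \<open>r\<close> at \<open>Y\<close>, which is also the transpose of the
  identity. Exchanging the two adjoints gives the other composite.
\<close>

lemma comparison_inverse:
  assumes "Y \<in> Ob B"
  shows "comparison A r' r Y \<cdot>\<^bsub>A\<^esub> comparison A r r' Y = Id A (fob P.G Y)"
proof -
  interpret I: two_right_adjoints A B F r' r by unfold_locales
  have "P.\<epsilon> Y \<cdot>\<^bsub>B\<^esub> far F (comparison A r' r Y \<cdot>\<^bsub>A\<^esub> comparison A r r' Y)
      = (P.\<epsilon> Y \<cdot>\<^bsub>B\<^esub> far F (comparison A r' r Y)) \<cdot>\<^bsub>B\<^esub> far F (comparison A r r' Y)"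
    using assms by simp
  also have "\<dots> = P.\<epsilon> Y \<cdot>\<^bsub>B\<^esub> far F (Id A (fob P.G Y))"
    using assms by (simp add: I.comparison_transpose comparison_transpose)
  finally show ?thesis
    by (rule P.transpose_inject[where x = "fob P.G Y" and y = Y])
      (use assms in \<open>simp_all add: hom_iff\<close>)
qed

end

lemma right_adjointI:
  assumes "functor_between A B F" "functor_between B A (ra_fun r)"
    and "ra_unit r \<in> extensional (Ob A)" "ra_counit r \<in> extensional (Ob B)"
    and "\<And>x. x \<in> Ob A \<Longrightarrow> ra_unit r x \<in> hom A x (fob (ra_fun r) (fob F x))"
    and "\<And>y. y \<in> Ob B \<Longrightarrow> ra_counit r y \<in> hom B (fob F (fob (ra_fun r) y)) y"
    and "\<And>f. f \<in> Ar A \<Longrightarrow>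
      ra_unit r (Cod A f) \<cdot>\<^bsub>A\<^esub> f = far (ra_fun r) (far F f) \<cdot>\<^bsub>A\<^esub> ra_unit r (Dom A f)"
    and "\<And>f. f \<in> Ar B \<Longrightarrow>
      ra_counit r (Cod B f) \<cdot>\<^bsub>B\<^esub> far F (far (ra_fun r) f) = f \<cdot>\<^bsub>B\<^esub> ra_counit r (Dom B f)"
    and "\<And>x. x \<in> Ob A \<Longrightarrow> ra_counit r (fob F x) \<cdot>\<^bsub>B\<^esub> far F (ra_unit r x) = Id B (fob F x)"
    and "\<And>y. y \<in> Ob B \<Longrightarrow>
      far (ra_fun r) (ra_counit r y) \<cdot>\<^bsub>A\<^esub> ra_unit r (fob (ra_fun r) y) = Id A (fob (ra_fun r) y)"
  shows "right_adjoint F r"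
proof -
  note FS = functor_between_simps[OF assms(1)] functor_between_simps[OF assms(2)]
  note cats = functor_between_cat[OF assms(1)]
  interpret A: category A by (rule cats)
  interpret B: category B by (rule cats)
  have "nat_trans (id_functr A) (comp_functr (ra_fun r) F) (ra_unit r)"
    by (rule nat_transI[OF functor_between_id[OF cats(1)] functor_between_comp[OF assms(1,2)]])
      (use assms(3,5,7) in \<open>simp_all add: FS\<close>)
  moreover have "nat_trans (comp_functr F (ra_fun r)) (id_functr B) (ra_counit r)"
    by (rule nat_transI[OF functor_between_comp[OF assms(2,1)] functor_between_id[OF cats(2)]])
      (use assms(4,6,8) in \<open>simp_all add: FS\<close>)
  ultimately show ?thesis using assms(1,2,9,10) by (simp add: right_adjoint_def Let_def FS)
qed

lemma right_adjoint_id: "category A \<Longrightarrow> right_adjoint (id_functr A) (id_radj A)"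
proof -
  assume "category A"
  then interpret category A .
  show ?thesis
    by (rule right_adjointI[of A A])
      (auto simp: id_radj_def functor_between_id category_axioms hom_iff)
qed

lemma right_adjoint_comp:
  assumes "adjunction A B F r" "adjunction B D F' r'"
  shows "right_adjoint (comp_functr F' F) (comp_radj F' r' F r)"
proof -
  interpret P: adjunction A B F r by fact
  interpret Q: adjunction B D F' r' by fact
  show ?thesis
  proof (rule right_adjointI[of A D], goal_cases)
    case 1 show ?case by (rule functor_between_comp[OF P.F_functor Q.F_functor])
  next
    case 2 show ?case
      using functor_between_comp[OF Q.G_functor P.G_functor] by (simp add: comp_radj_def)
  next
    case f: (7 f)
    have "(far P.G (Q.\<iota> (fob F (Cod A f))) \<cdot>\<^bsub>A\<^esub> P.\<iota> (Cod A f)) \<cdot>\<^bsub>A\<^esub> f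
        = far P.G (Q.\<iota> (fob F (Cod A f))) \<cdot>\<^bsub>A\<^esub> (far P.G (far F f) \<cdot>\<^bsub>A\<^esub> P.\<iota> (Dom A f))"
      using f P.unit_natural[OF f] by simp
    also have "\<dots> = far P.G (Q.\<iota> (fob F (Cod A f)) \<cdot>\<^bsub>B\<^esub> far F f) \<cdot>\<^bsub>A\<^esub> P.\<iota> (Dom A f)"
      using f by simp
    also have "Q.\<iota> (fob F (Cod A f)) \<cdot>\<^bsub>B\<^esub> far F f
        = far Q.G (far F' (far F f)) \<cdot>\<^bsub>B\<^esub> Q.\<iota> (fob F (Dom A f))"
      using f Q.unit_natural[of "far F f"] by simp
    finally show ?case using f by (simp add: comp_radj_def)
  next
    case f: (8 f)
    have "(Q.\<epsilon> (Cod D f) \<cdot>\<^bsub>D\<^esub> far F' (P.\<epsilon> (fob Q.G (Cod D f)))) \<cdot>\<^bsub>D\<^esub> far F' (far F (far P.G (far Q.G f)))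
        = Q.\<epsilon> (Cod D f) \<cdot>\<^bsub>D\<^esub> far F' (P.\<epsilon> (fob Q.G (Cod D f)) \<cdot>\<^bsub>B\<^esub> far F (far P.G (far Q.G f)))"
      using f by simp
    also have "P.\<epsilon> (fob Q.G (Cod D f)) \<cdot>\<^bsub>B\<^esub> far F (far P.G (far Q.G f))
        = far Q.G f \<cdot>\<^bsub>B\<^esub> P.\<epsilon> (fob Q.G (Dom D f))"
      using f P.counit_natural[of "far Q.G f"] by simp
    also have "Q.\<epsilon> (Cod D f) \<cdot>\<^bsub>D\<^esub> far F' (far Q.G f \<cdot>\<^bsub>B\<^esub> P.\<epsilon> (fob Q.G (Dom D f)))
        = (Q.\<epsilon> (Cod D f) \<cdot>\<^bsub>D\<^esub> far F' (far Q.G f)) \<cdot>\<^bsub>D\<^esub> far F' (P.\<epsilon> (fob Q.G (Dom D f)))"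
      using f by simp
    also have "Q.\<epsilon> (Cod D f) \<cdot>\<^bsub>D\<^esub> far F' (far Q.G f) = f \<cdot>\<^bsub>D\<^esub> Q.\<epsilon> (Dom D f)"
      by (rule Q.counit_natural[OF f])
    finally show ?case using f by (simp add: comp_radj_def)
  next
    case x: (9 x)
    have "(Q.\<epsilon> (fob F' (fob F x)) \<cdot>\<^bsub>D\<^esub> far F' (P.\<epsilon> (fob Q.G (fob F' (fob F x))))) \<cdot>\<^bsub>D\<^esub>
           far F' (far F (far P.G (Q.\<iota> (fob F x)) \<cdot>\<^bsub>A\<^esub> P.\<iota> x))
       = Q.\<epsilon> (fob F' (fob F x)) \<cdot>\<^bsub>D\<^esub> far F' (P.\<epsilon> (fob Q.G (fob F' (fob F x))) \<cdot>\<^bsub>B\<^esub>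
           far F (far P.G (Q.\<iota> (fob F x)) \<cdot>\<^bsub>A\<^esub> P.\<iota> x))"
      using x by simp
    also have "\<dots> = Id D (fob F' (fob F x))"
      using x by (subst P.transpose_inverse) (auto simp: hom_iff)
    finally show ?case using x by (simp add: comp_radj_def)
  next
    case z: (10 z)
    let ?y = "fob Q.G z" let ?x = "fob P.G ?y"
    have n: "Q.\<iota> ?y \<cdot>\<^bsub>B\<^esub> P.\<epsilon> ?y = far Q.G (far F' (P.\<epsilon> ?y)) \<cdot>\<^bsub>B\<^esub> Q.\<iota> (fob F ?x)"
      using Q.unit_natural[of "P.\<epsilon> ?y"] z by simp
    have "far P.G (far Q.G (Q.\<epsilon> z \<cdot>\<^bsub>D\<^esub> far F' (P.\<epsilon> ?y))) \<cdot>\<^bsub>A\<^esub> (far P.G (Q.\<iota> (fob F ?x)) \<cdot>\<^bsub>A\<^esub> P.\<iota> ?x)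
        = far P.G (far Q.G (Q.\<epsilon> z) \<cdot>\<^bsub>B\<^esub> (far Q.G (far F' (P.\<epsilon> ?y)) \<cdot>\<^bsub>B\<^esub> Q.\<iota> (fob F ?x))) \<cdot>\<^bsub>A\<^esub> P.\<iota> ?x"
      using z by simp
    also have "\<dots> = far P.G ((far Q.G (Q.\<epsilon> z) \<cdot>\<^bsub>B\<^esub> Q.\<iota> ?y) \<cdot>\<^bsub>B\<^esub> P.\<epsilon> ?y) \<cdot>\<^bsub>A\<^esub> P.\<iota> ?x"
      using z n by (simp del: Q.triangle_G)
    also have "\<dots> = Id A ?x" using z by simp
    finally show ?case using z by (simp add: comp_radj_def)
  qed (auto simp: comp_radj_def hom_iff)
qed

lemma (in adjunction) two_right_adjointsI:
  "right_adjoint F r' \<Longrightarrow> two_right_adjoints A B F r' r"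
  using F_functor adj by (simp add: two_right_adjoints_def adjunction_def)

lemma id_radj_simps [simp]:
  "ra_fun (id_radj A) = id_functr A"
  "x \<in> Ob A \<Longrightarrow> ra_unit (id_radj A) x = Id A x" "x \<in> Ob A \<Longrightarrow> ra_counit (id_radj A) x = Id A x"
  by (simp_all add: id_radj_def)

lemma comp_radj_simps [simp]:
  "ra_fun (comp_radj F' r' F r) = comp_functr (ra_fun r) (ra_fun r')"
  "x \<in> Ob (fsrc F) \<Longrightarrow> ra_unit (comp_radj F' r' F r) x
    = far (ra_fun r) (ra_unit r' (fob F x)) \<cdot>\<^bsub>fsrc F\<^esub> ra_unit r x"
  "z \<in> Ob (ftgt F') \<Longrightarrow> ra_counit (comp_radj F' r' F r) z
    = ra_counit r' z \<cdot>\<^bsub>ftgt F'\<^esub> far F' (ra_counit r (fob (ra_fun r') z))"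
  by (simp_all add: comp_radj_def)

text \<open>
  The next three lemmas are the coherence laws of comparisons with identity and composite
  adjunctions. In each of them both sides have the same transpose, namely a composite of counits:
  a comparison contributes the counit of its source, and an arrow of the form \<open>G c\<close> moves past a
  counit by naturality.
\<close>

lemma comparison_id_left:
  assumes "adjunction A B F r" "adjunction B B (id_functr B) s" "Y \<in> Ob B"
  shows "comparison A (comp_radj (id_functr B) s F r) r Y \<cdot>\<^bsub>A\<^esub>
      far (ra_fun r) (comparison B (id_radj B) s Y) = Id A (fob (ra_fun r) Y)"
proof -
  interpret P: adjunction A B F r by fact
  interpret J: adjunction B B "id_functr B" s by fact
  have [simp]: "comp_functr (id_functr B) F = F" by (rule comp_functr_id[OF P.F_functor])
  interpret C: two_right_adjoints A B F "comp_radj (id_functr B) s F r" r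
    by (rule P.two_right_adjointsI) (use right_adjoint_comp[OF assms(1,2)] in simp)
  interpret D: two_right_adjoints B B "id_functr B" "id_radj B" s
    by (rule J.two_right_adjointsI) (rule right_adjoint_id[OF P.B.category_axioms])
  note [simp] = assms(3)
  let ?d = "comparison B (id_radj B) s Y"
  have d: "J.\<epsilon> Y \<cdot>\<^bsub>B\<^esub> ?d = Id B Y" using D.comparison_transpose[of Y] by simp
  have "P.\<epsilon> Y \<cdot>\<^bsub>B\<^esub> far F (comparison A (comp_radj (id_functr B) s F r) r Y \<cdot>\<^bsub>A\<^esub> far P.G ?d)
      = (P.\<epsilon> Y \<cdot>\<^bsub>B\<^esub> far F (comparison A (comp_radj (id_functr B) s F r) r Y)) \<cdot>\<^bsub>B\<^esub> far F (far P.G ?d)"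
    by simp
  also have "\<dots> = J.\<epsilon> Y \<cdot>\<^bsub>B\<^esub> (P.\<epsilon> (fob J.G Y) \<cdot>\<^bsub>B\<^esub> far F (far P.G ?d))"
    unfolding C.comparison_transpose[OF assms(3)] by simp
  also have "\<dots> = (J.\<epsilon> Y \<cdot>\<^bsub>B\<^esub> ?d) \<cdot>\<^bsub>B\<^esub> P.\<epsilon> Y"
    using P.counit_natural[of ?d] by simp
  also have "\<dots> = P.\<epsilon> Y \<cdot>\<^bsub>B\<^esub> far F (Id A (fob P.G Y))" unfolding d by simp
  finally show ?thesis
    by (rule P.transpose_inject[where x = "fob P.G Y" and y = Y]) (simp_all add: hom_iff)
qed

lemma comparison_id_right:
  assumes "adjunction A B F r" "adjunction A A (id_functr A) s" "Y \<in> Ob B"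
  shows "comparison A (comp_radj F r (id_functr A) s) r Y \<cdot>\<^bsub>A\<^esub>
      comparison A (id_radj A) s (fob (ra_fun r) Y) = Id A (fob (ra_fun r) Y)"
proof -
  interpret P: adjunction A B F r by fact
  interpret J: adjunction A A "id_functr A" s by fact
  have [simp]: "comp_functr F (id_functr A) = F" by (rule comp_functr_id[OF P.F_functor])
  interpret C: two_right_adjoints A B F "comp_radj F r (id_functr A) s" r
    by (rule P.two_right_adjointsI) (use right_adjoint_comp[OF assms(2,1)] in simp)
  interpret D: two_right_adjoints A A "id_functr A" "id_radj A" s
    by (rule J.two_right_adjointsI) (rule right_adjoint_id[OF P.A.category_axioms])
  note [simp] = assms(3)
  let ?d = "comparison A (id_radj A) s (fob P.G Y)"
  have d: "J.\<epsilon> (fob P.G Y) \<cdot>\<^bsub>A\<^esub> ?d = Id A (fob P.G Y)"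
    using D.comparison_transpose[of "fob P.G Y"] by simp
  have "P.\<epsilon> Y \<cdot>\<^bsub>B\<^esub> far F (comparison A (comp_radj F r (id_functr A) s) r Y \<cdot>\<^bsub>A\<^esub> ?d)
      = (P.\<epsilon> Y \<cdot>\<^bsub>B\<^esub> far F (comparison A (comp_radj F r (id_functr A) s) r Y)) \<cdot>\<^bsub>B\<^esub> far F ?d"
    by simp
  also have "\<dots> = P.\<epsilon> Y \<cdot>\<^bsub>B\<^esub> far F (J.\<epsilon> (fob P.G Y) \<cdot>\<^bsub>A\<^esub> ?d)"
    unfolding C.comparison_transpose[OF assms(3)] by simp
  finally show ?thesis unfolding d
    by (rule P.transpose_inject[where x = "fob P.G Y" and y = Y]) (simp_all add: hom_iff)
qed

lemma comparison_comp_assoc: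
  fixes A :: "('o, 'a) cat" and B :: "('p, 'b) cat" and D :: "('q, 'c) cat" and E :: "('r, 'd) cat"
  assumes "adjunction A B F r" "adjunction B D F' r'" "adjunction D E F'' r''"
    and "adjunction A D (comp_functr F' F) s" "adjunction B E (comp_functr F'' F') s'"
    and "adjunction A E (comp_functr F'' (comp_functr F' F)) t" and "Y \<in> Ob E"
  shows "comparison A (comp_radj F'' r'' (comp_functr F' F) s) t Y \<cdot>\<^bsub>A\<^esub>
      comparison A (comp_radj F' r' F r) s (fob (ra_fun r'') Y)
    = comparison A (comp_radj (comp_functr F'' F') s' F r) t Y \<cdot>\<^bsub>A\<^esub>
      far (ra_fun r) (comparison B (comp_radj F'' r'' F' r') s' Y)"
proof -
  interpret P: adjunction A B F r by fact
  interpret P': adjunction B D F' r' by fact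
  interpret P'': adjunction D E F'' r'' by fact
  interpret S: adjunction A D "comp_functr F' F" s by fact
  interpret S': adjunction B E "comp_functr F'' F'" s' by fact
  interpret T: adjunction A E "comp_functr F'' (comp_functr F' F)" t by fact
  have eq: "comp_functr (comp_functr F'' F') F = comp_functr F'' (comp_functr F' F)"
    by (rule comp_functr_assoc[OF P.F_functor P'.F_functor P''.F_functor])
  interpret C1: two_right_adjoints A E "comp_functr F'' (comp_functr F' F)"
    "comp_radj F'' r'' (comp_functr F' F) s" t
    by (rule T.two_right_adjointsI) (use right_adjoint_comp[OF assms(4,3)] in simp)
  interpret C2: two_right_adjoints A D "comp_functr F' F" "comp_radj F' r' F r" s
    by (rule S.two_right_adjointsI) (use right_adjoint_comp[OF assms(1,2)] in simp)
  interpret C3: two_right_adjoints A E "comp_functr F'' (comp_functr F' F)"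
    "comp_radj (comp_functr F'' F') s' F r" t
    by (rule T.two_right_adjointsI) (use right_adjoint_comp[OF assms(1,5)] eq in simp)
  interpret C4: two_right_adjoints B E "comp_functr F'' F'" "comp_radj F'' r'' F' r'" s'
    by (rule S'.two_right_adjointsI) (use right_adjoint_comp[OF assms(2,3)] in simp)
  note [simp] = assms(7)
  let ?K = "far (comp_functr F'' (comp_functr F' F))"
  let ?c1 = "comparison A (comp_radj F'' r'' (comp_functr F' F) s) t Y"
  let ?c2 = "comparison A (comp_radj F' r' F r) s (fob P''.G Y)"
  let ?c3 = "comparison A (comp_radj (comp_functr F'' F') s' F r) t Y"
  let ?c4 = "comparison B (comp_radj F'' r'' F' r') s' Y"
  have t1: "T.\<epsilon> Y \<cdot>\<^bsub>E\<^esub> far F'' (far F' (far F ?c1)) = P''.\<epsilon> Y \<cdot>\<^bsub>E\<^esub> far F'' (S.\<epsilon> (fob P''.G Y))"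
    using C1.comparison_transpose[OF assms(7)] by simp
  have t2: "S.\<epsilon> (fob P''.G Y) \<cdot>\<^bsub>D\<^esub> far F' (far F ?c2)
      = P'.\<epsilon> (fob P''.G Y) \<cdot>\<^bsub>D\<^esub> far F' (P.\<epsilon> (fob P'.G (fob P''.G Y)))"
    using C2.comparison_transpose[of "fob P''.G Y"] by simp
  have t3: "T.\<epsilon> Y \<cdot>\<^bsub>E\<^esub> far F'' (far F' (far F ?c3))
      = S'.\<epsilon> Y \<cdot>\<^bsub>E\<^esub> far F'' (far F' (P.\<epsilon> (fob S'.G Y)))"
    using C3.comparison_transpose[OF assms(7)] by simp
  have t4: "S'.\<epsilon> Y \<cdot>\<^bsub>E\<^esub> far F'' (far F' ?c4) = P''.\<epsilon> Y \<cdot>\<^bsub>E\<^esub> far F'' (P'.\<epsilon> (fob P''.G Y))"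
    using C4.comparison_transpose[OF assms(7)] by simp
  have n: "P.\<epsilon> (fob S'.G Y) \<cdot>\<^bsub>B\<^esub> far F (far P.G ?c4) = ?c4 \<cdot>\<^bsub>B\<^esub> P.\<epsilon> (fob P'.G (fob P''.G Y))"
    using P.counit_natural[of ?c4] by simp
  have "T.\<epsilon> Y \<cdot>\<^bsub>E\<^esub> ?K (?c1 \<cdot>\<^bsub>A\<^esub> ?c2)
      = (T.\<epsilon> Y \<cdot>\<^bsub>E\<^esub> far F'' (far F' (far F ?c1))) \<cdot>\<^bsub>E\<^esub> far F'' (far F' (far F ?c2))"
    by simp
  also have "\<dots> = P''.\<epsilon> Y \<cdot>\<^bsub>E\<^esub> far F'' (S.\<epsilon> (fob P''.G Y) \<cdot>\<^bsub>D\<^esub> far F' (far F ?c2))"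
    unfolding t1 by simp
  also have "\<dots> = (S'.\<epsilon> Y \<cdot>\<^bsub>E\<^esub> far F'' (far F' ?c4)) \<cdot>\<^bsub>E\<^esub> far F'' (far F' (P.\<epsilon> (fob P'.G (fob P''.G Y))))"
    unfolding t2 t4 by simp
  also have "\<dots> = S'.\<epsilon> Y \<cdot>\<^bsub>E\<^esub> far F'' (far F' (P.\<epsilon> (fob S'.G Y) \<cdot>\<^bsub>B\<^esub> far F (far P.G ?c4)))"
    unfolding n by simp
  also have "\<dots> = (T.\<epsilon> Y \<cdot>\<^bsub>E\<^esub> far F'' (far F' (far F ?c3))) \<cdot>\<^bsub>E\<^esub> far F'' (far F' (far F (far P.G ?c4)))"
    unfolding t3 by simp
  also have "\<dots> = T.\<epsilon> Y \<cdot>\<^bsub>E\<^esub> ?K (?c3 \<cdot>\<^bsub>A\<^esub> far P.G ?c4)"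
    by simp
  finally show ?thesis
    by (rule T.transpose_inject[where x = "fob P.G (fob P'.G (fob P''.G Y))" and y = Y])
      (simp_all add: hom_iff)
qed

text \<open>
  A universal arrow \<open>e y : F (g y) \<rightarrow> y\<close> for every object \<open>y\<close> is enough for a right adjoint: its action
  on arrows and its unit are forced to be the unique factorisations \<open>tr\<close>, and the laws hold by
  uniqueness.
\<close>

lemma right_adjoint_exists:
  assumes F: "functor_between A B F"
    and e: "\<And>y. y \<in> Ob B \<Longrightarrow> g y \<in> Ob A \<and> e y \<in> hom B (fob F (g y)) y"
    and univ: "\<And>x y h. \<lbrakk>y \<in> Ob B; x \<in> Ob A; h \<in> hom B (fob F x) y\<rbrakk> \<Longrightarrow>
      \<exists>!k. k \<in> hom A x (g y) \<and> e y \<cdot>\<^bsub>B\<^esub> far F k = h"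
  shows "\<exists>r. right_adjoint F r"
proof -
  note FS [simp] = functor_between_simps[OF F]
  interpret A: category A by (rule functor_between_cat[OF F])
  interpret B: category B by (rule functor_between_cat[OF F])
  define tr where "tr x y h = (THE k. k \<in> hom A x (g y) \<and> e y \<cdot>\<^bsub>B\<^esub> far F k = h)" for x y h
  have tr: "tr x y h \<in> hom A x (g y)" "e y \<cdot>\<^bsub>B\<^esub> far F (tr x y h) = h"
    if "y \<in> Ob B" "x \<in> Ob A" "h \<in> hom B (fob F x) y" for x y h
    using theI'[OF univ[OF that]] unfolding tr_def by auto
  have tr_ar: "tr x y h \<in> Ar A" "Dom A (tr x y h) = x" "Cod A (tr x y h) = g y"
    if "y \<in> Ob B" "x \<in> Ob A" "h \<in> Ar B" "Dom B h = fob F x" "Cod B h = y" for x y h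
    using tr(1)[of y x h] that by (auto simp: hom_iff)
  have tr_eq: "e y \<cdot>\<^bsub>B\<^esub> far F (tr x y h) = h"
    if "y \<in> Ob B" "x \<in> Ob A" "h \<in> Ar B" "Dom B h = fob F x" "Cod B h = y" for x y h
    using tr(2)[of y x h] that by (auto simp: hom_iff)
  have inj: "k = k'" if "y \<in> Ob B" "k \<in> Ar A" "k' \<in> Ar A" "Cod A k = g y" "Cod A k' = g y"
      "Dom A k = Dom A k'" "e y \<cdot>\<^bsub>B\<^esub> far F k = e y \<cdot>\<^bsub>B\<^esub> far F k'" for k k' y
    using univ[of y "Dom A k" "e y \<cdot>\<^bsub>B\<^esub> far F k"] that e[OF that(1)] by (auto simp: hom_iff)
  have [simp]: "g y \<in> Ob A" "e y \<in> Ar B" "Dom B (e y) = fob F (g y)" "Cod B (e y) = y"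
    if "y \<in> Ob B" for y
    using e[OF that] by (auto simp: hom_iff)
  let ?G = "\<lparr>fsrc = B, ftgt = A, fob = restrict g (Ob B),
    far = (\<lambda>f\<in>Ar B. tr (g (Dom B f)) (Cod B f) (f \<cdot>\<^bsub>B\<^esub> e (Dom B f)))\<rparr>"
  let ?r = "\<lparr>ra_fun = ?G, ra_unit = (\<lambda>x\<in>Ob A. tr x (fob F x) (Id B (fob F x))), ra_counit = restrict e (Ob B)\<rparr>"
  have G: "functor_between B A ?G"
  proof (rule functor_betweenI, simp_all add: tr_ar A.category_axioms B.category_axioms, goal_cases)
    case (1 x)
    show ?case by (rule inj[of x]) (use 1 in \<open>simp_all add: tr_ar tr_eq\<close>)
  next
    case (2 f h)
    have "e (Cod B h) \<cdot>\<^bsub>B\<^esub> (far F (tr (g (Cod B f)) (Cod B h) (h \<cdot>\<^bsub>B\<^esub> e (Cod B f))) \<cdot>\<^bsub>B\<^esub>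
          far F (tr (g (Dom B f)) (Cod B f) (f \<cdot>\<^bsub>B\<^esub> e (Dom B f))))
        = (h \<cdot>\<^bsub>B\<^esub> e (Cod B f)) \<cdot>\<^bsub>B\<^esub> far F (tr (g (Dom B f)) (Cod B f) (f \<cdot>\<^bsub>B\<^esub> e (Dom B f)))"
      by (rule B.comp_eq_extend) (use 2 in \<open>simp_all add: tr_ar tr_eq\<close>)
    also have "\<dots> = h \<cdot>\<^bsub>B\<^esub> (f \<cdot>\<^bsub>B\<^esub> e (Dom B f))" using 2 by (simp add: tr_ar tr_eq)
    finally show ?case by (intro inj[of "Cod B h"]) (use 2 in \<open>simp_all add: tr_ar tr_eq\<close>)
  qed
  have "right_adjoint F ?r"
  proof (rule right_adjointI[OF F], simp_all add: G hom_iff tr_ar tr_eq, goal_cases)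
    case (1 f)
    have "e (fob F (Cod A f)) \<cdot>\<^bsub>B\<^esub> (far F (tr (g (fob F (Dom A f))) (fob F (Cod A f))
            (far F f \<cdot>\<^bsub>B\<^esub> e (fob F (Dom A f)))) \<cdot>\<^bsub>B\<^esub> far F (tr (Dom A f) (fob F (Dom A f)) (Id B (fob F (Dom A f)))))
        = (far F f \<cdot>\<^bsub>B\<^esub> e (fob F (Dom A f))) \<cdot>\<^bsub>B\<^esub> far F (tr (Dom A f) (fob F (Dom A f)) (Id B (fob F (Dom A f))))"
      by (rule B.comp_eq_extend) (use 1 in \<open>simp_all add: tr_ar tr_eq\<close>)
    also have "\<dots> = far F f" using 1 by (simp add: tr_ar tr_eq)
    moreover have "e (fob F (Cod A f)) \<cdot>\<^bsub>B\<^esub> (far F (tr (Cod A f) (fob F (Cod A f)) (Id B (fob F (Cod A f)))) \<cdot>\<^bsub>B\<^esub> far F f)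
        = Id B (fob F (Cod A f)) \<cdot>\<^bsub>B\<^esub> far F f"
      by (rule B.comp_eq_extend) (use 1 in \<open>simp_all add: tr_ar tr_eq\<close>)
    ultimately show ?case by (intro inj[of "fob F (Cod A f)"]) (use 1 in \<open>simp_all add: tr_ar\<close>)
  next
    case (2 y)
    have "e y \<cdot>\<^bsub>B\<^esub> (far F (tr (g (fob F (g y))) y (e y \<cdot>\<^bsub>B\<^esub> e (fob F (g y)))) \<cdot>\<^bsub>B\<^esub>
          far F (tr (g y) (fob F (g y)) (Id B (fob F (g y)))))
        = (e y \<cdot>\<^bsub>B\<^esub> e (fob F (g y))) \<cdot>\<^bsub>B\<^esub> far F (tr (g y) (fob F (g y)) (Id B (fob F (g y))))"
      by (rule B.comp_eq_extend) (use 2 in \<open>simp_all add: tr_ar tr_eq\<close>)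
    also have "\<dots> = e y" using 2 by (simp add: tr_ar tr_eq)
    finally show ?case by (intro inj[of y]) (use 2 in \<open>simp_all add: tr_ar\<close>)
  qed
  then show ?thesis by blast
qed

section \<open>Algebras along a comorphism\<close>
locale eilenberg_moore =
  fixes T :: "('o, 'a) monad"
  assumes monad: "is_monad T"
begin

lemma T_functor: "functor_between (mcat T) (mcat T) (mfun T)"
  using monad by (simp add: is_monad_def)

lemmas T_simps [simp] = functor_between_simps(2-)[OF T_functor]

sublocale E: category "mcat T" by (rule functor_between_cat[OF T_functor])

lemma unit_nat: "nat_trans (id_functr (mcat T)) (mfun T) (munit T)"
  and mult_nat: "nat_trans (comp_functr (mfun T) (mfun T)) (mfun T) (mmult T)"
  using monad by (simp_all add: is_monad_def)

lemma unit_simps [simp]: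
  assumes "x \<in> Ob (mcat T)"
  shows "munit T x \<in> Ar (mcat T)" "Dom (mcat T) (munit T x) = x"
    "Cod (mcat T) (munit T x) = fob (mfun T) x"
  using nat_trans_simps[OF unit_nat functor_between_id[OF E.category_axioms]] assms by simp_all

lemma mult_simps [simp]:
  assumes "x \<in> Ob (mcat T)"
  shows "mmult T x \<in> Ar (mcat T)" "Dom (mcat T) (mmult T x) = fob (mfun T) (fob (mfun T) x)"
    "Cod (mcat T) (mmult T x) = fob (mfun T) x"
  using nat_trans_simps[OF mult_nat functor_between_comp[OF T_functor T_functor]] assms by simp_all

lemma unit_natural:
  "f \<in> Ar (mcat T) \<Longrightarrow> munit T (Cod (mcat T) f) \<cdot>\<^bsub>mcat T\<^esub> f
    = far (mfun T) f \<cdot>\<^bsub>mcat T\<^esub> munit T (Dom (mcat T) f)"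
  using nat_trans_natural[OF unit_nat functor_between_id[OF E.category_axioms]] by simp

lemma mult_natural:
  "f \<in> Ar (mcat T) \<Longrightarrow> mmult T (Cod (mcat T) f) \<cdot>\<^bsub>mcat T\<^esub> far (mfun T) (far (mfun T) f)
    = far (mfun T) f \<cdot>\<^bsub>mcat T\<^esub> mmult T (Dom (mcat T) f)"
  using nat_trans_natural[OF mult_nat functor_between_comp[OF T_functor T_functor]] by simp

lemma is_algebra_iff:
  "is_algebra T (Y, b) \<longleftrightarrow> Y \<in> Ob (mcat T) \<and> b \<in> Ar (mcat T) \<and> Dom (mcat T) b = fob (mfun T) Y
    \<and> Cod (mcat T) b = Y \<and> b \<cdot>\<^bsub>mcat T\<^esub> munit T Y = Id (mcat T) Y
    \<and> b \<cdot>\<^bsub>mcat T\<^esub> mmult T Y = b \<cdot>\<^bsub>mcat T\<^esub> far (mfun T) b"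
  by (auto simp: is_algebra_def hom_iff)

lemma algebra_simps:
  assumes "is_algebra T X"
  shows "fst X \<in> Ob (mcat T)" "snd X \<in> Ar (mcat T)" "Dom (mcat T) (snd X) = fob (mfun T) (fst X)"
    "Cod (mcat T) (snd X) = fst X"
  using assms by (cases X, simp add: is_algebra_iff)+

lemma ALG_ar_iff:
  "(X, f, Z) \<in> Ar (ALG T) \<longleftrightarrow> is_algebra T X \<and> is_algebra T Z \<and> f \<in> Ar (mcat T)
    \<and> Dom (mcat T) f = fst X \<and> Cod (mcat T) f = fst Z
    \<and> f \<cdot>\<^bsub>mcat T\<^esub> snd X = snd Z \<cdot>\<^bsub>mcat T\<^esub> far (mfun T) f"
  by (cases X; cases Z) (auto simp: ALG_def hom_iff)

lemma ALG_simps [simp]: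
  "X \<in> Ob (ALG T) \<longleftrightarrow> is_algebra T X"
  "Dom (ALG T) (X, f, Z) = X" "Cod (ALG T) (X, f, Z) = Z"
  "Id (ALG T) X = (X, Id (mcat T) (fst X), X)"
  "(X', g, Z') \<cdot>\<^bsub>ALG T\<^esub> (X, f, Z) = (X, g \<cdot>\<^bsub>mcat T\<^esub> f, Z')"
  by (simp_all add: ALG_def)

lemma ALG_comp:
  assumes "(X, f, Z) \<in> Ar (ALG T)" "(Z, g, W) \<in> Ar (ALG T)"
  shows "(X, g \<cdot>\<^bsub>mcat T\<^esub> f, W) \<in> Ar (ALG T)"
proof -
  have alg: "is_algebra T X" "is_algebra T Z" "is_algebra T W"
    using assms by (simp_all add: ALG_ar_iff)
  note [simp] = alg[THEN algebra_simps(1)] alg[THEN algebra_simps(2)] alg[THEN algebra_simps(3)]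
    alg[THEN algebra_simps(4)]
  have [simp]: "f \<in> Ar (mcat T)" "Dom (mcat T) f = fst X" "Cod (mcat T) f = fst Z"
    "g \<in> Ar (mcat T)" "Dom (mcat T) g = fst Z" "Cod (mcat T) g = fst W"
    and f: "f \<cdot>\<^bsub>mcat T\<^esub> snd X = snd Z \<cdot>\<^bsub>mcat T\<^esub> far (mfun T) f"
    and g: "g \<cdot>\<^bsub>mcat T\<^esub> snd Z = snd W \<cdot>\<^bsub>mcat T\<^esub> far (mfun T) g"
    using assms by (simp_all add: ALG_ar_iff)
  have "(g \<cdot>\<^bsub>mcat T\<^esub> f) \<cdot>\<^bsub>mcat T\<^esub> snd X = (g \<cdot>\<^bsub>mcat T\<^esub> snd Z) \<cdot>\<^bsub>mcat T\<^esub> far (mfun T) f"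
    by (simp add: f)
  also have "\<dots> = snd W \<cdot>\<^bsub>mcat T\<^esub> far (mfun T) (g \<cdot>\<^bsub>mcat T\<^esub> f)"
    unfolding g by simp
  finally show ?thesis using alg by (simp add: ALG_ar_iff)
qed

lemma category_ALG: "category (ALG T)"
proof (rule categoryI, goal_cases)
  case (4 f g) then show ?case using ALG_comp by (cases f; cases g) auto
qed (auto simp: ALG_ar_iff algebra_simps)

lemma ALG_isoI:
  assumes "(X, f, Z) \<in> Ar (ALG T)" "(Z, g, X) \<in> Ar (ALG T)"
    and "g \<cdot>\<^bsub>mcat T\<^esub> f = Id (mcat T) (fst X)" "f \<cdot>\<^bsub>mcat T\<^esub> g = Id (mcat T) (fst Z)"
  shows "is_iso (ALG T) (X, f, Z)"
  by (rule category.is_isoI[OF category_ALG, where x = X and y = Z and g = "(Z, g, X)"])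
    (use assms in \<open>simp_all add: hom_iff\<close>)

end

locale comorphism_adj =
  fixes \<phi> :: "('o, 'a) comorphism" and r :: "('o, 'a, 'o, 'a) radj"
  assumes comorphism: "is_comorphism \<phi>" and right_adj: "right_adjoint (cfun \<phi>) r"
begin

abbreviation T where "T \<equiv> csrc \<phi>"
abbreviation S where "S \<equiv> ctgt \<phi>"
abbreviation F where "F \<equiv> cfun \<phi>"
abbreviation \<chi> where "\<chi> \<equiv> cnat \<phi>"
abbreviation A where "A \<equiv> mcat T"
abbreviation B where "B \<equiv> mcat S"

sublocale T: eilenberg_moore T
  using comorphism by unfold_locales (simp add: is_comorphism_def Let_def)
sublocale S: eilenberg_moore S
  using comorphism by unfold_locales (simp add: is_comorphism_def Let_def)
sublocale adjunction A B F r
  using comorphism right_adj by unfold_locales (simp_all add: is_comorphism_def Let_def)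

lemma comorphism_nat: "nat_trans (comp_functr F (mfun T)) (comp_functr (mfun S) F) \<chi>"
  using comorphism by (simp add: is_comorphism_def Let_def)

lemma comorphism_simps [simp]:
  assumes "x \<in> Ob A"
  shows "\<chi> x \<in> Ar B" "Dom B (\<chi> x) = fob F (fob (mfun T) x)" "Cod B (\<chi> x) = fob (mfun S) (fob F x)"
  using nat_trans_simps[OF comorphism_nat functor_between_comp[OF T.T_functor F_functor]] assms
  by simp_all

lemma comorphism_natural:
  "f \<in> Ar A \<Longrightarrow> \<chi> (Cod A f) \<cdot>\<^bsub>B\<^esub> far F (far (mfun T) f)
    = far (mfun S) (far F f) \<cdot>\<^bsub>B\<^esub> \<chi> (Dom A f)"
  using nat_trans_natural[OF comorphism_nat functor_between_comp[OF T.T_functor F_functor]] by simp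

lemma comorphism_unit:
  "x \<in> Ob A \<Longrightarrow> \<chi> x \<cdot>\<^bsub>B\<^esub> far F (munit T x) = munit S (fob F x)"
  and comorphism_mult:
  "x \<in> Ob A \<Longrightarrow> \<chi> x \<cdot>\<^bsub>B\<^esub> far F (mmult T x)
    = mmult S (fob F x) \<cdot>\<^bsub>B\<^esub> far (mfun S) (\<chi> x) \<cdot>\<^bsub>B\<^esub> \<chi> (fob (mfun T) x)"
  using comorphism by (simp_all add: is_comorphism_def Let_def)

lemma fst_alg_ob [simp]: "fst (alg_ob \<phi> r X) = fob G (fst X)"
  by (cases X) (simp add: alg_ob_def)

text \<open>
  The mate has the factor \<open>\<iota>\<close> on the right and is otherwise an image under \<open>G\<close>, so the structure map
  \<open>G b \<circ> \<chi>\<^sup>\<sharp>\<close> is an adjunct; its transpose is \<open>b \<circ> S \<epsilon> \<circ> \<chi>\<close>.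
\<close>

lemma
  assumes "is_algebra S X"
  shows alg_ob_struct [simp]: "snd (alg_ob \<phi> r X) \<in> Ar A" "Dom A (snd (alg_ob \<phi> r X)) = fob (mfun T) (fob G (fst X))"
    "Cod A (snd (alg_ob \<phi> r X)) = fob G (fst X)"
  and alg_ob_transpose: "\<epsilon> (fst X) \<cdot>\<^bsub>B\<^esub> far F (snd (alg_ob \<phi> r X))
    = snd X \<cdot>\<^bsub>B\<^esub> far (mfun S) (\<epsilon> (fst X)) \<cdot>\<^bsub>B\<^esub> \<chi> (fob G (fst X))"
proof -
  obtain Y b where X: "X = (Y, b)" by (cases X)
  have b [simp]: "Y \<in> Ob B" "b \<in> Ar B" "Dom B b = fob (mfun S) Y" "Cod B b = Y"
    using assms unfolding X by (simp_all add: S.is_algebra_iff)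
  let ?h = "b \<cdot>\<^bsub>B\<^esub> far (mfun S) (\<epsilon> Y) \<cdot>\<^bsub>B\<^esub> \<chi> (fob G Y)"
  have eq: "snd (alg_ob \<phi> r X) = far G ?h \<cdot>\<^bsub>A\<^esub> \<iota> (fob (mfun T) (fob G Y))"
    by (simp add: X alg_ob_def mate_def Let_def)
  show "snd (alg_ob \<phi> r X) \<in> Ar A" "Dom A (snd (alg_ob \<phi> r X)) = fob (mfun T) (fob G (fst X))"
    "Cod A (snd (alg_ob \<phi> r X)) = fob G (fst X)"
    by (simp_all add: eq) (simp_all add: X)
  show "\<epsilon> (fst X) \<cdot>\<^bsub>B\<^esub> far F (snd (alg_ob \<phi> r X))
    = snd X \<cdot>\<^bsub>B\<^esub> far (mfun S) (\<epsilon> (fst X)) \<cdot>\<^bsub>B\<^esub> \<chi> (fob G (fst X))"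
    unfolding eq by (subst transpose_inverse) (simp_all add: hom_iff X)
qed

text \<open>
  The laws for algebras and their morphisms contain the structure map composed with an image under
  \<open>T\<close>. Naturality of \<open>\<chi>\<close> turns the transpose of such a composite into an expression in which only
  the transpose of \<open>k\<close> enters.
\<close>

lemma transpose_struct:
  assumes "is_algebra S X" "k \<in> Ar A" "Cod A k = fob G (fst X)"
  shows "\<epsilon> (fst X) \<cdot>\<^bsub>B\<^esub> far F (snd (alg_ob \<phi> r X) \<cdot>\<^bsub>A\<^esub> far (mfun T) k)
    = snd X \<cdot>\<^bsub>B\<^esub> far (mfun S) (\<epsilon> (fst X) \<cdot>\<^bsub>B\<^esub> far F k) \<cdot>\<^bsub>B\<^esub> \<chi> (Dom A k)"
proof -
  note [simp] = S.algebra_simps[OF assms(1)] assms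
  have n: "\<chi> (fob G (fst X)) \<cdot>\<^bsub>B\<^esub> far F (far (mfun T) k) = far (mfun S) (far F k) \<cdot>\<^bsub>B\<^esub> \<chi> (Dom A k)"
    using comorphism_natural[of k] by simp
  have "\<epsilon> (fst X) \<cdot>\<^bsub>B\<^esub> far F (snd (alg_ob \<phi> r X) \<cdot>\<^bsub>A\<^esub> far (mfun T) k)
      = (\<epsilon> (fst X) \<cdot>\<^bsub>B\<^esub> far F (snd (alg_ob \<phi> r X))) \<cdot>\<^bsub>B\<^esub> far F (far (mfun T) k)"
    by simp
  also have "\<dots> = snd X \<cdot>\<^bsub>B\<^esub> far (mfun S) (\<epsilon> (fst X)) \<cdot>\<^bsub>B\<^esub> (\<chi> (fob G (fst X)) \<cdot>\<^bsub>B\<^esub> far F (far (mfun T) k))"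
    unfolding alg_ob_transpose[OF assms(1)] by simp
  also have "\<dots> = snd X \<cdot>\<^bsub>B\<^esub> far (mfun S) (\<epsilon> (fst X) \<cdot>\<^bsub>B\<^esub> far F k) \<cdot>\<^bsub>B\<^esub> \<chi> (Dom A k)"
    unfolding n by simp
  finally show ?thesis .
qed

text \<open>
  On transposes, the unit law of the new algebra is the compatibility of \<open>\<chi>\<close> with the units followed
  by the unit law of \<open>b\<close>, and the associativity law is the compatibility of \<open>\<chi>\<close> with the
  multiplications followed by the associativity of \<open>b\<close>.
\<close>

lemma alg_ob_algebra:
  assumes "is_algebra S X"
  shows "is_algebra T (alg_ob \<phi> r X)"
proof -
  obtain Y b where X: "X = (Y, b)" by (cases X)
  have b [simp]: "Y \<in> Ob B" "b \<in> Ar B" "Dom B b = fob (mfun S) Y" "Cod B b = Y"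
    "b \<cdot>\<^bsub>B\<^esub> munit S Y = Id B Y" and bm: "b \<cdot>\<^bsub>B\<^esub> mmult S Y = b \<cdot>\<^bsub>B\<^esub> far (mfun S) b"
    using assms unfolding X by (simp_all add: S.is_algebra_iff)
  define b' where "b' = snd (alg_ob \<phi> r X)"
  have b' [simp]: "b' \<in> Ar A" "Dom A b' = fob (mfun T) (fob G Y)" "Cod A b' = fob G Y"
    and tr: "\<epsilon> Y \<cdot>\<^bsub>B\<^esub> far F b' = b \<cdot>\<^bsub>B\<^esub> far (mfun S) (\<epsilon> Y) \<cdot>\<^bsub>B\<^esub> \<chi> (fob G Y)"
    and trs: "\<And>k. k \<in> Ar A \<Longrightarrow> Cod A k = fob G Y \<Longrightarrow> \<epsilon> Y \<cdot>\<^bsub>B\<^esub> far F (b' \<cdot>\<^bsub>A\<^esub> far (mfun T) k)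
      = b \<cdot>\<^bsub>B\<^esub> far (mfun S) (\<epsilon> Y \<cdot>\<^bsub>B\<^esub> far F k) \<cdot>\<^bsub>B\<^esub> \<chi> (Dom A k)"
    using assms alg_ob_transpose[OF assms] transpose_struct[OF assms]
    unfolding b'_def by (simp_all add: X)
  let ?g = "fob G Y"
  have "\<epsilon> Y \<cdot>\<^bsub>B\<^esub> far F (b' \<cdot>\<^bsub>A\<^esub> munit T ?g) = (\<epsilon> Y \<cdot>\<^bsub>B\<^esub> far F b') \<cdot>\<^bsub>B\<^esub> far F (munit T ?g)"
    by simp
  also have "\<dots> = b \<cdot>\<^bsub>B\<^esub> far (mfun S) (\<epsilon> Y) \<cdot>\<^bsub>B\<^esub> munit S (fob F ?g)"
    unfolding tr by (simp add: comorphism_unit)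
  also have "\<dots> = (b \<cdot>\<^bsub>B\<^esub> munit S Y) \<cdot>\<^bsub>B\<^esub> \<epsilon> Y"
    using S.unit_natural[of "\<epsilon> Y"] by (simp del: b(5))
  also have "\<dots> = \<epsilon> Y \<cdot>\<^bsub>B\<^esub> far F (Id A ?g)" by simp
  finally have u: "b' \<cdot>\<^bsub>A\<^esub> munit T ?g = Id A ?g"
    by (rule transpose_inject[where x = ?g and y = Y]) (simp_all add: hom_iff)
  have "\<epsilon> Y \<cdot>\<^bsub>B\<^esub> far F (b' \<cdot>\<^bsub>A\<^esub> mmult T ?g) = (\<epsilon> Y \<cdot>\<^bsub>B\<^esub> far F b') \<cdot>\<^bsub>B\<^esub> far F (mmult T ?g)"
    by simp
  also have "\<dots> = b \<cdot>\<^bsub>B\<^esub> (far (mfun S) (\<epsilon> Y) \<cdot>\<^bsub>B\<^esub> mmult S (fob F ?g)) \<cdot>\<^bsub>B\<^esub>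
      far (mfun S) (\<chi> ?g) \<cdot>\<^bsub>B\<^esub> \<chi> (fob (mfun T) ?g)"
    unfolding tr by (simp add: comorphism_mult)
  also have "far (mfun S) (\<epsilon> Y) \<cdot>\<^bsub>B\<^esub> mmult S (fob F ?g)
      = mmult S Y \<cdot>\<^bsub>B\<^esub> far (mfun S) (far (mfun S) (\<epsilon> Y))"
    using S.mult_natural[of "\<epsilon> Y"] by simp
  also have "b \<cdot>\<^bsub>B\<^esub> (mmult S Y \<cdot>\<^bsub>B\<^esub> far (mfun S) (far (mfun S) (\<epsilon> Y))) \<cdot>\<^bsub>B\<^esub>
      far (mfun S) (\<chi> ?g) \<cdot>\<^bsub>B\<^esub> \<chi> (fob (mfun T) ?g)
      = (b \<cdot>\<^bsub>B\<^esub> mmult S Y) \<cdot>\<^bsub>B\<^esub> far (mfun S) (far (mfun S) (\<epsilon> Y)) \<cdot>\<^bsub>B\<^esub>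
      far (mfun S) (\<chi> ?g) \<cdot>\<^bsub>B\<^esub> \<chi> (fob (mfun T) ?g)" by simp
  also have "\<dots> = b \<cdot>\<^bsub>B\<^esub> far (mfun S) (\<epsilon> Y \<cdot>\<^bsub>B\<^esub> far F b') \<cdot>\<^bsub>B\<^esub> \<chi> (fob (mfun T) ?g)"
    unfolding tr bm by simp
  also have "\<dots> = \<epsilon> Y \<cdot>\<^bsub>B\<^esub> far F (b' \<cdot>\<^bsub>A\<^esub> far (mfun T) b')"
    by (simp only: trs b')
  finally have m: "b' \<cdot>\<^bsub>A\<^esub> mmult T ?g = b' \<cdot>\<^bsub>A\<^esub> far (mfun T) b'"
    by (rule transpose_inject[where x = "fob (mfun T) (fob (mfun T) ?g)" and y = Y]) (simp_all add: hom_iff)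
  have "alg_ob \<phi> r X = (?g, b')" unfolding b'_def by (rule prod_eqI) (simp_all add: X)
  then show ?thesis using u m by (simp add: T.is_algebra_iff)
qed

lemma alg_functr_simps [simp]:
  "fsrc (alg_functr \<phi> r) = ALG S" "ftgt (alg_functr \<phi> r) = ALG T"
  "is_algebra S X \<Longrightarrow> fob (alg_functr \<phi> r) X = alg_ob \<phi> r X"
  "(X, f, Z) \<in> Ar (ALG S) \<Longrightarrow>
    far (alg_functr \<phi> r) (X, f, Z) = (alg_ob \<phi> r X, far G f, alg_ob \<phi> r Z)"
  by (simp_all add: alg_functr_def)

lemma alg_functr_ar:
  assumes "(X, f, Z) \<in> Ar (ALG S)"
  shows "(alg_ob \<phi> r X, far G f, alg_ob \<phi> r Z) \<in> Ar (ALG T)"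
proof -
  have alg: "is_algebra S X" "is_algebra S Z" using assms by (simp_all add: S.ALG_ar_iff)
  have f [simp]: "f \<in> Ar B" "Dom B f = fst X" "Cod B f = fst Z"
    and fe: "f \<cdot>\<^bsub>B\<^esub> snd X = snd Z \<cdot>\<^bsub>B\<^esub> far (mfun S) f"
    using assms by (simp_all add: S.ALG_ar_iff)
  note [simp] = S.algebra_simps[OF alg(1)] S.algebra_simps[OF alg(2)] alg
  have n: "\<epsilon> (fst Z) \<cdot>\<^bsub>B\<^esub> far F (far G f) = f \<cdot>\<^bsub>B\<^esub> \<epsilon> (fst X)"
    using counit_natural[of f] by simp
  have "\<epsilon> (fst Z) \<cdot>\<^bsub>B\<^esub> far F (far G f \<cdot>\<^bsub>A\<^esub> snd (alg_ob \<phi> r X))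
      = (\<epsilon> (fst Z) \<cdot>\<^bsub>B\<^esub> far F (far G f)) \<cdot>\<^bsub>B\<^esub> far F (snd (alg_ob \<phi> r X))"
    by simp
  also have "\<dots> = f \<cdot>\<^bsub>B\<^esub> (\<epsilon> (fst X) \<cdot>\<^bsub>B\<^esub> far F (snd (alg_ob \<phi> r X)))"
    unfolding n by simp
  also have "\<dots> = (f \<cdot>\<^bsub>B\<^esub> snd X) \<cdot>\<^bsub>B\<^esub> far (mfun S) (\<epsilon> (fst X)) \<cdot>\<^bsub>B\<^esub> \<chi> (fob G (fst X))"
    by (simp add: alg_ob_transpose)
  also have "\<dots> = snd Z \<cdot>\<^bsub>B\<^esub> far (mfun S) (f \<cdot>\<^bsub>B\<^esub> \<epsilon> (fst X)) \<cdot>\<^bsub>B\<^esub> \<chi> (fob G (fst X))"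
    unfolding fe by simp
  also have "\<dots> = \<epsilon> (fst Z) \<cdot>\<^bsub>B\<^esub> far F (snd (alg_ob \<phi> r Z) \<cdot>\<^bsub>A\<^esub> far (mfun T) (far G f))"
    by (subst transpose_struct) (simp_all add: n del: T.T_simps F_simps G_simps,
      simp_all)
  finally have "far G f \<cdot>\<^bsub>A\<^esub> snd (alg_ob \<phi> r X)
      = snd (alg_ob \<phi> r Z) \<cdot>\<^bsub>A\<^esub> far (mfun T) (far G f)"
    by (rule transpose_inject[where x = "fob (mfun T) (fob G (fst X))" and y = "fst Z"]) (simp_all add: hom_iff)
  then show ?thesis by (simp add: T.ALG_ar_iff alg_ob_algebra)
qed

lemma alg_functr_functor: "functor_between (ALG S) (ALG T) (alg_functr \<phi> r)"
proof (rule functor_betweenI)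
  show "fob (alg_functr \<phi> r) \<in> extensional (Ob (ALG S))"
    "far (alg_functr \<phi> r) \<in> extensional (Ar (ALG S))"
    by (simp_all add: alg_functr_def)
next
  fix f assume "f \<in> Ar (ALG S)"
  then show "far (alg_functr \<phi> r) f \<in> Ar (ALG T) \<and>
      Dom (ALG T) (far (alg_functr \<phi> r) f) = fob (alg_functr \<phi> r) (Dom (ALG S) f) \<and>
      Cod (ALG T) (far (alg_functr \<phi> r) f) = fob (alg_functr \<phi> r) (Cod (ALG S) f)"
    by (cases f) (simp add: alg_functr_ar, simp add: S.ALG_ar_iff)
next
  fix X assume "X \<in> Ob (ALG S)"
  moreover from this have "(X, Id B (fst X), X) \<in> Ar (ALG S)"
    using category.id_ar(1)[OF S.category_ALG, of X] by simp
  ultimately show "far (alg_functr \<phi> r) (Id (ALG S) X) = Id (ALG T) (fob (alg_functr \<phi> r) X)"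
    by (simp add: S.algebra_simps)
next
  fix f g assume fg: "f \<in> Ar (ALG S)" "g \<in> Ar (ALG S)" "Dom (ALG S) g = Cod (ALG S) f"
  then have "g \<cdot>\<^bsub>ALG S\<^esub> f \<in> Ar (ALG S)" using category.comp_ar(1)[OF S.category_ALG] by blast
  then show "far (alg_functr \<phi> r) (g \<cdot>\<^bsub>ALG S\<^esub> f)
      = far (alg_functr \<phi> r) g \<cdot>\<^bsub>ALG T\<^esub> far (alg_functr \<phi> r) f"
    using fg by (cases f; cases g) (simp add: S.ALG_ar_iff)
qed (simp_all add: S.category_ALG T.category_ALG alg_ob_algebra)

end

text \<open>
  The functor between categories of algebras depends on the chosen right adjoint only up to the
  comparison isomorphism, because the latter is a morphism of algebras: the structure maps with
  respect to \<open>r\<close> and \<open>r'\<close> have transposes given by the same formula.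
\<close>

locale comorphism_two_adjoints = P: comorphism_adj \<phi> r + Q: comorphism_adj \<phi> r'
  for \<phi> :: "('o, 'a) comorphism" and r r' :: "('o, 'a, 'o, 'a) radj"
begin

sublocale C: two_right_adjoints "mcat (csrc \<phi>)" "mcat (ctgt \<phi>)" "cfun \<phi>" r r'
  by unfold_locales

abbreviation c where "c \<equiv> comparison P.A r r'"

lemma comparison_ar:
  assumes "is_algebra P.S X"
  shows "(alg_ob \<phi> r X, c (fst X), alg_ob \<phi> r' X) \<in> Ar (ALG P.T)"
proof -
  note [simp] = P.S.algebra_simps[OF assms] assms
  have "Q.\<epsilon> (fst X) \<cdot>\<^bsub>P.B\<^esub> far P.F (c (fst X) \<cdot>\<^bsub>P.A\<^esub> snd (alg_ob \<phi> r X))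
      = (Q.\<epsilon> (fst X) \<cdot>\<^bsub>P.B\<^esub> far P.F (c (fst X))) \<cdot>\<^bsub>P.B\<^esub> far P.F (snd (alg_ob \<phi> r X))"
    by simp
  also have "\<dots> = Q.\<epsilon> (fst X) \<cdot>\<^bsub>P.B\<^esub> far P.F (snd (alg_ob \<phi> r' X) \<cdot>\<^bsub>P.A\<^esub> far (mfun P.T) (c (fst X)))"
    by (subst Q.transpose_struct) (simp_all add: C.comparison_transpose P.alg_ob_transpose)
  finally have "c (fst X) \<cdot>\<^bsub>P.A\<^esub> snd (alg_ob \<phi> r X)
      = snd (alg_ob \<phi> r' X) \<cdot>\<^bsub>P.A\<^esub> far (mfun P.T) (c (fst X))"
    by (rule Q.transpose_inject[where x = "fob (mfun P.T) (fob P.G (fst X))" and y = "fst X"])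
      (simp_all add: hom_iff)
  then show ?thesis by (simp add: P.T.ALG_ar_iff P.alg_ob_algebra Q.alg_ob_algebra)
qed

lemma comparison_nat_iso:
  "nat_iso (alg_functr \<phi> r) (alg_functr \<phi> r')
    (\<lambda>X\<in>Ob (ALG P.S). (alg_ob \<phi> r X, c (fst X), alg_ob \<phi> r' X))" (is "nat_iso _ _ ?\<tau>")
proof -
  interpret I: comorphism_two_adjoints \<phi> r' r by unfold_locales
  have "nat_trans (alg_functr \<phi> r) (alg_functr \<phi> r') ?\<tau>"
  proof (rule nat_transI[OF P.alg_functr_functor Q.alg_functr_functor])
    fix f assume f: "f \<in> Ar (ALG P.S)"
    obtain X h Z where fX: "f = (X, h, Z)" by (cases f)
    show "?\<tau> (Cod (ALG P.S) f) \<cdot>\<^bsub>ALG P.T\<^esub> far (alg_functr \<phi> r) f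
        = far (alg_functr \<phi> r') f \<cdot>\<^bsub>ALG P.T\<^esub> ?\<tau> (Dom (ALG P.S) f)"
      using f C.comparison_natural[of h] unfolding fX by simp (simp add: P.S.ALG_ar_iff)
  qed (use comparison_ar in \<open>auto simp: hom_iff\<close>)
  moreover have "is_iso (ALG P.T) (?\<tau> X)" if "X \<in> Ob (ALG P.S)" for X
    using that P.T.ALG_isoI[OF comparison_ar I.comparison_ar, of X]
      C.comparison_inverse I.C.comparison_inverse
    by (simp add: P.S.algebra_simps)
  ultimately show ?thesis by (simp add: nat_iso_def)
qed

end

section \<open>The pseudofunctor of Eilenberg-Moore categories\<close>
abbreviation comp_comorphism ::
  "('o, 'a) comorphism \<Rightarrow> ('o, 'a) comorphism \<Rightarrow> ('o, 'a) comorphism"  (infixr \<open>\<odot>\<close> 70) where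
  "\<psi> \<odot> \<phi> \<equiv> \<psi> \<cdot>\<^bsub>MND_co_adj\<^esub> \<phi>"

lemma MND_simps [simp]:
  "T \<in> Ob MND_co_adj \<longleftrightarrow> is_monad T"
  "Dom MND_co_adj = csrc" "Cod MND_co_adj = ctgt"
  "csrc (Id MND_co_adj T) = T" "ctgt (Id MND_co_adj T) = T"
  "cfun (Id MND_co_adj T) = id_functr (mcat T)"
  "csrc (\<psi> \<odot> \<phi>) = csrc \<phi>" "ctgt (\<psi> \<odot> \<phi>) = ctgt \<psi>"
  "cfun (\<psi> \<odot> \<phi>) = comp_functr (cfun \<psi>) (cfun \<phi>)"
  by (simp_all add: MND_co_adj_def)

lemma MND_cnat [simp]:
  "x \<in> Ob (mcat T) \<Longrightarrow> cnat (Id MND_co_adj T) x = Id (mcat T) (fob (mfun T) x)"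
  "x \<in> Ob (mcat (csrc \<phi>)) \<Longrightarrow> cnat (\<psi> \<odot> \<phi>) x
    = cnat \<psi> (fob (cfun \<phi>) x) \<cdot>\<^bsub>mcat (ctgt \<psi>)\<^esub> far (cfun \<psi>) (cnat \<phi> x)"
  by (simp_all add: MND_co_adj_def)

lemma MND_cnat_ext:
  "cnat (Id MND_co_adj T) \<in> extensional (Ob (mcat T))"
  "cnat (\<psi> \<odot> \<phi>) \<in> extensional (Ob (mcat (csrc \<phi>)))"
  by (simp_all add: MND_co_adj_def)

lemma MND_ar_iff: "\<phi> \<in> Ar MND_co_adj \<longleftrightarrow> is_comorphism \<phi> \<and> (\<exists>r. right_adjoint (cfun \<phi>) r)"
  by (simp add: MND_co_adj_def)

lemma is_comorphismI:
  assumes "is_monad (csrc \<phi>)" "is_monad (ctgt \<phi>)"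
    and "functor_between (mcat (csrc \<phi>)) (mcat (ctgt \<phi>)) (cfun \<phi>)"
    and "cnat \<phi> \<in> extensional (Ob (mcat (csrc \<phi>)))"
    and "\<And>x. x \<in> Ob (mcat (csrc \<phi>)) \<Longrightarrow> cnat \<phi> x \<in> hom (mcat (ctgt \<phi>))
      (fob (cfun \<phi>) (fob (mfun (csrc \<phi>)) x)) (fob (mfun (ctgt \<phi>)) (fob (cfun \<phi>) x))"
    and "\<And>f. f \<in> Ar (mcat (csrc \<phi>)) \<Longrightarrow>
      cnat \<phi> (Cod (mcat (csrc \<phi>)) f) \<cdot>\<^bsub>mcat (ctgt \<phi>)\<^esub> far (cfun \<phi>) (far (mfun (csrc \<phi>)) f)
      = far (mfun (ctgt \<phi>)) (far (cfun \<phi>) f) \<cdot>\<^bsub>mcat (ctgt \<phi>)\<^esub> cnat \<phi> (Dom (mcat (csrc \<phi>)) f)"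
    and "\<And>x. x \<in> Ob (mcat (csrc \<phi>)) \<Longrightarrow>
      cnat \<phi> x \<cdot>\<^bsub>mcat (ctgt \<phi>)\<^esub> far (cfun \<phi>) (munit (csrc \<phi>) x) = munit (ctgt \<phi>) (fob (cfun \<phi>) x)"
    and "\<And>x. x \<in> Ob (mcat (csrc \<phi>)) \<Longrightarrow>
      cnat \<phi> x \<cdot>\<^bsub>mcat (ctgt \<phi>)\<^esub> far (cfun \<phi>) (mmult (csrc \<phi>) x) =
      mmult (ctgt \<phi>) (fob (cfun \<phi>) x) \<cdot>\<^bsub>mcat (ctgt \<phi>)\<^esub> far (mfun (ctgt \<phi>)) (cnat \<phi> x)
        \<cdot>\<^bsub>mcat (ctgt \<phi>)\<^esub> cnat \<phi> (fob (mfun (csrc \<phi>)) x)"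
  shows "is_comorphism \<phi>"
proof -
  interpret T: eilenberg_moore "csrc \<phi>" by unfold_locales fact
  interpret S: eilenberg_moore "ctgt \<phi>" by unfold_locales fact
  have "nat_trans (comp_functr (cfun \<phi>) (mfun (csrc \<phi>))) (comp_functr (mfun (ctgt \<phi>)) (cfun \<phi>)) (cnat \<phi>)"
    by (rule nat_transI[OF functor_between_comp[OF T.T_functor assms(3)]
          functor_between_comp[OF assms(3) S.T_functor] assms(4)])
      (use assms(5,6) in \<open>simp_all add: functor_between_simps[OF assms(3)]\<close>)
  then show ?thesis using assms by (simp add: is_comorphism_def Let_def)
qed

lemma comorphism_adj_id:
  assumes "is_monad T"
  shows "comorphism_adj (Id MND_co_adj T) (id_radj (mcat T))"
proof -
  interpret eilenberg_moore T by unfold_locales fact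
  show ?thesis
  proof
    show "is_comorphism (Id MND_co_adj T)"
      by (rule is_comorphismI)
        (use assms MND_cnat_ext(1)[of T] in \<open>simp_all add: functor_between_id E.category_axioms hom_iff\<close>)
    show "right_adjoint (cfun (Id MND_co_adj T)) (id_radj (mcat T))"
      using right_adjoint_id[OF E.category_axioms] by simp
  qed
qed

lemma comorphism_adj_comp:
  assumes "comorphism_adj \<phi> r" "comorphism_adj \<psi> s" and st: "csrc \<psi> = ctgt \<phi>"
  shows "comorphism_adj (\<psi> \<odot> \<phi>) (comp_radj (cfun \<psi>) s (cfun \<phi>) r)"
proof -
  interpret P: comorphism_adj \<phi> r by fact
  interpret Q: comorphism_adj \<psi> s rewrites "csrc \<psi> = ctgt \<phi>" by fact (fact st)
  show ?thesis
  proof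
    let ?F = "far (cfun \<psi>)" and ?D = "mcat (ctgt \<psi>)" and ?\<chi> = "cnat (\<psi> \<odot> \<phi>)"
    have ra: "functor_between P.A ?D (comp_functr (cfun \<psi>) (cfun \<phi>))"
      by (rule functor_between_comp[OF P.F_functor Q.F_functor])
    show "is_comorphism (\<psi> \<odot> \<phi>)"
    proof (rule is_comorphismI, simp_all add: MND_cnat_ext hom_iff P.T.monad Q.S.monad ra, goal_cases)
      case (1 f)
      have "cnat \<psi> (fob P.F (Cod P.A f)) \<cdot>\<^bsub>?D\<^esub> (?F (P.\<chi> (Cod P.A f)) \<cdot>\<^bsub>?D\<^esub> ?F (far P.F (far (mfun P.T) f)))
          = cnat \<psi> (fob P.F (Cod P.A f)) \<cdot>\<^bsub>?D\<^esub> ?F (P.\<chi> (Cod P.A f) \<cdot>\<^bsub>P.B\<^esub> far P.F (far (mfun P.T) f))"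
        using 1 by simp
      also have "\<dots> = (cnat \<psi> (fob P.F (Cod P.A f)) \<cdot>\<^bsub>?D\<^esub> ?F (far (mfun P.S) (far P.F f))) \<cdot>\<^bsub>?D\<^esub> ?F (P.\<chi> (Dom P.A f))"
        using 1 P.comorphism_natural[OF 1] by simp
      also have "cnat \<psi> (fob P.F (Cod P.A f)) \<cdot>\<^bsub>?D\<^esub> ?F (far (mfun P.S) (far P.F f))
          = far (mfun (ctgt \<psi>)) (?F (far P.F f)) \<cdot>\<^bsub>?D\<^esub> cnat \<psi> (fob P.F (Dom P.A f))"
        using Q.comorphism_natural[of "far P.F f"] 1 by simp
      finally show ?case using 1 by simp
    next
      case (2 x)
      have "cnat \<psi> (fob P.F x) \<cdot>\<^bsub>?D\<^esub> (?F (P.\<chi> x) \<cdot>\<^bsub>?D\<^esub> ?F (far P.F (munit P.T x)))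
          = cnat \<psi> (fob P.F x) \<cdot>\<^bsub>?D\<^esub> ?F (P.\<chi> x \<cdot>\<^bsub>P.B\<^esub> far P.F (munit P.T x))"
        using 2 by simp
      then show ?case using 2 by (simp add: P.comorphism_unit Q.comorphism_unit)
    next
      case (3 x)
      have "cnat \<psi> (fob P.F x) \<cdot>\<^bsub>?D\<^esub> (?F (P.\<chi> x) \<cdot>\<^bsub>?D\<^esub> ?F (far P.F (mmult P.T x)))
          = cnat \<psi> (fob P.F x) \<cdot>\<^bsub>?D\<^esub> ?F (P.\<chi> x \<cdot>\<^bsub>P.B\<^esub> far P.F (mmult P.T x))"
        using 3 by simp
      also have "\<dots> = (cnat \<psi> (fob P.F x) \<cdot>\<^bsub>?D\<^esub> ?F (mmult P.S (fob P.F x))) \<cdot>\<^bsub>?D\<^esub>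
          ?F (far (mfun P.S) (P.\<chi> x)) \<cdot>\<^bsub>?D\<^esub> ?F (P.\<chi> (fob (mfun P.T) x))"
        using 3 by (simp add: P.comorphism_mult)
      also have "\<dots> = mmult (ctgt \<psi>) (fob (cfun \<psi>) (fob P.F x)) \<cdot>\<^bsub>?D\<^esub> far (mfun (ctgt \<psi>)) (cnat \<psi> (fob P.F x)) \<cdot>\<^bsub>?D\<^esub>
          (cnat \<psi> (fob (mfun P.S) (fob P.F x)) \<cdot>\<^bsub>?D\<^esub> ?F (far (mfun P.S) (P.\<chi> x))) \<cdot>\<^bsub>?D\<^esub> ?F (P.\<chi> (fob (mfun P.T) x))"
        using 3 by (simp add: Q.comorphism_mult)
      also have "cnat \<psi> (fob (mfun P.S) (fob P.F x)) \<cdot>\<^bsub>?D\<^esub> ?F (far (mfun P.S) (P.\<chi> x))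
          = far (mfun (ctgt \<psi>)) (?F (P.\<chi> x)) \<cdot>\<^bsub>?D\<^esub> cnat \<psi> (fob P.F (fob (mfun P.T) x))"
        using Q.comorphism_natural[of "P.\<chi> x"] 3 by simp
      finally show ?case using 3 by simp
    qed
    show "right_adjoint (cfun (\<psi> \<odot> \<phi>)) (comp_radj (cfun \<psi>) s (cfun \<phi>) r)"
      using right_adjoint_comp[OF P.adjunction_axioms Q.adjunction_axioms] by simp
  qed
qed

lemma MND_arE:
  assumes "\<phi> \<in> Ar MND_co_adj"
  obtains r where "comorphism_adj \<phi> r"
  using assms by (auto simp: MND_ar_iff comorphism_adj_def)

lemma MND_arI: "comorphism_adj \<phi> r \<Longrightarrow> \<phi> \<in> Ar MND_co_adj"
  by (auto simp: MND_ar_iff comorphism_adj_def)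

lemma comorphism_eqI:
  assumes "is_comorphism \<phi>" "is_comorphism \<psi>" "csrc \<phi> = csrc \<psi>" "ctgt \<phi> = ctgt \<psi>" "cfun \<phi> = cfun \<psi>"
    and "\<And>x. x \<in> Ob (mcat (csrc \<phi>)) \<Longrightarrow> cnat \<phi> x = cnat \<psi> x"
  shows "\<phi> = \<psi>"
proof -
  have "cnat \<chi> \<in> extensional (Ob (mcat (csrc \<chi>)))" if c: "is_comorphism \<chi>" for \<chi> :: "('a, 'b) comorphism"
    using c by (auto simp: is_comorphism_def Let_def nat_trans_def functor_between_def)
  then have "cnat \<phi> = cnat \<psi>" using assms by (metis extensionalityI)
  then show ?thesis using assms by (cases \<phi>; cases \<psi>) simp
qed

lemma category_MND: "category MND_co_adj"
proof (rule categoryI, goal_cases)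
  case (1 f) then show ?case by (auto elim!: MND_arE simp: comorphism_adj_def is_comorphism_def Let_def)
next
  case (2 f) then show ?case by (auto elim!: MND_arE simp: comorphism_adj_def is_comorphism_def Let_def)
next
  case (3 T) then show ?case using MND_arI[OF comorphism_adj_id] by simp
next
  case (4 \<phi> \<psi>) then show ?case by (auto elim!: MND_arE intro: MND_arI[OF comorphism_adj_comp])
next
  case (5 \<phi>)
  then obtain r where r: "comorphism_adj \<phi> r" by (rule MND_arE)
  interpret comorphism_adj \<phi> r by fact
  note c = comorphism_adj_comp[OF comorphism_adj_id[OF T.monad] r]
  show ?case
    by (rule comorphism_eqI)
      (use comorphism_adj.comorphism[OF c] comorphism in \<open>simp_all add: comp_functr_id[OF F_functor]\<close>)
next
  case (6 \<phi>)
  then obtain r where r: "comorphism_adj \<phi> r" by (rule MND_arE)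
  interpret comorphism_adj \<phi> r by fact
  note c = comorphism_adj_comp[OF r comorphism_adj_id[OF S.monad]]
  show ?case
    by (rule comorphism_eqI)
      (use comorphism_adj.comorphism[OF c] comorphism in \<open>simp_all add: comp_functr_id[OF F_functor]\<close>)
next
  case (7 f g h)
  obtain r s t where r: "comorphism_adj f r" and s: "comorphism_adj g s" and t: "comorphism_adj h t"
    using 7(1-3) by (elim MND_arE)
  have st: "csrc g = ctgt f" "csrc h = ctgt g" using 7 by auto
  interpret P: comorphism_adj f r by fact
  interpret Q: comorphism_adj g s rewrites "csrc g = ctgt f" by fact (fact st)
  interpret R: comorphism_adj h t rewrites "csrc h = ctgt g" by fact (fact st)
  note gf = comorphism_adj_comp[OF r s st(1)] and hg = comorphism_adj_comp[OF s t st(2)]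
  note c1 = comorphism_adj_comp[OF r hg] and c2 = comorphism_adj_comp[OF gf t]
  show ?case
    by (rule comorphism_eqI)
      (use comorphism_adj.comorphism[OF c1] comorphism_adj.comorphism[OF c2] st in
        \<open>simp_all add: comp_functr_assoc[OF P.F_functor Q.F_functor R.F_functor]\<close>)
qed

text \<open>
  With respect to the identity adjunction and to composite adjunctions, passing to algebras is
  strictly functorial. Only the structure maps need an argument, and they are compared on
  transposes. These two lemmas make \<open>Alg(-)\<close> a strict functor for a split choice of right adjoints,
  and they reduce the general case to comparisons of right adjoints.
\<close>

lemma alg_functr_id:
  assumes "is_monad T"
  shows "alg_functr (Id MND_co_adj T) (id_radj (mcat T)) = id_functr (ALG T)"
proof -
  interpret comorphism_adj "Id MND_co_adj T" "id_radj (mcat T)"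
    rewrites "csrc (Id MND_co_adj T) = T" and "ctgt (Id MND_co_adj T) = T"
      and "cfun (Id MND_co_adj T) = id_functr (mcat T)"
    by (rule comorphism_adj_id[OF assms]) simp_all
  have ob: "alg_ob (Id MND_co_adj T) (id_radj (mcat T)) X = X" if X: "is_algebra T X" for X
  proof -
    note [simp] = T.algebra_simps[OF X] X
    have "snd (alg_ob (Id MND_co_adj T) (id_radj (mcat T)) X) = snd X"
      using alg_ob_transpose[OF X] alg_ob_struct[OF X] by simp
    then show ?thesis by (intro prod_eqI) simp_all
  qed
  show ?thesis
  proof (rule functor_between_eqI[OF alg_functr_functor functor_between_id[OF T.category_ALG]])
    fix f assume "f \<in> Ar (ALG T)"
    then show "far (alg_functr (Id MND_co_adj T) (id_radj (mcat T))) f = far (id_functr (ALG T)) f"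
      by (cases f) (simp, simp add: T.ALG_ar_iff ob)
  qed (simp add: ob)
qed

lemma alg_functr_comp:
  assumes "comorphism_adj \<phi> r" "comorphism_adj \<psi> s" and st: "csrc \<psi> = ctgt \<phi>"
  shows "alg_functr (\<psi> \<odot> \<phi>) (comp_radj (cfun \<psi>) s (cfun \<phi>) r)
    = comp_functr (alg_functr \<phi> r) (alg_functr \<psi> s)"
proof -
  interpret P: comorphism_adj \<phi> r by fact
  interpret Q: comorphism_adj \<psi> s rewrites "csrc \<psi> = ctgt \<phi>" by fact (fact st)
  let ?\<theta> = "\<psi> \<odot> \<phi>" and ?t = "comp_radj (cfun \<psi>) s (cfun \<phi>) r"
  interpret C: comorphism_adj ?\<theta> ?t
    rewrites "csrc ?\<theta> = csrc \<phi>" and "ctgt ?\<theta> = ctgt \<psi>"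
      and "cfun ?\<theta> = comp_functr (cfun \<psi>) (cfun \<phi>)"
    by (rule comorphism_adj_comp[OF assms]) simp_all
  let ?F = "far (cfun \<psi>)" and ?D = "mcat (ctgt \<psi>)"
  have ob: "alg_ob ?\<theta> ?t X = alg_ob \<phi> r (alg_ob \<psi> s X)" if X: "is_algebra (ctgt \<psi>) X" for X
  proof -
    have X': "is_algebra (ctgt \<phi>) (alg_ob \<psi> s X)" by (rule Q.alg_ob_algebra[OF X])
    note [simp] = Q.S.algebra_simps[OF X] X X'
    let ?Y = "fst X" and ?Y' = "fob Q.G (fst X)"
    let ?d = "snd (alg_ob \<phi> r (alg_ob \<psi> s X))"
    have d [simp]: "?d \<in> Ar P.A" "Dom P.A ?d = fob (mfun P.T) (fob P.G ?Y')" "Cod P.A ?d = fob P.G ?Y'"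
      using P.alg_ob_struct[OF X'] by simp_all
    have n: "cnat \<psi> ?Y' \<cdot>\<^bsub>?D\<^esub> ?F (far (mfun P.S) (P.\<epsilon> ?Y'))
        = far (mfun (ctgt \<psi>)) (?F (P.\<epsilon> ?Y')) \<cdot>\<^bsub>?D\<^esub> cnat \<psi> (fob P.F (fob P.G ?Y'))"
      using Q.comorphism_natural[of "P.\<epsilon> ?Y'"] by simp
    have "ra_counit ?t ?Y \<cdot>\<^bsub>?D\<^esub> far (comp_functr (cfun \<psi>) (cfun \<phi>)) ?d
        = Q.\<epsilon> ?Y \<cdot>\<^bsub>?D\<^esub> ?F (P.\<epsilon> ?Y' \<cdot>\<^bsub>P.B\<^esub> far P.F ?d)"
      by simp
    also have "\<dots> = (Q.\<epsilon> ?Y \<cdot>\<^bsub>?D\<^esub> ?F (snd (alg_ob \<psi> s X))) \<cdot>\<^bsub>?D\<^esub>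
        ?F (far (mfun P.S) (P.\<epsilon> ?Y')) \<cdot>\<^bsub>?D\<^esub> ?F (P.\<chi> (fob P.G ?Y'))"
      using P.alg_ob_transpose[OF X'] by simp
    also have "\<dots> = snd X \<cdot>\<^bsub>?D\<^esub> far (mfun (ctgt \<psi>)) (Q.\<epsilon> ?Y) \<cdot>\<^bsub>?D\<^esub>
        (cnat \<psi> ?Y' \<cdot>\<^bsub>?D\<^esub> ?F (far (mfun P.S) (P.\<epsilon> ?Y'))) \<cdot>\<^bsub>?D\<^esub> ?F (P.\<chi> (fob P.G ?Y'))"
      unfolding Q.alg_ob_transpose[OF X] by simp
    also have "\<dots> = ra_counit ?t ?Y \<cdot>\<^bsub>?D\<^esub> far (comp_functr (cfun \<psi>) (cfun \<phi>)) (snd (alg_ob ?\<theta> ?t X))"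
      unfolding C.alg_ob_transpose[OF X] n by simp
    finally have "?d = snd (alg_ob ?\<theta> ?t X)"
      by (rule C.transpose_inject[where x = "fob (mfun P.T) (fob P.G ?Y')" and y = ?Y])
        (use C.alg_ob_struct[OF X] in \<open>simp_all add: hom_iff\<close>)
    then show ?thesis by (intro prod_eqI) simp_all
  qed
  show ?thesis
  proof (rule functor_between_eqI[OF C.alg_functr_functor
        functor_between_comp[OF Q.alg_functr_functor P.alg_functr_functor]])
    fix f assume f: "f \<in> Ar (ALG (ctgt \<psi>))"
    obtain X h Z where fX: "f = (X, h, Z)" by (cases f)
    show "far (alg_functr ?\<theta> ?t) f = far (comp_functr (alg_functr \<phi> r) (alg_functr \<psi> s)) f"
      using f Q.alg_functr_ar[of X h Z] unfolding fX by (simp, simp add: Q.S.ALG_ar_iff ob)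
  qed (simp add: ob Q.alg_ob_algebra)
qed

locale right_adjoint_choices =
  fixes R :: "('o, 'a, 'o, 'a) functr \<Rightarrow> ('o, 'a, 'o, 'a) radj"
  assumes choice: "right_adjoint_choice R"
begin

abbreviation composite_adj where
  "composite_adj \<psi> \<phi> \<equiv> comp_radj (cfun \<psi>) (R (cfun \<psi>)) (cfun \<phi>) (R (cfun \<phi>))"

lemma comorphism_adj_choice: "\<phi> \<in> Ar MND_co_adj \<Longrightarrow> comorphism_adj \<phi> (R (cfun \<phi>))"
  using choice by (auto simp: right_adjoint_choice_def comorphism_adj_def MND_ar_iff)

lemma adjunction_choice:
  "\<phi> \<in> Ar MND_co_adj \<Longrightarrow> adjunction (mcat (csrc \<phi>)) (mcat (ctgt \<phi>)) (cfun \<phi>) (R (cfun \<phi>))"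
proof -
  assume "\<phi> \<in> Ar MND_co_adj"
  then interpret comorphism_adj \<phi> "R (cfun \<phi>)" by (rule comorphism_adj_choice)
  show ?thesis by unfold_locales
qed

lemma ALG_ps_simps [simp]:
  "ps_ob (ALG_ps R) = ALG" "ps_ar (ALG_ps R) \<phi> = alg_functr \<phi> (R (cfun \<phi>))"
  by (simp_all add: ALG_ps_def)

text \<open>
  By strictness, the comparison cells of \<open>Alg(-)\<close> are comparisons between two right adjoints of the
  same functor: from the identity or composite adjunction to the chosen one.
\<close>

lemma ALG_ps_unit:
  assumes "is_monad T"
  shows "ps_unit (ALG_ps R) T = (\<lambda>X\<in>Ob (ALG T).
    (alg_ob (Id MND_co_adj T) (id_radj (mcat T)) X,
     comparison (mcat T) (id_radj (mcat T)) (R (id_functr (mcat T))) (fst X),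
     alg_ob (Id MND_co_adj T) (R (id_functr (mcat T))) X))"
proof -
  interpret J: comorphism_adj "Id MND_co_adj T" "R (id_functr (mcat T))"
    rewrites "csrc (Id MND_co_adj T) = T" and "ctgt (Id MND_co_adj T) = T"
      and "cfun (Id MND_co_adj T) = id_functr (mcat T)"
    using comorphism_adj_choice[of "Id MND_co_adj T"] MND_arI[OF comorphism_adj_id[OF assms]]
    by simp_all
  have "alg_ob (Id MND_co_adj T) (id_radj (mcat T)) X = X" if "is_algebra T X" for X
  proof -
    have "fob (alg_functr (Id MND_co_adj T) (id_radj (mcat T))) X = X"
      using alg_functr_id[OF assms] that J.T.ALG_simps by simp
    then show ?thesis using that J.T.ALG_simps by (simp add: alg_functr_def)
  qed
  moreover have "comparison (mcat T) (id_radj (mcat T)) (R (id_functr (mcat T))) (fst X)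
    = ra_unit (R (id_functr (mcat T))) (fst X)" if "is_algebra T X" for X
  proof -
    have "fst X \<in> Ob (mcat T)" using J.T.algebra_simps(1) that by simp
    then show ?thesis
      by (simp add: comparison_def)
  qed
  ultimately show ?thesis using J.T.ALG_simps(1)
    by (auto simp: ALG_ps_def Let_def intro!: restrict_ext)
qed

lemma ALG_ps_comp:
  assumes "\<phi> \<in> Ar MND_co_adj" "\<psi> \<in> Ar MND_co_adj" "csrc \<psi> = ctgt \<phi>"
  shows "ps_comp (ALG_ps R) \<phi> \<psi> = (\<lambda>X\<in>Ob (ALG (ctgt \<psi>)).
    (alg_ob (\<psi> \<odot> \<phi>) (composite_adj \<psi> \<phi>) X,
     comparison (mcat (csrc \<phi>)) (composite_adj \<psi> \<phi>)
       (R (comp_functr (cfun \<psi>) (cfun \<phi>))) (fst X),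
     alg_ob (\<psi> \<odot> \<phi>) (R (comp_functr (cfun \<psi>) (cfun \<phi>))) X))"
proof -
  interpret P: comorphism_adj \<phi> "R (cfun \<phi>)" by (rule comorphism_adj_choice[OF assms(1)])
  interpret Q: comorphism_adj \<psi> "R (cfun \<psi>)" by (rule comorphism_adj_choice[OF assms(2)])
  let ?t = "composite_adj \<psi> \<phi>"
  have ob: "alg_ob (\<psi> \<odot> \<phi>) ?t X = alg_ob \<phi> (R (cfun \<phi>)) (alg_ob \<psi> (R (cfun \<psi>)) X)"
    if "is_algebra (ctgt \<psi>) X" for X
  proof -
    have "is_algebra (ctgt \<phi>) (alg_ob \<psi> (R (cfun \<psi>)) X)"
      using Q.alg_ob_algebra[OF that] assms(3) by simp
    then show ?thesis
      using arg_cong[OF alg_functr_comp[OF P.comorphism_adj_axioms Q.comorphism_adj_axioms assms(3)],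
          of "\<lambda>K. fob K X"] that Q.S.ALG_simps P.S.ALG_simps
      by (simp add: alg_functr_def)
  qed
  show ?thesis
    unfolding ALG_ps_def Let_def
    by (auto simp: ob Q.S.is_algebra_iff comparison_def intro!: restrict_ext)
qed

lemma ALG_ps_pseudofunctor: "pseudofunctor (op_cat MND_co_adj) (ALG_ps R)"
proof -
  note cat = category_MND
  have ar: "functor_between (ALG (ctgt \<phi>)) (ALG (csrc \<phi>)) (alg_functr \<phi> (R (cfun \<phi>)))"
    if "\<phi> \<in> Ar MND_co_adj" for \<phi>
    by (rule comorphism_adj.alg_functr_functor[OF comorphism_adj_choice[OF that]])
  have unit: "nat_iso (id_functr (ALG T)) (alg_functr (Id MND_co_adj T) (R (id_functr (mcat T))))
      (ps_unit (ALG_ps R) T)" if T: "is_monad T" for T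
  proof -
    have "comorphism_two_adjoints (Id MND_co_adj T) (id_radj (mcat T)) (R (id_functr (mcat T)))"
      using comorphism_adj_id[OF T] comorphism_adj_choice[OF MND_arI[OF comorphism_adj_id[OF T]]]
      by (simp add: comorphism_two_adjoints_def)
    from comorphism_two_adjoints.comparison_nat_iso[OF this] show ?thesis
      by (simp add: alg_functr_id[OF T] ALG_ps_unit[OF T])
  qed
  have comp: "nat_iso (comp_functr (alg_functr \<phi> (R (cfun \<phi>))) (alg_functr \<psi> (R (cfun \<psi>))))
      (alg_functr (\<psi> \<odot> \<phi>) (R (comp_functr (cfun \<psi>) (cfun \<phi>)))) (ps_comp (ALG_ps R) \<phi> \<psi>)"
    if a: "\<phi> \<in> Ar MND_co_adj" "\<psi> \<in> Ar MND_co_adj" "csrc \<psi> = ctgt \<phi>" for \<phi> \<psi>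
  proof -
    note c = comorphism_adj_comp[OF comorphism_adj_choice[OF a(1)] comorphism_adj_choice[OF a(2)] a(3)]
    have "comorphism_two_adjoints (\<psi> \<odot> \<phi>) (composite_adj \<psi> \<phi>)
        (R (comp_functr (cfun \<psi>) (cfun \<phi>)))"
      using c comorphism_adj_choice[OF MND_arI[OF c]] by (simp add: comorphism_two_adjoints_def)
    from comorphism_two_adjoints.comparison_nat_iso[OF this] show ?thesis
      using alg_functr_comp[OF comorphism_adj_choice[OF a(1)] comorphism_adj_choice[OF a(2)] a(3)]
      by (simp add: ALG_ps_comp[OF a])
  qed
  have unit_ar: "ps_unit (ALG_ps R) T X = (X, comparison (mcat T) (id_radj (mcat T))
        (R (id_functr (mcat T))) (fst X), alg_ob (Id MND_co_adj T) (R (id_functr (mcat T))) X)" (is ?eq)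
      "ps_unit (ALG_ps R) T X \<in> Ar (ALG T)" (is ?ar)
    if T: "is_monad T" and X: "is_algebra T X" for T X
  proof -
    interpret eilenberg_moore T by unfold_locales fact
    have "ps_unit (ALG_ps R) T X \<in> hom (ALG T) X (fob (alg_functr (Id MND_co_adj T) (R (id_functr (mcat T)))) X)"
      using unit[OF T] X by (auto simp: nat_iso_def nat_trans_def)
    then show ?eq ?ar
      using X by (auto simp: ALG_ps_unit[OF T] hom_iff)
  qed
  have comp_ar: "ps_comp (ALG_ps R) \<phi> \<psi> X =
      (alg_ob \<phi> (R (cfun \<phi>)) (alg_ob \<psi> (R (cfun \<psi>)) X),
       comparison (mcat (csrc \<phi>)) (composite_adj \<psi> \<phi>)
         (R (comp_functr (cfun \<psi>) (cfun \<phi>))) (fst X),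
       alg_ob (\<psi> \<odot> \<phi>) (R (comp_functr (cfun \<psi>) (cfun \<phi>))) X)" (is ?eq)
      "ps_comp (ALG_ps R) \<phi> \<psi> X \<in> Ar (ALG (csrc \<phi>))" (is ?ar)
    if a: "\<phi> \<in> Ar MND_co_adj" "\<psi> \<in> Ar MND_co_adj" "csrc \<psi> = ctgt \<phi>" and X: "is_algebra (ctgt \<psi>) X"
    for \<phi> \<psi> X
  proof -
    interpret P: comorphism_adj \<phi> "R (cfun \<phi>)" by (rule comorphism_adj_choice[OF a(1)])
    interpret Q: comorphism_adj \<psi> "R (cfun \<psi>)" rewrites "csrc \<psi> = ctgt \<phi>"
      by (rule comorphism_adj_choice[OF a(2)]) (fact a(3))
    have "ps_comp (ALG_ps R) \<phi> \<psi> X \<in> hom (ALG (csrc \<phi>))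
        (fob (comp_functr (alg_functr \<phi> (R (cfun \<phi>))) (alg_functr \<psi> (R (cfun \<psi>)))) X)
        (fob (alg_functr (\<psi> \<odot> \<phi>) (R (comp_functr (cfun \<psi>) (cfun \<phi>)))) X)"
      using comp[OF a] X by (auto simp: nat_iso_def nat_trans_def)
    then show ?eq ?ar
      using X Q.alg_ob_algebra[OF X] by (auto simp: ALG_ps_comp[OF a] hom_iff)
  qed
  \<comment> \<open>On underlying arrows, the three laws of a pseudofunctor are the coherence laws of comparisons.\<close>
  have law_left: "ps_comp (ALG_ps R) \<phi> (Id MND_co_adj (ctgt \<phi>)) X \<cdot>\<^bsub>ALG (csrc \<phi>)\<^esub>
      far (alg_functr \<phi> (R (cfun \<phi>))) (ps_unit (ALG_ps R) (ctgt \<phi>) X)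
    = Id (ALG (csrc \<phi>)) (fob (alg_functr \<phi> (R (cfun \<phi>))) X)"
    if a: "\<phi> \<in> Ar MND_co_adj" and X: "is_algebra (ctgt \<phi>) X" for \<phi> X
  proof -
    interpret P: comorphism_adj \<phi> "R (cfun \<phi>)" by (rule comorphism_adj_choice[OF a])
    have i: "Id MND_co_adj (ctgt \<phi>) \<in> Ar MND_co_adj"
      by (rule MND_arI[OF comorphism_adj_id[OF P.S.monad]])
    have e [simp]: "Id MND_co_adj (ctgt \<phi>) \<odot> \<phi> = \<phi>"
      using category.id_comp[OF cat a] by simp
    note u = unit_ar[OF P.S.monad X]
    have c: "comparison P.A (comp_radj (id_functr P.B) (R (id_functr P.B)) P.F (R P.F)) (R P.F) (fst X)
        \<cdot>\<^bsub>P.A\<^esub> far P.G (comparison P.B (id_radj P.B) (R (id_functr P.B)) (fst X)) = Id P.A (fob P.G (fst X))"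
      by (rule comparison_id_left[OF P.adjunction_axioms])
        (use adjunction_choice[OF i] P.S.algebra_simps[OF X] in simp_all)
    show ?thesis
      using u(2) X unfolding comp_ar(1)[OF a i] u(1)
      by (simp add: comp_ar(1)[OF a i] comp_functr_id[OF P.F_functor] c)
  qed
  have law_right: "ps_comp (ALG_ps R) (Id MND_co_adj (csrc \<phi>)) \<phi> X \<cdot>\<^bsub>ALG (csrc \<phi>)\<^esub>
      ps_unit (ALG_ps R) (csrc \<phi>) (fob (alg_functr \<phi> (R (cfun \<phi>))) X)
    = Id (ALG (csrc \<phi>)) (fob (alg_functr \<phi> (R (cfun \<phi>))) X)"
    if a: "\<phi> \<in> Ar MND_co_adj" and X: "is_algebra (ctgt \<phi>) X" for \<phi> X
  proof -
    interpret P: comorphism_adj \<phi> "R (cfun \<phi>)" by (rule comorphism_adj_choice[OF a])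
    have i: "Id MND_co_adj (csrc \<phi>) \<in> Ar MND_co_adj"
      by (rule MND_arI[OF comorphism_adj_id[OF P.T.monad]])
    have e [simp]: "\<phi> \<odot> Id MND_co_adj (csrc \<phi>) = \<phi>"
      using category.comp_id[OF cat a] by simp
    note u = unit_ar[OF P.T.monad P.alg_ob_algebra[OF X]]
    have c: "comparison P.A (comp_radj P.F (R P.F) (id_functr P.A) (R (id_functr P.A))) (R P.F) (fst X)
        \<cdot>\<^bsub>P.A\<^esub> comparison P.A (id_radj P.A) (R (id_functr P.A)) (fob P.G (fst X)) = Id P.A (fob P.G (fst X))"
      by (rule comparison_id_right[OF P.adjunction_axioms])
        (use adjunction_choice[OF i] P.S.algebra_simps[OF X] in simp_all)
    show ?thesis
      using X by (simp add: u(1) comp_ar(1)[OF i a] comp_functr_id[OF P.F_functor] c)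
  qed
  have law_assoc: "ps_comp (ALG_ps R) (\<psi> \<odot> \<phi>) \<theta> X \<cdot>\<^bsub>ALG (csrc \<phi>)\<^esub>
      ps_comp (ALG_ps R) \<phi> \<psi> (fob (alg_functr \<theta> (R (cfun \<theta>))) X)
    = ps_comp (ALG_ps R) \<phi> (\<theta> \<odot> \<psi>) X \<cdot>\<^bsub>ALG (csrc \<phi>)\<^esub>
      far (alg_functr \<phi> (R (cfun \<phi>))) (ps_comp (ALG_ps R) \<psi> \<theta> X)"
    if a: "\<phi> \<in> Ar MND_co_adj" and b: "\<psi> \<in> Ar MND_co_adj" and c: "\<theta> \<in> Ar MND_co_adj"
      and ab: "csrc \<psi> = ctgt \<phi>" and bc: "csrc \<theta> = ctgt \<psi>" and X: "is_algebra (ctgt \<theta>) X"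
    for \<phi> \<psi> \<theta> X
  proof -
    interpret P: comorphism_adj \<phi> "R (cfun \<phi>)" by (rule comorphism_adj_choice[OF a])
    interpret P': comorphism_adj \<psi> "R (cfun \<psi>)" rewrites "csrc \<psi> = ctgt \<phi>"
      by (rule comorphism_adj_choice[OF b]) (fact ab)
    interpret P'': comorphism_adj \<theta> "R (cfun \<theta>)" rewrites "csrc \<theta> = ctgt \<psi>"
      by (rule comorphism_adj_choice[OF c]) (fact bc)
    have ba: "\<psi> \<odot> \<phi> \<in> Ar MND_co_adj" and cb: "\<theta> \<odot> \<psi> \<in> Ar MND_co_adj"
      and cba: "\<theta> \<odot> (\<psi> \<odot> \<phi>) \<in> Ar MND_co_adj"
      by (auto intro!: category.comp_ar(1)[OF cat] simp: a b c ab bc)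
    have e: "(\<theta> \<odot> \<psi>) \<odot> \<phi> = \<theta> \<odot> (\<psi> \<odot> \<phi>)"
      by (rule category.comp_assoc[OF cat]) (use a b c ab bc in simp_all)
    have e': "comp_functr (comp_functr P''.F P'.F) P.F = comp_functr P''.F (comp_functr P'.F P.F)"
      by (rule comp_functr_assoc[OF P.F_functor P'.F_functor P''.F_functor])
    have X': "is_algebra (ctgt \<psi>) (alg_ob \<theta> (R (cfun \<theta>)) X)" by (rule P''.alg_ob_algebra[OF X])
    have co: "comparison P.A (comp_radj P''.F (R P''.F) (comp_functr P'.F P.F) (R (comp_functr P'.F P.F)))
          (R (comp_functr P''.F (comp_functr P'.F P.F))) (fst X) \<cdot>\<^bsub>P.A\<^esub>
        comparison P.A (comp_radj P'.F (R P'.F) P.F (R P.F)) (R (comp_functr P'.F P.F)) (fob P''.G (fst X))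
      = comparison P.A (comp_radj (comp_functr P''.F P'.F) (R (comp_functr P''.F P'.F)) P.F (R P.F))
          (R (comp_functr P''.F (comp_functr P'.F P.F))) (fst X) \<cdot>\<^bsub>P.A\<^esub>
        far P.G (comparison P.B (comp_radj P''.F (R P''.F) P'.F (R P'.F)) (R (comp_functr P''.F P'.F)) (fst X))"
      by (rule comparison_comp_assoc[OF P.adjunction_axioms P'.adjunction_axioms P''.adjunction_axioms])
        (use adjunction_choice[OF ba] adjunction_choice[OF cb] adjunction_choice[OF cba]
          P''.S.algebra_simps[OF X] ab in simp_all)
    have ar: "(alg_ob \<psi> (R P'.F) (alg_ob \<theta> (R P''.F) X),
        comparison P.B (comp_radj P''.F (R P''.F) P'.F (R P'.F)) (R (comp_functr P''.F P'.F)) (fst X),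
        alg_ob (\<theta> \<odot> \<psi>) (R (comp_functr P''.F P'.F)) X) \<in> Ar (ALG P.S)"
      using comp_ar[OF b c bc X] ab by simp
    show ?thesis
      using X X' ar ab
      by (simp add: comp_ar(1)[OF ba c] comp_ar(1)[OF a b] comp_ar(1)[OF a cb] comp_ar(1)[OF b c]
          bc e e' co)
  qed
  have alg: "X \<in> Ob (ALG T) \<longleftrightarrow> is_algebra T X" for T :: "('o, 'a) monad" and X
    by (simp add: ALG_def)
  have monads: "is_monad (csrc \<phi>)" "is_monad (ctgt \<phi>)" if "\<phi> \<in> Ar MND_co_adj"
    for \<phi> :: "('o, 'a) comorphism"
    using that by (auto simp: MND_ar_iff is_comorphism_def Let_def)
  show ?thesis
    unfolding pseudofunctor_def
    by (intro conjI ballI impI; (elim conjE)?)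
      (simp_all add: category_op[OF cat] eilenberg_moore.category_ALG eilenberg_moore_def
        ar unit comp law_left law_right law_assoc alg)
qed

end

section \<open>Precomposition and transport of pseudofunctors\<close>
lemma pseudofunctorD:
  assumes "pseudofunctor B P"
  shows "category B" "\<And>b. b \<in> Ob B \<Longrightarrow> category (ps_ob P b)"
    "\<And>f. f \<in> Ar B \<Longrightarrow> functor_between (ps_ob P (Dom B f)) (ps_ob P (Cod B f)) (ps_ar P f)"
    "\<And>b. b \<in> Ob B \<Longrightarrow> nat_iso (id_functr (ps_ob P b)) (ps_ar P (Id B b)) (ps_unit P b)"
    "\<And>f g. \<lbrakk>f \<in> Ar B; g \<in> Ar B; Dom B g = Cod B f\<rbrakk> \<Longrightarrow>
      nat_iso (comp_functr (ps_ar P g) (ps_ar P f)) (ps_ar P (g \<cdot>\<^bsub>B\<^esub> f)) (ps_comp P g f)"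
    "\<And>f x. \<lbrakk>f \<in> Ar B; x \<in> Ob (ps_ob P (Dom B f))\<rbrakk> \<Longrightarrow>
      ps_comp P f (Id B (Dom B f)) x \<cdot>\<^bsub>ps_ob P (Cod B f)\<^esub> far (ps_ar P f) (ps_unit P (Dom B f) x)
        = Id (ps_ob P (Cod B f)) (fob (ps_ar P f) x)"
    "\<And>f x. \<lbrakk>f \<in> Ar B; x \<in> Ob (ps_ob P (Dom B f))\<rbrakk> \<Longrightarrow>
      ps_comp P (Id B (Cod B f)) f x \<cdot>\<^bsub>ps_ob P (Cod B f)\<^esub> ps_unit P (Cod B f) (fob (ps_ar P f) x)
        = Id (ps_ob P (Cod B f)) (fob (ps_ar P f) x)"
    "\<And>f g h x. \<lbrakk>f \<in> Ar B; g \<in> Ar B; h \<in> Ar B; Dom B g = Cod B f; Dom B h = Cod B g;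
        x \<in> Ob (ps_ob P (Dom B f))\<rbrakk> \<Longrightarrow>
      ps_comp P (h \<cdot>\<^bsub>B\<^esub> g) f x \<cdot>\<^bsub>ps_ob P (Cod B h)\<^esub> ps_comp P h g (fob (ps_ar P f) x)
        = ps_comp P h (g \<cdot>\<^bsub>B\<^esub> f) x \<cdot>\<^bsub>ps_ob P (Cod B h)\<^esub> far (ps_ar P h) (ps_comp P g f x)"
  using assms unfolding pseudofunctor_def by blast+

lemma pseudofunctorI:
  assumes "category B" "\<And>b. b \<in> Ob B \<Longrightarrow> category (ps_ob P b)"
    "\<And>f. f \<in> Ar B \<Longrightarrow> functor_between (ps_ob P (Dom B f)) (ps_ob P (Cod B f)) (ps_ar P f)"
    "\<And>b. b \<in> Ob B \<Longrightarrow> nat_iso (id_functr (ps_ob P b)) (ps_ar P (Id B b)) (ps_unit P b)"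
    "\<And>f g. \<lbrakk>f \<in> Ar B; g \<in> Ar B; Dom B g = Cod B f\<rbrakk> \<Longrightarrow>
      nat_iso (comp_functr (ps_ar P g) (ps_ar P f)) (ps_ar P (g \<cdot>\<^bsub>B\<^esub> f)) (ps_comp P g f)"
    "\<And>f x. \<lbrakk>f \<in> Ar B; x \<in> Ob (ps_ob P (Dom B f))\<rbrakk> \<Longrightarrow>
      ps_comp P f (Id B (Dom B f)) x \<cdot>\<^bsub>ps_ob P (Cod B f)\<^esub> far (ps_ar P f) (ps_unit P (Dom B f) x)
        = Id (ps_ob P (Cod B f)) (fob (ps_ar P f) x)"
    "\<And>f x. \<lbrakk>f \<in> Ar B; x \<in> Ob (ps_ob P (Dom B f))\<rbrakk> \<Longrightarrow>
      ps_comp P (Id B (Cod B f)) f x \<cdot>\<^bsub>ps_ob P (Cod B f)\<^esub> ps_unit P (Cod B f) (fob (ps_ar P f) x)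
        = Id (ps_ob P (Cod B f)) (fob (ps_ar P f) x)"
    "\<And>f g h x. \<lbrakk>f \<in> Ar B; g \<in> Ar B; h \<in> Ar B; Dom B g = Cod B f; Dom B h = Cod B g;
        x \<in> Ob (ps_ob P (Dom B f))\<rbrakk> \<Longrightarrow>
      ps_comp P (h \<cdot>\<^bsub>B\<^esub> g) f x \<cdot>\<^bsub>ps_ob P (Cod B h)\<^esub> ps_comp P h g (fob (ps_ar P f) x)
        = ps_comp P h (g \<cdot>\<^bsub>B\<^esub> f) x \<cdot>\<^bsub>ps_ob P (Cod B h)\<^esub> far (ps_ar P h) (ps_comp P g f x)"
  shows "pseudofunctor B P"
  using assms unfolding pseudofunctor_def by blast

text \<open>
  The functor being strict, every law of the composite is an instance of the same law of \<open>P\<close>.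
\<close>

lemma pseudofunctor_precomp:
  assumes "pseudofunctor B P" "functor_between A B K"
  shows "pseudofunctor A (ps_precomp P K)"
proof -
  note D = pseudofunctorD[OF assms(1)]
  note K = functor_between_simps[OF assms(2)]
  interpret A: category A by (rule functor_between_cat[OF assms(2)])
  have P: "functor_between (ps_ob P (fob K (Dom A f))) (ps_ob P (fob K (Cod A f))) (ps_ar P (far K f))"
    if "f \<in> Ar A" for f
    using D(3)[of "far K f"] that by (simp add: K)
  show ?thesis
  proof (rule pseudofunctorI, unfold ps_precomp_def psfun.simps, goal_cases)
    case (6 f x) then show ?case using D(6)[of "far K f" x] by (simp add: K)
  next
    case (7 f x) then show ?case using D(7)[of "far K f" x] by (simp add: K)
  next
    case (8 f g h x) then show ?case using D(8)[of "far K f" "far K g" "far K h" x] by (simp add: K)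
  qed (simp_all add: A.category_axioms D K P)
qed

lemma nat_iso_whisker:
  assumes "nat_iso F G \<tau>" "functor_between A B F" "functor_between A' A H" "functor_between B B' K"
  shows "nat_iso (comp_functr K (comp_functr F H)) (comp_functr K (comp_functr G H))
    (\<lambda>y\<in>Ob A'. far K (\<tau> (fob H y)))"
proof -
  have nt: "nat_trans F G \<tau>" and iso: "\<And>x. x \<in> Ob A \<Longrightarrow> is_iso B (\<tau> x)"
    using assms(1,2) by (auto simp: nat_iso_def functor_between_def)
  have G: "functor_between A B G"
    using nt assms(2) by (auto simp: nat_trans_def functor_between_def)
  note FS [simp] = functor_between_simps[OF assms(2)] functor_between_simps[OF assms(3)]
    functor_between_simps[OF assms(4)] functor_between_simps[OF G] nat_trans_simps(1-3)[OF nt assms(2)]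
  interpret B: category B by (rule functor_between_cat[OF assms(2)])
  interpret B': category B' by (rule functor_between_cat[OF assms(4)])
  interpret A': category A' by (rule functor_between_cat[OF assms(3)])
  let ?\<sigma> = "\<lambda>y\<in>Ob A'. far K (\<tau> (fob H y))"
  have "nat_trans (comp_functr K (comp_functr F H)) (comp_functr K (comp_functr G H)) ?\<sigma>"
  proof (rule nat_transI[of A' B'])
    fix f assume f: "f \<in> Ar A'"
    have "far K (\<tau> (fob H (Cod A' f))) \<cdot>\<^bsub>B'\<^esub> far K (far F (far H f))
        = far K (\<tau> (fob H (Cod A' f)) \<cdot>\<^bsub>B\<^esub> far F (far H f))"
      using f by simp
    also have "\<dots> = far K (far G (far H f) \<cdot>\<^bsub>B\<^esub> \<tau> (fob H (Dom A' f)))"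
      using nat_trans_natural[OF nt assms(2), of "far H f"] f by simp
    finally show "?\<sigma> (Cod A' f) \<cdot>\<^bsub>B'\<^esub> far (comp_functr K (comp_functr F H)) f
        = far (comp_functr K (comp_functr G H)) f \<cdot>\<^bsub>B'\<^esub> ?\<sigma> (Dom A' f)"
      using f by simp
  qed (use functor_between_comp assms(2-4) G in \<open>auto simp: hom_iff intro!: functor_between_comp\<close>)
  moreover have "is_iso B' (?\<sigma> y)" if y: "y \<in> Ob A'" for y
  proof -
    obtain g where g: "g \<in> Ar B" "Dom B g = fob G (fob H y)" "Cod B g = fob F (fob H y)"
      and inv: "g \<cdot>\<^bsub>B\<^esub> \<tau> (fob H y) = Id B (fob F (fob H y))" "\<tau> (fob H y) \<cdot>\<^bsub>B\<^esub> g = Id B (fob G (fob H y))"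
      using iso[of "fob H y"] y by (auto simp: is_iso_def hom_iff)
    show ?thesis
      by (rule B'.is_isoI[where g = "far K g" and x = "fob K (fob F (fob H y))" and y = "fob K (fob G (fob H y))"])
        (use g y inv in \<open>simp_all add: hom_iff flip: functor_between_simps(8)[OF assms(4)]\<close>)
  qed
  ultimately show ?thesis by (simp add: nat_iso_def)
qed

text \<open>
  Meaningful for isomorphisms of categories only, where the choice is unique.
\<close>

definition inverse_functr :: "('o, 'a, 'p, 'b) functr \<Rightarrow> ('p, 'b, 'o, 'a) functr" where
  "inverse_functr F = (SOME G. functor_between (ftgt F) (fsrc F) G
    \<and> comp_functr G F = id_functr (fsrc F) \<and> comp_functr F G = id_functr (ftgt F))"

lemma inverse_functr:
  assumes "cat_isomorphism A B F"
  shows "functor_between A B F" "functor_between B A (inverse_functr F)"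
    "comp_functr (inverse_functr F) F = id_functr A" "comp_functr F (inverse_functr F) = id_functr B"
proof -
  show F: "functor_between A B F" using assms by (simp add: cat_isomorphism_def)
  obtain G where "functor_between B A G \<and> comp_functr G F = id_functr A \<and> comp_functr F G = id_functr B"
    using assms by (auto simp: cat_isomorphism_def)
  from someI[of "\<lambda>G. functor_between B A G \<and> comp_functr G F = id_functr A \<and> comp_functr F G = id_functr B", OF this]
  show "functor_between B A (inverse_functr F)"
    "comp_functr (inverse_functr F) F = id_functr A" "comp_functr F (inverse_functr F) = id_functr B"
    unfolding inverse_functr_def functor_between_simps(1,2)[OF F] by blast+
qed

text \<open>
  The pseudofunctor with values \<open>Q b\<close> that makes the isomorphisms \<open>\<Phi> b : P b \<cong> Q b\<close> strictly natural;
  functors and cells are conjugated by \<open>\<Phi>\<close>.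
\<close>

definition ps_transport ::
  "('o, 'a) cat \<Rightarrow> ('o, 'a, 'p, 'b) psfun \<Rightarrow> ('o \<Rightarrow> ('q, 'c) cat) \<Rightarrow> ('o \<Rightarrow> ('p, 'b, 'q, 'c) functr) \<Rightarrow>
   ('o, 'a, 'q, 'c) psfun" where
  "ps_transport B P Q \<Phi> = \<lparr>ps_ob = Q,
    ps_ar = (\<lambda>f. comp_functr (\<Phi> (Cod B f)) (comp_functr (ps_ar P f) (inverse_functr (\<Phi> (Dom B f))))),
    ps_unit = (\<lambda>b. \<lambda>y\<in>Ob (Q b). far (\<Phi> b) (ps_unit P b (fob (inverse_functr (\<Phi> b)) y))),
    ps_comp = (\<lambda>g f. \<lambda>y\<in>Ob (Q (Dom B f)).
      far (\<Phi> (Cod B g)) (ps_comp P g f (fob (inverse_functr (\<Phi> (Dom B f))) y)))\<rparr>"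

locale transport =
  fixes B :: "('o, 'a) cat" and P :: "('o, 'a, 'p, 'b) psfun" and Q :: "'o \<Rightarrow> ('q, 'c) cat"
    and \<Phi> :: "'o \<Rightarrow> ('p, 'b, 'q, 'c) functr"
  assumes ps: "pseudofunctor B P"
    and iso: "b \<in> Ob B \<Longrightarrow> cat_isomorphism (ps_ob P b) (Q b) (\<Phi> b)"
begin

abbreviation \<Psi> where "\<Psi> b \<equiv> inverse_functr (\<Phi> b)"
abbreviation P' where "P' \<equiv> ps_transport B P Q \<Phi>"

sublocale B: category B by (rule pseudofunctorD[OF ps])

lemmas P_functor = pseudofunctorD(3)[OF ps]
lemmas \<Phi>_functor = inverse_functr(1)[OF iso]
lemmas \<Psi>_functor = inverse_functr(2)[OF iso]
lemmas \<Phi>_simps [simp] = functor_between_simps[OF \<Phi>_functor]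
lemmas \<Psi>_simps [simp] = functor_between_simps[OF \<Psi>_functor]
lemmas P_simps [simp] = functor_between_simps[OF P_functor]

lemma \<Psi>_inverse [simp]:
  assumes "b \<in> Ob B"
  shows "\<And>x. x \<in> Ob (ps_ob P b) \<Longrightarrow> fob (\<Psi> b) (fob (\<Phi> b) x) = x"
    "\<And>y. y \<in> Ob (Q b) \<Longrightarrow> fob (\<Phi> b) (fob (\<Psi> b) y) = y"
    "\<And>f. f \<in> Ar (ps_ob P b) \<Longrightarrow> far (\<Psi> b) (far (\<Phi> b) f) = f"
    "\<And>g. g \<in> Ar (Q b) \<Longrightarrow> far (\<Phi> b) (far (\<Psi> b) g) = g"
proof -
  note e = inverse_functr(3,4)[OF iso[OF assms]]
  show "fob (\<Psi> b) (fob (\<Phi> b) x) = x" if "x \<in> Ob (ps_ob P b)" for x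
    using arg_cong[OF e(1), of "\<lambda>H. fob H x"] assms that by simp
  show "fob (\<Phi> b) (fob (\<Psi> b) y) = y" if "y \<in> Ob (Q b)" for y
    using arg_cong[OF e(2), of "\<lambda>H. fob H y"] assms that by simp
  show "far (\<Psi> b) (far (\<Phi> b) f) = f" if "f \<in> Ar (ps_ob P b)" for f
    using arg_cong[OF e(1), of "\<lambda>H. far H f"] assms that by simp
  show "far (\<Phi> b) (far (\<Psi> b) g) = g" if "g \<in> Ar (Q b)" for g
    using arg_cong[OF e(2), of "\<lambda>H. far H g"] assms that by simp
qed

lemma transport_simps [simp]:
  "ps_ob P' = Q"
  "ps_ar P' f = comp_functr (\<Phi> (Cod B f)) (comp_functr (ps_ar P f) (\<Psi> (Dom B f)))"
  "y \<in> Ob (Q b) \<Longrightarrow> ps_unit P' b y = far (\<Phi> b) (ps_unit P b (fob (\<Psi> b) y))"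
  "y \<in> Ob (Q (Dom B f)) \<Longrightarrow> ps_comp P' g f y = far (\<Phi> (Cod B g)) (ps_comp P g f (fob (\<Psi> (Dom B f)) y))"
  by (simp_all add: ps_transport_def)

lemma cell_simps [simp]:
  "b \<in> Ob B \<Longrightarrow> x \<in> Ob (ps_ob P b) \<Longrightarrow> ps_unit P b x \<in> Ar (ps_ob P b)"
  "b \<in> Ob B \<Longrightarrow> x \<in> Ob (ps_ob P b) \<Longrightarrow> Dom (ps_ob P b) (ps_unit P b x) = x"
  "b \<in> Ob B \<Longrightarrow> x \<in> Ob (ps_ob P b) \<Longrightarrow> Cod (ps_ob P b) (ps_unit P b x) = fob (ps_ar P (Id B b)) x"
  "\<lbrakk>f \<in> Ar B; g \<in> Ar B; Dom B g = Cod B f; x \<in> Ob (ps_ob P (Dom B f))\<rbrakk> \<Longrightarrow>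
    ps_comp P g f x \<in> Ar (ps_ob P (Cod B g))"
  "\<lbrakk>f \<in> Ar B; g \<in> Ar B; Dom B g = Cod B f; x \<in> Ob (ps_ob P (Dom B f))\<rbrakk> \<Longrightarrow>
    Dom (ps_ob P (Cod B g)) (ps_comp P g f x) = fob (ps_ar P g) (fob (ps_ar P f) x)"
  "\<lbrakk>f \<in> Ar B; g \<in> Ar B; Dom B g = Cod B f; x \<in> Ob (ps_ob P (Dom B f))\<rbrakk> \<Longrightarrow>
    Cod (ps_ob P (Cod B g)) (ps_comp P g f x) = fob (ps_ar P (g \<cdot>\<^bsub>B\<^esub> f)) x"
proof -
  assume "b \<in> Ob B" and x: "x \<in> Ob (ps_ob P b)"
  then have "ps_unit P b x \<in> hom (ps_ob P b) x (fob (ps_ar P (Id B b)) x)"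
    using pseudofunctorD(4)[OF ps, of b] by (auto simp: nat_iso_def nat_trans_def)
  then show "ps_unit P b x \<in> Ar (ps_ob P b)" "Dom (ps_ob P b) (ps_unit P b x) = x"
    "Cod (ps_ob P b) (ps_unit P b x) = fob (ps_ar P (Id B b)) x" by (auto simp: hom_iff)
next
  assume f: "f \<in> Ar B" "g \<in> Ar B" "Dom B g = Cod B f" and x: "x \<in> Ob (ps_ob P (Dom B f))"
  then have "ps_comp P g f x \<in> hom (ps_ob P (Cod B g)) (fob (ps_ar P g) (fob (ps_ar P f) x))
      (fob (ps_ar P (g \<cdot>\<^bsub>B\<^esub> f)) x)"
    using pseudofunctorD(5)[OF ps f] P_simps[OF f(1)] P_simps[OF f(2)]
    by (auto simp: nat_iso_def nat_trans_def)
  then show "ps_comp P g f x \<in> Ar (ps_ob P (Cod B g))"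
    "Dom (ps_ob P (Cod B g)) (ps_comp P g f x) = fob (ps_ar P g) (fob (ps_ar P f) x)"
    "Cod (ps_ob P (Cod B g)) (ps_comp P g f x) = fob (ps_ar P (g \<cdot>\<^bsub>B\<^esub> f)) x" by (auto simp: hom_iff)
qed

lemma transport_ar_functor:
  "f \<in> Ar B \<Longrightarrow> functor_between (Q (Dom B f)) (Q (Cod B f)) (ps_ar P' f)"
  by (auto intro!: functor_between_comp P_functor \<Phi>_functor \<Psi>_functor)

lemma transport_id:
  assumes "b \<in> Ob B"
  shows "comp_functr (\<Phi> b) (comp_functr (id_functr (ps_ob P b)) (\<Psi> b)) = id_functr (Q b)"
  using comp_functr_id(2)[OF \<Psi>_functor[OF assms]] inverse_functr(4)[OF iso[OF assms]] by simp

lemma transport_comp: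
  assumes "f \<in> Ar B" "g \<in> Ar B" "Dom B g = Cod B f"
  shows "comp_functr (\<Phi> (Cod B g)) (comp_functr (comp_functr (ps_ar P g) (ps_ar P f)) (\<Psi> (Dom B f)))
    = comp_functr (ps_ar P' g) (ps_ar P' f)"
proof (rule functor_between_eqI[of "Q (Dom B f)" "Q (Cod B g)"])
  have "functor_between (ps_ob P (Cod B f)) (ps_ob P (Cod B g)) (ps_ar P g)"
    using P_functor[OF assms(2)] assms(3) by simp
  with P_functor[OF assms(1)] show "functor_between (Q (Dom B f)) (Q (Cod B g))
    (comp_functr (\<Phi> (Cod B g)) (comp_functr (comp_functr (ps_ar P g) (ps_ar P f)) (\<Psi> (Dom B f))))"
    using assms by (auto intro!: functor_between_comp \<Phi>_functor \<Psi>_functor)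
  show "functor_between (Q (Dom B f)) (Q (Cod B g)) (comp_functr (ps_ar P' g) (ps_ar P' f))"
    using transport_ar_functor[OF assms(1)] transport_ar_functor[OF assms(2)] assms(3)
    by (auto intro: functor_between_comp)
qed (use assms P_simps[OF assms(1)] P_simps[OF assms(2)] in simp_all)

lemma transport_pseudofunctor: "pseudofunctor B P'"
proof -
  note D = pseudofunctorD[OF ps]
  have u: "nat_iso (id_functr (Q b)) (ps_ar P' (Id B b)) (ps_unit P' b)" if b: "b \<in> Ob B" for b
  proof -
    have "ps_unit P' b = (\<lambda>y\<in>Ob (Q b). far (\<Phi> b) (ps_unit P b (fob (\<Psi> b) y)))"
      by (simp add: ps_transport_def)
    then show ?thesis
      using nat_iso_whisker[OF D(4)[OF b] functor_between_id[OF D(2)[OF b]] \<Psi>_functor[OF b] \<Phi>_functor[OF b]] b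
      by (simp add: transport_id)
  qed
  have c: "nat_iso (comp_functr (ps_ar P' g) (ps_ar P' f)) (ps_ar P' (g \<cdot>\<^bsub>B\<^esub> f)) (ps_comp P' g f)"
    if f: "f \<in> Ar B" "g \<in> Ar B" "Dom B g = Cod B f" for f g
  proof -
    have e: "ps_comp P' g f = (\<lambda>y\<in>Ob (Q (Dom B f)). far (\<Phi> (Cod B g)) (ps_comp P g f (fob (\<Psi> (Dom B f)) y)))"
      by (simp add: ps_transport_def)
    have "functor_between (ps_ob P (Dom B f)) (ps_ob P (Cod B g)) (comp_functr (ps_ar P g) (ps_ar P f))"
      using P_functor[OF f(1)] P_functor[OF f(2)] f(3) by (auto intro: functor_between_comp)
    from nat_iso_whisker[OF D(5)[OF f] this \<Psi>_functor \<Phi>_functor]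
    show ?thesis using f by (simp add: transport_comp[OF f, unfolded transport_simps] e)
  qed
  have l: "ps_comp P' f (Id B (Dom B f)) y \<cdot>\<^bsub>Q (Cod B f)\<^esub> far (ps_ar P' f) (ps_unit P' (Dom B f) y)
      = Id (Q (Cod B f)) (fob (ps_ar P' f) y)" if f: "f \<in> Ar B" and y: "y \<in> Ob (Q (Dom B f))" for f y
  proof -
    let ?x = "fob (\<Psi> (Dom B f)) y"
    have "far (\<Phi> (Cod B f)) (ps_comp P f (Id B (Dom B f)) ?x) \<cdot>\<^bsub>Q (Cod B f)\<^esub>
        far (\<Phi> (Cod B f)) (far (ps_ar P f) (ps_unit P (Dom B f) ?x))
      = far (\<Phi> (Cod B f)) (ps_comp P f (Id B (Dom B f)) ?x \<cdot>\<^bsub>ps_ob P (Cod B f)\<^esub>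
        far (ps_ar P f) (ps_unit P (Dom B f) ?x))"
      using f y P_simps[OF f] by simp
    then show ?thesis using f y P_simps[OF f] D(6)[OF f, of ?x] by simp
  qed
  have r: "ps_comp P' (Id B (Cod B f)) f y \<cdot>\<^bsub>Q (Cod B f)\<^esub> ps_unit P' (Cod B f) (fob (ps_ar P' f) y)
      = Id (Q (Cod B f)) (fob (ps_ar P' f) y)" if f: "f \<in> Ar B" and y: "y \<in> Ob (Q (Dom B f))" for f y
  proof -
    let ?x = "fob (\<Psi> (Dom B f)) y"
    have c: "ps_comp P (Id B (Cod B f)) f ?x \<in> Ar (ps_ob P (Cod B f))"
        "Dom (ps_ob P (Cod B f)) (ps_comp P (Id B (Cod B f)) f ?x) = fob (ps_ar P (Id B (Cod B f))) (fob (ps_ar P f) ?x)"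
      using cell_simps(4,5)[of f "Id B (Cod B f)" ?x] f y by simp_all
    have "far (\<Phi> (Cod B f)) (ps_comp P (Id B (Cod B f)) f ?x) \<cdot>\<^bsub>Q (Cod B f)\<^esub>
        far (\<Phi> (Cod B f)) (ps_unit P (Cod B f) (fob (ps_ar P f) ?x))
      = far (\<Phi> (Cod B f)) (ps_comp P (Id B (Cod B f)) f ?x \<cdot>\<^bsub>ps_ob P (Cod B f)\<^esub>
        ps_unit P (Cod B f) (fob (ps_ar P f) ?x))"
      using f y P_simps[OF f] c by simp
    then show ?thesis using f y P_simps[OF f] D(7)[OF f, of ?x] by simp
  qed
  have a: "ps_comp P' (h \<cdot>\<^bsub>B\<^esub> g) f y \<cdot>\<^bsub>Q (Cod B h)\<^esub> ps_comp P' h g (fob (ps_ar P' f) y)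
      = ps_comp P' h (g \<cdot>\<^bsub>B\<^esub> f) y \<cdot>\<^bsub>Q (Cod B h)\<^esub> far (ps_ar P' h) (ps_comp P' g f y)"
    if f: "f \<in> Ar B" "g \<in> Ar B" "h \<in> Ar B" "Dom B g = Cod B f" "Dom B h = Cod B g"
      and y: "y \<in> Ob (Q (Dom B f))" for f g h y
  proof -
    let ?x = "fob (\<Psi> (Dom B f)) y"
    note S = P_simps[OF f(1)] P_simps[OF f(2), unfolded f(4)] P_simps[OF f(3), unfolded f(5)] f y
    have c1: "ps_comp P (h \<cdot>\<^bsub>B\<^esub> g) f ?x \<in> Ar (ps_ob P (Cod B h))"
      "Dom (ps_ob P (Cod B h)) (ps_comp P (h \<cdot>\<^bsub>B\<^esub> g) f ?x) = fob (ps_ar P (h \<cdot>\<^bsub>B\<^esub> g)) (fob (ps_ar P f) ?x)"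
      using cell_simps(4,5)[of f "h \<cdot>\<^bsub>B\<^esub> g" ?x] f y by simp_all
    have c2: "ps_comp P h g (fob (ps_ar P f) ?x) \<in> Ar (ps_ob P (Cod B h))"
      "Cod (ps_ob P (Cod B h)) (ps_comp P h g (fob (ps_ar P f) ?x)) = fob (ps_ar P (h \<cdot>\<^bsub>B\<^esub> g)) (fob (ps_ar P f) ?x)"
      using cell_simps(4,6)[of g h "fob (ps_ar P f) ?x"] S by simp_all
    have c3: "ps_comp P h (g \<cdot>\<^bsub>B\<^esub> f) ?x \<in> Ar (ps_ob P (Cod B h))"
      "Dom (ps_ob P (Cod B h)) (ps_comp P h (g \<cdot>\<^bsub>B\<^esub> f) ?x) = fob (ps_ar P h) (fob (ps_ar P (g \<cdot>\<^bsub>B\<^esub> f)) ?x)"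
      using cell_simps(4,5)[of "g \<cdot>\<^bsub>B\<^esub> f" h ?x] f y by simp_all
    have c4: "ps_comp P g f ?x \<in> Ar (ps_ob P (Cod B g))"
      "Cod (ps_ob P (Cod B g)) (ps_comp P g f ?x) = fob (ps_ar P (g \<cdot>\<^bsub>B\<^esub> f)) ?x"
      using cell_simps(4,6)[of f g ?x] f y by simp_all
    have "far (\<Phi> (Cod B h)) (ps_comp P (h \<cdot>\<^bsub>B\<^esub> g) f ?x) \<cdot>\<^bsub>Q (Cod B h)\<^esub>
        far (\<Phi> (Cod B h)) (ps_comp P h g (fob (ps_ar P f) ?x))
      = far (\<Phi> (Cod B h)) (ps_comp P (h \<cdot>\<^bsub>B\<^esub> g) f ?x \<cdot>\<^bsub>ps_ob P (Cod B h)\<^esub> ps_comp P h g (fob (ps_ar P f) ?x))"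
      using f c1 c2 by simp
    also have "\<dots> = far (\<Phi> (Cod B h)) (ps_comp P h (g \<cdot>\<^bsub>B\<^esub> f) ?x) \<cdot>\<^bsub>Q (Cod B h)\<^esub>
        far (\<Phi> (Cod B h)) (far (ps_ar P h) (ps_comp P g f ?x))"
      using D(8)[OF f, of ?x] c3 c4 S by simp
    finally show ?thesis using S c4 by simp
  qed
  have q: "category (Q b)" if "b \<in> Ob B" for b
    by (rule functor_between_cat[OF \<Phi>_functor[OF that]])
  show ?thesis
    unfolding pseudofunctor_def transport_simps(1)
    using u c l r a q transport_ar_functor B.category_axioms by blast
qed

lemma transport_isomorphism: "ps_isomorphism B P P' \<Phi>"
proof -
  have "comp_functr (\<Phi> (Cod B f)) (ps_ar P f) = comp_functr (ps_ar P' f) (\<Phi> (Dom B f))"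
    if f: "f \<in> Ar B" for f
    by (rule functor_between_eqI[of "ps_ob P (Dom B f)" "Q (Cod B f)"])
      (use f P_simps[OF f] transport_ar_functor[OF f] in
        \<open>auto intro!: functor_between_comp P_functor \<Phi>_functor \<Psi>_functor\<close>)
  then show ?thesis unfolding ps_isomorphism_def by (auto simp: iso)
qed

lemma transport_strict:
  assumes "\<And>b. b \<in> Ob B \<Longrightarrow> ps_ar P (Id B b) = id_functr (ps_ob P b)"
    and "\<And>f g. \<lbrakk>f \<in> Ar B; g \<in> Ar B; Dom B g = Cod B f\<rbrakk> \<Longrightarrow>
      ps_ar P (g \<cdot>\<^bsub>B\<^esub> f) = comp_functr (ps_ar P g) (ps_ar P f)"
  shows "b \<in> Ob B \<Longrightarrow> ps_ar P' (Id B b) = id_functr (Q b)"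
    and "\<lbrakk>f \<in> Ar B; g \<in> Ar B; Dom B g = Cod B f\<rbrakk> \<Longrightarrow>
      ps_ar P' (g \<cdot>\<^bsub>B\<^esub> f) = comp_functr (ps_ar P' g) (ps_ar P' f)"
  using transport_comp[of f g] by (simp_all add: assms transport_id)

end

lemma ps_functr_functor:
  assumes ps: "pseudofunctor B P"
    and "\<And>b. b \<in> Ob B \<Longrightarrow> ps_ar P (Id B b) = id_functr (ps_ob P b)"
    and "\<And>f g. \<lbrakk>f \<in> Ar B; g \<in> Ar B; Dom B g = Cod B f\<rbrakk> \<Longrightarrow>
      ps_ar P (g \<cdot>\<^bsub>B\<^esub> f) = comp_functr (ps_ar P g) (ps_ar P f)"
  shows "functor_between B CAT (ps_functr B P)"
proof -
  note D = pseudofunctorD[OF ps]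
  interpret category B by (rule D)
  show ?thesis
  proof (rule functor_betweenI)
    fix f assume f: "f \<in> Ar B"
    show "far (ps_functr B P) f \<in> Ar CAT
        \<and> Dom CAT (far (ps_functr B P) f) = fob (ps_functr B P) (Dom B f)
        \<and> Cod CAT (far (ps_functr B P) f) = fob (ps_functr B P) (Cod B f)"
      using functor_between_is_functor[OF D(3)[OF f]] f by (simp add: ps_functr_def CAT_def)
  qed (simp_all add: ps_functr_def category_axioms category_CAT assms D, simp_all add: CAT_def D)
qed

section \<open>Pullbacks and slices\<close>
locale pullback_category = category C for C :: "('o, 'a) cat" +
  fixes pb :: "'a \<Rightarrow> 'a \<Rightarrow> 'a \<times> 'a"
  assumes pullback_choice: "pullback_choice C pb"
begin

lemma pullback: "\<lbrakk>f \<in> Ar C; g \<in> Ar C; Cod C f = Cod C g\<rbrakk> \<Longrightarrow> is_pullback C f g (fst (pb f g)) (snd (pb f g))"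
  using pullback_choice by (simp add: pullback_choice_def)

lemma Dom_fst [simp]: "Dom C (fst (pb f g)) = pbob C pb f g"
  by (simp add: pbob_def)

lemma projections [simp]:
  assumes "f \<in> Ar C" "g \<in> Ar C" "Cod C f = Cod C g"
  shows "fst (pb f g) \<in> Ar C" "Cod C (fst (pb f g)) = Dom C f" "pbob C pb f g \<in> Ob C"
    "snd (pb f g) \<in> Ar C" "Dom C (snd (pb f g)) = pbob C pb f g" "Cod C (snd (pb f g)) = Dom C g"
    "f \<cdot>\<^bsub>C\<^esub> fst (pb f g) = g \<cdot>\<^bsub>C\<^esub> snd (pb f g)"
proof -
  show "fst (pb f g) \<in> Ar C" "Cod C (fst (pb f g)) = Dom C f"
    "snd (pb f g) \<in> Ar C" "Dom C (snd (pb f g)) = pbob C pb f g" "Cod C (snd (pb f g)) = Dom C g"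
    "f \<cdot>\<^bsub>C\<^esub> fst (pb f g) = g \<cdot>\<^bsub>C\<^esub> snd (pb f g)"
    using pullback[OF assms] by (auto simp: is_pullback_def hom_iff)
  then show "pbob C pb f g \<in> Ob C" using dom_closed[of "fst (pb f g)"] by simp
qed

lemma pullback_universal:
  assumes "f \<in> Ar C" "g \<in> Ar C" "Cod C f = Cod C g" "a \<in> hom C z (Dom C f)" "b \<in> hom C z (Dom C g)"
    and "f \<cdot>\<^bsub>C\<^esub> a = g \<cdot>\<^bsub>C\<^esub> b"
  shows "\<exists>!h. h \<in> hom C z (pbob C pb f g) \<and> fst (pb f g) \<cdot>\<^bsub>C\<^esub> h = a \<and> snd (pb f g) \<cdot>\<^bsub>C\<^esub> h = b"
  using pullback[OF assms(1-3)] assms(4-) unfolding is_pullback_def Dom_fst by blast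

lemma square_comp [simp]:
  "\<lbrakk>f \<in> Ar C; g \<in> Ar C; Cod C f = Cod C g; z \<in> Ar C; Cod C z = pbob C pb f g\<rbrakk> \<Longrightarrow>
    f \<cdot>\<^bsub>C\<^esub> (fst (pb f g) \<cdot>\<^bsub>C\<^esub> z) = g \<cdot>\<^bsub>C\<^esub> (snd (pb f g) \<cdot>\<^bsub>C\<^esub> z)"
  using comp_eq_extend[of f "fst (pb f g)" "g \<cdot>\<^bsub>C\<^esub> snd (pb f g)" z] by simp

lemma pair_simps [simp]:
  assumes "f \<in> Ar C" "g \<in> Ar C" "Cod C f = Cod C g" "a \<in> Ar C" "b \<in> Ar C" "Dom C a = Dom C b"
    "Cod C a = Dom C f" "Cod C b = Dom C g" "f \<cdot>\<^bsub>C\<^esub> a = g \<cdot>\<^bsub>C\<^esub> b"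
  shows "pbpair C pb f g a b \<in> Ar C" "Dom C (pbpair C pb f g a b) = Dom C b"
    "Cod C (pbpair C pb f g a b) = pbob C pb f g"
    "fst (pb f g) \<cdot>\<^bsub>C\<^esub> pbpair C pb f g a b = a" "snd (pb f g) \<cdot>\<^bsub>C\<^esub> pbpair C pb f g a b = b"
proof -
  have "\<exists>!h. h \<in> hom C (Dom C a) (pbob C pb f g) \<and> fst (pb f g) \<cdot>\<^bsub>C\<^esub> h = a \<and> snd (pb f g) \<cdot>\<^bsub>C\<^esub> h = b"
    by (rule pullback_universal) (use assms in \<open>simp_all add: hom_iff\<close>)
  from theI'[OF this] show "pbpair C pb f g a b \<in> Ar C" "Dom C (pbpair C pb f g a b) = Dom C b"
    "Cod C (pbpair C pb f g a b) = pbob C pb f g"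
    "fst (pb f g) \<cdot>\<^bsub>C\<^esub> pbpair C pb f g a b = a" "snd (pb f g) \<cdot>\<^bsub>C\<^esub> pbpair C pb f g a b = b"
    unfolding pbpair_def using assms(6) by (auto simp: hom_iff)
qed

lemma pair_proj_comp [simp]:
  assumes "f \<in> Ar C" "g \<in> Ar C" "Cod C f = Cod C g" "a \<in> Ar C" "b \<in> Ar C" "Dom C a = Dom C b"
    "Cod C a = Dom C f" "Cod C b = Dom C g" "f \<cdot>\<^bsub>C\<^esub> a = g \<cdot>\<^bsub>C\<^esub> b" "z \<in> Ar C" "Cod C z = Dom C b"
  shows "fst (pb f g) \<cdot>\<^bsub>C\<^esub> (pbpair C pb f g a b \<cdot>\<^bsub>C\<^esub> z) = a \<cdot>\<^bsub>C\<^esub> z"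
    "snd (pb f g) \<cdot>\<^bsub>C\<^esub> (pbpair C pb f g a b \<cdot>\<^bsub>C\<^esub> z) = b \<cdot>\<^bsub>C\<^esub> z"
  using comp_eq_extend[OF pair_simps(4)[OF assms(1-9)]] comp_eq_extend[OF pair_simps(5)[OF assms(1-9)]] assms
  by simp_all

lemma pullback_inject:
  assumes "fst (pb f g) \<cdot>\<^bsub>C\<^esub> h = fst (pb f g) \<cdot>\<^bsub>C\<^esub> k" "snd (pb f g) \<cdot>\<^bsub>C\<^esub> h = snd (pb f g) \<cdot>\<^bsub>C\<^esub> k"
    and "f \<in> Ar C" "g \<in> Ar C" "Cod C f = Cod C g" "h \<in> Ar C" "k \<in> Ar C" "Dom C h = Dom C k"
    and "Cod C h = pbob C pb f g" "Cod C k = pbob C pb f g"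
  shows "h = k"
proof -
  have "\<exists>!l. l \<in> hom C (Dom C h) (pbob C pb f g) \<and> fst (pb f g) \<cdot>\<^bsub>C\<^esub> l = fst (pb f g) \<cdot>\<^bsub>C\<^esub> h
      \<and> snd (pb f g) \<cdot>\<^bsub>C\<^esub> l = snd (pb f g) \<cdot>\<^bsub>C\<^esub> h"
    by (rule pullback_universal) (use assms(3-) in \<open>simp_all add: hom_iff\<close>)
  moreover have "h \<in> hom C (Dom C h) (pbob C pb f g)" "k \<in> hom C (Dom C h) (pbob C pb f g)"
    using assms by (simp_all add: hom_iff)
  ultimately show ?thesis using assms(1,2) by metis
qed

lemma pair_comp [simp]:
  assumes "f \<in> Ar C" "g \<in> Ar C" "Cod C f = Cod C g" "a \<in> Ar C" "b \<in> Ar C" "Dom C a = Dom C b"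
    "Cod C a = Dom C f" "Cod C b = Dom C g" "f \<cdot>\<^bsub>C\<^esub> a = g \<cdot>\<^bsub>C\<^esub> b" "z \<in> Ar C" "Cod C z = Dom C b"
  shows "pbpair C pb f g a b \<cdot>\<^bsub>C\<^esub> z = pbpair C pb f g (a \<cdot>\<^bsub>C\<^esub> z) (b \<cdot>\<^bsub>C\<^esub> z)"
proof -
  have "f \<cdot>\<^bsub>C\<^esub> (a \<cdot>\<^bsub>C\<^esub> z) = g \<cdot>\<^bsub>C\<^esub> (b \<cdot>\<^bsub>C\<^esub> z)"
    using comp_eq_extend[OF assms(9)] assms by simp
  then show ?thesis by - (rule pullback_inject[of f g], use assms in simp_all)
qed

lemma pair_eta:
  "\<lbrakk>f \<in> Ar C; g \<in> Ar C; Cod C f = Cod C g; h \<in> Ar C; Cod C h = pbob C pb f g\<rbrakk> \<Longrightarrow>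
    pbpair C pb f g (fst (pb f g) \<cdot>\<^bsub>C\<^esub> h) (snd (pb f g) \<cdot>\<^bsub>C\<^esub> h) = h"
  by (rule pullback_inject[of f g]) simp_all

lemma pair_proj [simp]:
  "\<lbrakk>f \<in> Ar C; g \<in> Ar C; Cod C f = Cod C g\<rbrakk> \<Longrightarrow>
    pbpair C pb f g (fst (pb f g)) (snd (pb f g)) = Id C (pbob C pb f g)"
  by (rule pullback_inject[of f g]) simp_all

end

context category
begin

lemma slice_ob [simp]: "\<gamma> \<in> Ob (slice C x) \<longleftrightarrow> \<gamma> \<in> Ar C \<and> Cod C \<gamma> = x"
  by (simp add: slice_def)

lemma slice_ar [simp]: "(\<gamma>, f, \<gamma>') \<in> Ar (slice C x) \<longleftrightarrow> \<gamma> \<in> Ar C \<and> Cod C \<gamma> = x \<and> \<gamma>' \<in> Ar C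
    \<and> Cod C \<gamma>' = x \<and> f \<in> Ar C \<and> Dom C f = Dom C \<gamma> \<and> Cod C f = Dom C \<gamma>' \<and> \<gamma>' \<cdot>\<^bsub>C\<^esub> f = \<gamma>"
  by (auto simp: slice_def hom_iff)

lemma slice_simps [simp]:
  "Dom (slice C x) (\<gamma>, f, \<gamma>') = \<gamma>" "Cod (slice C x) (\<gamma>, f, \<gamma>') = \<gamma>'"
  "Id (slice C x) \<gamma> = (\<gamma>, Id C (Dom C \<gamma>), \<gamma>)"
  "(\<delta>, g, \<delta>') \<cdot>\<^bsub>slice C x\<^esub> (\<gamma>, f, \<gamma>') = (\<gamma>, g \<cdot>\<^bsub>C\<^esub> f, \<delta>')"
  by (simp_all add: slice_def)

lemma slice_ar_comp:
  assumes "(\<gamma>, f, \<gamma>') \<in> Ar (slice C x)" "z \<in> Ar C" "Cod C z = Dom C \<gamma>"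
  shows "\<gamma>' \<cdot>\<^bsub>C\<^esub> (f \<cdot>\<^bsub>C\<^esub> z) = \<gamma> \<cdot>\<^bsub>C\<^esub> z"
  using comp_eq_extend[of \<gamma>' f \<gamma> z] assms by simp

lemma category_slice: "category (slice C x)"
proof (rule categoryI, goal_cases)
  case (1 f) then show ?case by (cases f) simp
next
  case (2 f) then show ?case by (cases f) simp
next
  case (3 x) then show ?case by simp
next
  case (4 f g) then show ?case by (cases f; cases g) (simp flip: comp_assoc)
next
  case (5 f) then show ?case by (cases f) simp
next
  case (6 f) then show ?case by (cases f) simp
next
  case (7 f g h) then show ?case by (cases f; cases g; cases h) simp
qed

lemma postcomp_simps [simp]:
  "fsrc (postcomp C u) = slice C (Dom C u)" "ftgt (postcomp C u) = slice C (Cod C u)"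
  "\<gamma> \<in> Ar C \<Longrightarrow> Cod C \<gamma> = Dom C u \<Longrightarrow> fob (postcomp C u) \<gamma> = u \<cdot>\<^bsub>C\<^esub> \<gamma>"
  "(\<gamma>, f, \<gamma>') \<in> Ar (slice C (Dom C u)) \<Longrightarrow> far (postcomp C u) (\<gamma>, f, \<gamma>') = (u \<cdot>\<^bsub>C\<^esub> \<gamma>, f, u \<cdot>\<^bsub>C\<^esub> \<gamma>')"
  by (simp_all add: postcomp_def)

lemma postcomp_functor:
  assumes "u \<in> Ar C"
  shows "functor_between (slice C (Dom C u)) (slice C (Cod C u)) (postcomp C u)"
proof (rule functor_betweenI)
  show "fob (postcomp C u) \<in> extensional (Ob (slice C (Dom C u)))"
    "far (postcomp C u) \<in> extensional (Ar (slice C (Dom C u)))"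
    by (simp_all add: postcomp_def)
next
  fix f g assume fg: "f \<in> Ar (slice C (Dom C u))" "g \<in> Ar (slice C (Dom C u))"
    "Dom (slice C (Dom C u)) g = Cod (slice C (Dom C u)) f"
  then have n: "g \<cdot>\<^bsub>slice C (Dom C u)\<^esub> f \<in> Ar (slice C (Dom C u))"
    using category.comp_ar(1)[OF category_slice] by blast
  obtain \<gamma> k \<delta> \<gamma>' l \<delta>' where e: "f = (\<gamma>, k, \<delta>)" "g = (\<gamma>', l, \<delta>')" by (cases f; cases g)
  show "far (postcomp C u) (g \<cdot>\<^bsub>slice C (Dom C u)\<^esub> f)
      = far (postcomp C u) g \<cdot>\<^bsub>slice C (Cod C u)\<^esub> far (postcomp C u) f"
    using n fg unfolding e by simp
qed (use assms in \<open>auto simp: category_slice split_paired_all\<close>)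

lemma postcomp_comp:
  assumes "u \<in> Ar C" "v \<in> Ar C" "Dom C v = Cod C u"
  shows "postcomp C (v \<cdot>\<^bsub>C\<^esub> u) = comp_functr (postcomp C v) (postcomp C u)"
proof (rule functor_between_eqI)
  show "functor_between (slice C (Dom C u)) (slice C (Cod C v)) (postcomp C (v \<cdot>\<^bsub>C\<^esub> u))"
    using postcomp_functor[of "v \<cdot>\<^bsub>C\<^esub> u"] assms by simp
  show "functor_between (slice C (Dom C u)) (slice C (Cod C v)) (comp_functr (postcomp C v) (postcomp C u))"
    using functor_between_comp postcomp_functor assms by metis
qed (use assms in \<open>auto simp: split_paired_all\<close>)

lemma postcomp_id: "x \<in> Ob C \<Longrightarrow> postcomp C (Id C x) = id_functr (slice C x)"
  using postcomp_functor[of "Id C x"]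
  by (intro functor_between_eqI[OF _ functor_between_id[OF category_slice]]) (auto simp: split_paired_all)

end

context pullback_category
begin

text \<open>
  The right adjoint is pullback along \<open>u\<close>: the second projection of the pullback of \<open>u\<close> and \<open>\<delta>\<close> is a
  universal arrow from postcomposition with \<open>u\<close> to \<open>\<delta>\<close>.
\<close>

lemma postcomp_right_adjoint:
  assumes u: "u \<in> Ar C"
  shows "\<exists>r. right_adjoint (postcomp C u) r"
proof (rule right_adjoint_exists[OF postcomp_functor[OF u]])
  fix \<delta> assume "\<delta> \<in> Ob (slice C (Cod C u))"
  then show "fst (pb u \<delta>) \<in> Ob (slice C (Dom C u)) \<and> (u \<cdot>\<^bsub>C\<^esub> fst (pb u \<delta>), snd (pb u \<delta>), \<delta>)
      \<in> hom (slice C (Cod C u)) (fob (postcomp C u) (fst (pb u \<delta>))) \<delta>"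
    using u by (simp add: hom_iff)
next
  fix \<gamma> \<delta> h assume d: "\<delta> \<in> Ob (slice C (Cod C u))" and g: "\<gamma> \<in> Ob (slice C (Dom C u))"
    and "h \<in> hom (slice C (Cod C u)) (fob (postcomp C u) \<gamma>) \<delta>"
  then obtain k where h: "h = (u \<cdot>\<^bsub>C\<^esub> \<gamma>, k, \<delta>)" and k: "k \<in> Ar C" "Dom C k = Dom C \<gamma>" "Cod C k = Dom C \<delta>"
      "\<delta> \<cdot>\<^bsub>C\<^esub> k = u \<cdot>\<^bsub>C\<^esub> \<gamma>"
    using u by (cases h) (auto simp: hom_iff)
  let ?l = "(\<gamma>, pbpair C pb u \<delta> \<gamma> k, fst (pb u \<delta>))"
  show "\<exists>!l. l \<in> hom (slice C (Dom C u)) \<gamma> (fst (pb u \<delta>)) \<and>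
      (u \<cdot>\<^bsub>C\<^esub> fst (pb u \<delta>), snd (pb u \<delta>), \<delta>) \<cdot>\<^bsub>slice C (Cod C u)\<^esub> far (postcomp C u) l = h"
  proof (rule ex1I[of _ ?l])
    show "?l \<in> hom (slice C (Dom C u)) \<gamma> (fst (pb u \<delta>)) \<and>
      (u \<cdot>\<^bsub>C\<^esub> fst (pb u \<delta>), snd (pb u \<delta>), \<delta>) \<cdot>\<^bsub>slice C (Cod C u)\<^esub> far (postcomp C u) ?l = h"
      using u d g k by (simp add: hom_iff h)
  next
    fix l assume l: "l \<in> hom (slice C (Dom C u)) \<gamma> (fst (pb u \<delta>)) \<and>
      (u \<cdot>\<^bsub>C\<^esub> fst (pb u \<delta>), snd (pb u \<delta>), \<delta>) \<cdot>\<^bsub>slice C (Cod C u)\<^esub> far (postcomp C u) l = h"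
    obtain \<gamma>' l' \<delta>' where l': "l = (\<gamma>', l', \<delta>')" by (cases l)
    have e: "\<gamma>' = \<gamma>" "\<delta>' = fst (pb u \<delta>)"
      using l unfolding l' by (simp_all add: hom_iff)
    have "l' \<in> Ar C" "Dom C l' = Dom C \<gamma>" "Cod C l' = pbob C pb u \<delta>" "fst (pb u \<delta>) \<cdot>\<^bsub>C\<^esub> l' = \<gamma>"
      using conjunct1[OF l] u d unfolding l' e by (simp_all add: hom_iff)
    moreover from this have "snd (pb u \<delta>) \<cdot>\<^bsub>C\<^esub> l' = k"
      using conjunct2[OF l] u d g unfolding l' e h by simp
    moreover from calculation have "l' = pbpair C pb u \<delta> \<gamma> k"
      using u d g k by - (rule pullback_inject[of u \<delta>], simp_all)
    ultimately show "l = ?l" using l' e by simp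
  qed
qed

end

section \<open>The monad of an internal category\<close>

locale internal_cat = pullback_category C pb
  for C :: "('o, 'a) cat" and pb :: "'a \<Rightarrow> 'a \<Rightarrow> 'a \<times> 'a" +
  fixes D :: "('o, 'a) icat"
  assumes internal: "internal_category C pb D"
begin

abbreviation s where "s \<equiv> isrc D"
abbreviation t where "t \<equiv> itgt D"
abbreviation i where "i \<equiv> iid D"
abbreviation m where "m \<equiv> icomp D"
abbreviation D\<^sub>0 where "D\<^sub>0 \<equiv> iob D"
abbreviation D\<^sub>1 where "D\<^sub>1 \<equiv> iar D"

lemma structure_simps [simp]:
  "D\<^sub>0 \<in> Ob C" "D\<^sub>1 \<in> Ob C"
  "s \<in> Ar C" "Dom C s = D\<^sub>1" "Cod C s = D\<^sub>0" "t \<in> Ar C" "Dom C t = D\<^sub>1" "Cod C t = D\<^sub>0"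
  "i \<in> Ar C" "Dom C i = D\<^sub>0" "Cod C i = D\<^sub>1"
  "m \<in> Ar C" "Dom C m = pbob C pb s t" "Cod C m = D\<^sub>1"
  "s \<cdot>\<^bsub>C\<^esub> i = Id C D\<^sub>0" "t \<cdot>\<^bsub>C\<^esub> i = Id C D\<^sub>0"
  "s \<cdot>\<^bsub>C\<^esub> m = s \<cdot>\<^bsub>C\<^esub> snd (pb s t)" "t \<cdot>\<^bsub>C\<^esub> m = t \<cdot>\<^bsub>C\<^esub> fst (pb s t)"
  using internal by (simp_all add: internal_category_def hom_iff)

lemma structure_comp_simps [simp]:
  "z \<in> Ar C \<Longrightarrow> Cod C z = D\<^sub>0 \<Longrightarrow> s \<cdot>\<^bsub>C\<^esub> (i \<cdot>\<^bsub>C\<^esub> z) = z"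
  "z \<in> Ar C \<Longrightarrow> Cod C z = D\<^sub>0 \<Longrightarrow> t \<cdot>\<^bsub>C\<^esub> (i \<cdot>\<^bsub>C\<^esub> z) = z"
  "z \<in> Ar C \<Longrightarrow> Cod C z = pbob C pb s t \<Longrightarrow> s \<cdot>\<^bsub>C\<^esub> (m \<cdot>\<^bsub>C\<^esub> z) = s \<cdot>\<^bsub>C\<^esub> (snd (pb s t) \<cdot>\<^bsub>C\<^esub> z)"
  "z \<in> Ar C \<Longrightarrow> Cod C z = pbob C pb s t \<Longrightarrow> t \<cdot>\<^bsub>C\<^esub> (m \<cdot>\<^bsub>C\<^esub> z) = t \<cdot>\<^bsub>C\<^esub> (fst (pb s t) \<cdot>\<^bsub>C\<^esub> z)"
  by (simp_all flip: comp_assoc)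

text \<open>
  The axioms of an internal category are equations between arrows out of iterated pullbacks. They
  are used here in the equivalent form for generalised elements: for \<open>a, b : Z \<rightarrow> D\<^sub>1\<close> with
  \<open>s \<circ> a = t \<circ> b\<close> the arrow \<open>m \<circ> \<langle>a, b\<rangle>\<close> is their composite, and the axioms say that these composites
  are unital and associative. One obtains this form by precomposing an axiom with a pair.
  The unit laws mention \<open>u\<close> so that they still apply when \<open>t \<circ> f\<close> or \<open>s \<circ> f\<close> has been simplified.
\<close>

lemma comp_unit_left [simp]:
  assumes "f \<in> Ar C" "Cod C f = D\<^sub>1" "t \<cdot>\<^bsub>C\<^esub> f = u"
  shows "m \<cdot>\<^bsub>C\<^esub> pbpair C pb s t (i \<cdot>\<^bsub>C\<^esub> u) f = f"
proof -
  have "(m \<cdot>\<^bsub>C\<^esub> pbpair C pb s t (i \<cdot>\<^bsub>C\<^esub> t) (Id C D\<^sub>1)) \<cdot>\<^bsub>C\<^esub> f = m \<cdot>\<^bsub>C\<^esub> pbpair C pb s t (i \<cdot>\<^bsub>C\<^esub> u) f"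
    using assms by simp
  moreover have "m \<cdot>\<^bsub>C\<^esub> pbpair C pb s t (i \<cdot>\<^bsub>C\<^esub> t) (Id C D\<^sub>1) = Id C D\<^sub>1"
    using internal by (simp add: internal_category_def)
  ultimately show ?thesis using assms by simp
qed

lemma comp_unit_right [simp]:
  assumes "f \<in> Ar C" "Cod C f = D\<^sub>1" "s \<cdot>\<^bsub>C\<^esub> f = u"
  shows "m \<cdot>\<^bsub>C\<^esub> pbpair C pb s t f (i \<cdot>\<^bsub>C\<^esub> u) = f"
proof -
  have "(m \<cdot>\<^bsub>C\<^esub> pbpair C pb s t (Id C D\<^sub>1) (i \<cdot>\<^bsub>C\<^esub> s)) \<cdot>\<^bsub>C\<^esub> f = m \<cdot>\<^bsub>C\<^esub> pbpair C pb s t f (i \<cdot>\<^bsub>C\<^esub> u)"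
    using assms by simp
  moreover have "m \<cdot>\<^bsub>C\<^esub> pbpair C pb s t (Id C D\<^sub>1) (i \<cdot>\<^bsub>C\<^esub> s) = Id C D\<^sub>1"
    using internal by (simp add: internal_category_def)
  ultimately show ?thesis using assms by simp
qed

abbreviation T where "T \<equiv> act_tgt C pb D"

text \<open>
  \<open>T \<gamma>\<close> stays folded as an object of the slice and is unfolded as soon as it is composed with an
  arrow, where the projection \<open>\<pi>\<^sub>1\<close> can meet a pair.
\<close>

lemma act_tgt_simps [simp]:
  assumes "\<gamma> \<in> Ar C" "Cod C \<gamma> = D\<^sub>0"
  shows "T \<gamma> \<in> Ar C" "Dom C (T \<gamma>) = pbob C pb s \<gamma>" "Cod C (T \<gamma>) = D\<^sub>0"
    "z \<in> Ar C \<Longrightarrow> Cod C z = pbob C pb s \<gamma> \<Longrightarrow> T \<gamma> \<cdot>\<^bsub>C\<^esub> z = t \<cdot>\<^bsub>C\<^esub> (fst (pb s \<gamma>) \<cdot>\<^bsub>C\<^esub> z)"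
  using assms by (simp_all add: act_tgt_def)

text \<open>
  In terms of elements, the multiplication sends \<open>(a, (b, x))\<close> to \<open>(a \<circ> b, x)\<close>.
\<close>

lemma act_mult_eq:
  assumes [simp]: "\<gamma> \<in> Ar C" "Cod C \<gamma> = D\<^sub>0"
  shows "act_mult C pb D \<gamma> = pbpair C pb s \<gamma>
    (m \<cdot>\<^bsub>C\<^esub> pbpair C pb s t (fst (pb s (T \<gamma>))) (fst (pb s \<gamma>) \<cdot>\<^bsub>C\<^esub> snd (pb s (T \<gamma>))))
    (snd (pb s \<gamma>) \<cdot>\<^bsub>C\<^esub> snd (pb s (T \<gamma>)))"
proof -
  let ?p = "fst (pb (s \<cdot>\<^bsub>C\<^esub> snd (pb s t)) \<gamma>)" and ?q = "snd (pb (s \<cdot>\<^bsub>C\<^esub> snd (pb s t)) \<gamma>)"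
  have [simp]: "s \<cdot>\<^bsub>C\<^esub> (snd (pb s t) \<cdot>\<^bsub>C\<^esub> ?p) = \<gamma> \<cdot>\<^bsub>C\<^esub> ?q"
    using projections(7)[of "s \<cdot>\<^bsub>C\<^esub> snd (pb s t)" \<gamma>] by (simp del: projections(7))
  show ?thesis
    by (simp add: act_mult_def pbmap_def act_assoc_def Let_def)
qed

lemma comp_assoc_elements [simp]:
  assumes "a \<in> Ar C" "b \<in> Ar C" "c \<in> Ar C" "Cod C a = D\<^sub>1" "Cod C b = D\<^sub>1" "Cod C c = D\<^sub>1"
    and "Dom C a = Dom C c" "Dom C b = Dom C c" "s \<cdot>\<^bsub>C\<^esub> a = t \<cdot>\<^bsub>C\<^esub> b" "s \<cdot>\<^bsub>C\<^esub> b = t \<cdot>\<^bsub>C\<^esub> c"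
  shows "m \<cdot>\<^bsub>C\<^esub> pbpair C pb s t (m \<cdot>\<^bsub>C\<^esub> pbpair C pb s t a b) c
    = m \<cdot>\<^bsub>C\<^esub> pbpair C pb s t a (m \<cdot>\<^bsub>C\<^esub> pbpair C pb s t b c)"
proof -
  let ?e = "pbpair C pb s (T t) a (pbpair C pb s t b c)"
  have "m \<cdot>\<^bsub>C\<^esub> act_mult C pb D t = m \<cdot>\<^bsub>C\<^esub> pbmap C pb s (T t) s t (Id C D\<^sub>1) m"
    using internal by (simp add: internal_category_def)
  then have "(m \<cdot>\<^bsub>C\<^esub> act_mult C pb D t) \<cdot>\<^bsub>C\<^esub> ?e = (m \<cdot>\<^bsub>C\<^esub> pbmap C pb s (T t) s t (Id C D\<^sub>1) m) \<cdot>\<^bsub>C\<^esub> ?e"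
    by simp
  then show ?thesis using assms by (simp add: act_mult_eq pbmap_def)
qed

end

lemma is_monadI:
  assumes "functor_between (mcat T) (mcat T) (mfun T)"
    and "munit T \<in> extensional (Ob (mcat T))" "mmult T \<in> extensional (Ob (mcat T))"
    and "\<And>x. x \<in> Ob (mcat T) \<Longrightarrow> munit T x \<in> hom (mcat T) x (fob (mfun T) x)"
    and "\<And>x. x \<in> Ob (mcat T) \<Longrightarrow>
      mmult T x \<in> hom (mcat T) (fob (mfun T) (fob (mfun T) x)) (fob (mfun T) x)"
    and "\<And>f. f \<in> Ar (mcat T) \<Longrightarrow> munit T (Cod (mcat T) f) \<cdot>\<^bsub>mcat T\<^esub> f
      = far (mfun T) f \<cdot>\<^bsub>mcat T\<^esub> munit T (Dom (mcat T) f)"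
    and "\<And>f. f \<in> Ar (mcat T) \<Longrightarrow> mmult T (Cod (mcat T) f) \<cdot>\<^bsub>mcat T\<^esub> far (mfun T) (far (mfun T) f)
      = far (mfun T) f \<cdot>\<^bsub>mcat T\<^esub> mmult T (Dom (mcat T) f)"
    and "\<And>x. x \<in> Ob (mcat T) \<Longrightarrow>
      mmult T x \<cdot>\<^bsub>mcat T\<^esub> munit T (fob (mfun T) x) = Id (mcat T) (fob (mfun T) x)"
    and "\<And>x. x \<in> Ob (mcat T) \<Longrightarrow>
      mmult T x \<cdot>\<^bsub>mcat T\<^esub> far (mfun T) (munit T x) = Id (mcat T) (fob (mfun T) x)"
    and "\<And>x. x \<in> Ob (mcat T) \<Longrightarrow> mmult T x \<cdot>\<^bsub>mcat T\<^esub> mmult T (fob (mfun T) x)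
      = mmult T x \<cdot>\<^bsub>mcat T\<^esub> far (mfun T) (mmult T x)"
  shows "is_monad T"
proof -
  note FS = functor_between_simps(2-)[OF assms(1)]
  have "nat_trans (id_functr (mcat T)) (mfun T) (munit T)"
    by (rule nat_transI[OF functor_between_id[OF functor_between_cat(1)[OF assms(1)]] assms(1,2)])
      (use assms(4,6) in simp_all)
  moreover have "nat_trans (comp_functr (mfun T) (mfun T)) (mfun T) (mmult T)"
    by (rule nat_transI[OF functor_between_comp[OF assms(1,1)] assms(1,3)])
      (use assms(5,7) in \<open>simp_all add: FS\<close>)
  ultimately show ?thesis using assms by (simp add: is_monad_def)
qed

context internal_cat
begin

abbreviation M where "M \<equiv> T_monad C pb D"

lemma act_tgt_fold [simp]: "t \<cdot>\<^bsub>C\<^esub> fst (pb s \<gamma>) = T \<gamma>"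
  by (simp add: act_tgt_def)

lemma T_monad_cat [simp]: "fsrc (mfun M) = slice C D\<^sub>0" "ftgt (mfun M) = slice C D\<^sub>0"
  by (simp_all add: T_monad_def Let_def)

lemma T_monad_simps [simp]:
  assumes "\<gamma> \<in> Ar C" "Cod C \<gamma> = D\<^sub>0"
  shows "fob (mfun M) \<gamma> = T \<gamma>"
    "munit M \<gamma> = (\<gamma>, pbpair C pb s \<gamma> (i \<cdot>\<^bsub>C\<^esub> \<gamma>) (Id C (Dom C \<gamma>)), T \<gamma>)"
    "mmult M \<gamma> = (T (T \<gamma>), act_mult C pb D \<gamma>, T \<gamma>)"
  using assms by (simp_all add: T_monad_def Let_def)

lemma act_mult_simps [simp]:
  assumes "\<gamma> \<in> Ar C" "Cod C \<gamma> = D\<^sub>0"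
  shows "act_mult C pb D \<gamma> \<in> Ar C" "Dom C (act_mult C pb D \<gamma>) = pbob C pb s (T \<gamma>)"
    "Cod C (act_mult C pb D \<gamma>) = pbob C pb s \<gamma>" "t \<cdot>\<^bsub>C\<^esub> (fst (pb s \<gamma>) \<cdot>\<^bsub>C\<^esub> act_mult C pb D \<gamma>) = T (T \<gamma>)"
  using assms by (simp_all add: act_mult_eq)

lemma T_monad_far [simp]:
  assumes "\<gamma> \<in> Ar C" "Cod C \<gamma> = D\<^sub>0" "\<gamma>' \<in> Ar C" "Cod C \<gamma>' = D\<^sub>0" "f \<in> Ar C" "Dom C f = Dom C \<gamma>"
    "Cod C f = Dom C \<gamma>'" "\<gamma>' \<cdot>\<^bsub>C\<^esub> f = \<gamma>"
  shows "far (mfun M) (\<gamma>, f, \<gamma>') = (T \<gamma>, pbpair C pb s \<gamma>' (fst (pb s \<gamma>)) (f \<cdot>\<^bsub>C\<^esub> snd (pb s \<gamma>)), T \<gamma>')"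
  using assms by (simp add: T_monad_def Let_def pbmap_def)

lemma T_monad_functor: "functor_between (slice C D\<^sub>0) (slice C D\<^sub>0) (mfun M)"
proof (rule functor_betweenI)
  show "fob (mfun M) \<in> extensional (Ob (slice C D\<^sub>0))" "far (mfun M) \<in> extensional (Ar (slice C D\<^sub>0))"
    by (simp_all add: T_monad_def Let_def)
next
  fix f assume f: "f \<in> Ar (slice C D\<^sub>0)"
  obtain \<gamma> k \<delta> where e: "f = (\<gamma>, k, \<delta>)" by (cases f)
  have [simp]: "\<delta> \<cdot>\<^bsub>C\<^esub> (k \<cdot>\<^bsub>C\<^esub> z) = \<gamma> \<cdot>\<^bsub>C\<^esub> z" if "z \<in> Ar C" "Cod C z = Dom C \<gamma>" for z
    by (rule slice_ar_comp) (use f that in \<open>simp_all add: e\<close>)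
  show "far (mfun M) f \<in> Ar (slice C D\<^sub>0) \<and> Dom (slice C D\<^sub>0) (far (mfun M) f) = fob (mfun M) (Dom (slice C D\<^sub>0) f)
      \<and> Cod (slice C D\<^sub>0) (far (mfun M) f) = fob (mfun M) (Cod (slice C D\<^sub>0) f)"
    using f unfolding e by simp
next
  fix f g assume fg: "f \<in> Ar (slice C D\<^sub>0)" "g \<in> Ar (slice C D\<^sub>0)" "Dom (slice C D\<^sub>0) g = Cod (slice C D\<^sub>0) f"
  then have n: "g \<cdot>\<^bsub>slice C D\<^sub>0\<^esub> f \<in> Ar (slice C D\<^sub>0)"
    using category.comp_ar(1)[OF category_slice] by blast
  obtain \<gamma> k \<delta> \<gamma>' l \<delta>' where e: "f = (\<gamma>, k, \<delta>)" "g = (\<gamma>', l, \<delta>')" by (cases f; cases g)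
  have [simp]: "\<delta> \<cdot>\<^bsub>C\<^esub> (k \<cdot>\<^bsub>C\<^esub> z) = \<gamma> \<cdot>\<^bsub>C\<^esub> z" if "z \<in> Ar C" "Cod C z = Dom C \<gamma>" for z
    by (rule slice_ar_comp) (use fg that in \<open>simp_all add: e\<close>)
  have [simp]: "\<delta>' \<cdot>\<^bsub>C\<^esub> (l \<cdot>\<^bsub>C\<^esub> z) = \<delta> \<cdot>\<^bsub>C\<^esub> z" if "z \<in> Ar C" "Cod C z = Dom C \<delta>" for z
    by (rule slice_ar_comp) (use fg that in \<open>simp_all add: e\<close>)
  show "far (mfun M) (g \<cdot>\<^bsub>slice C D\<^sub>0\<^esub> f) = far (mfun M) g \<cdot>\<^bsub>slice C D\<^sub>0\<^esub> far (mfun M) f"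
    using fg n unfolding e by simp
qed (simp_all add: category_slice)

lemma act_mult_pair:
  assumes [simp]: "\<gamma> \<in> Ar C" "Cod C \<gamma> = D\<^sub>0"
    and [simp]: "a \<in> Ar C" "b \<in> Ar C" "x \<in> Ar C" "Cod C a = D\<^sub>1" "Cod C b = D\<^sub>1" "Cod C x = Dom C \<gamma>"
    "Dom C a = Dom C x" "Dom C b = Dom C x" "s \<cdot>\<^bsub>C\<^esub> a = t \<cdot>\<^bsub>C\<^esub> b" "s \<cdot>\<^bsub>C\<^esub> b = \<gamma> \<cdot>\<^bsub>C\<^esub> x"
  shows "act_mult C pb D \<gamma> \<cdot>\<^bsub>C\<^esub> pbpair C pb s (T \<gamma>) a (pbpair C pb s \<gamma> b x)
    = pbpair C pb s \<gamma> (m \<cdot>\<^bsub>C\<^esub> pbpair C pb s t a b) x"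
  by (simp add: act_mult_eq)

text \<open>
  Both composites send the generic element \<open>(a, (b, (c, x)))\<close> to a pair with second component \<open>x\<close>; the
  first components \<open>(a \<circ> b) \<circ> c\<close> and \<open>a \<circ> (b \<circ> c)\<close> agree by associativity in \<open>D\<close>.
\<close>

lemma act_mult_assoc:
  assumes [simp]: "\<gamma> \<in> Ar C" "Cod C \<gamma> = D\<^sub>0"
  shows "act_mult C pb D \<gamma> \<cdot>\<^bsub>C\<^esub> act_mult C pb D (T \<gamma>)
    = act_mult C pb D \<gamma> \<cdot>\<^bsub>C\<^esub> pbpair C pb s (T \<gamma>) (fst (pb s (T (T \<gamma>))))
        (act_mult C pb D \<gamma> \<cdot>\<^bsub>C\<^esub> snd (pb s (T (T \<gamma>))))"
proof -
  \<comment> \<open>The components of the generic element. They stay opaque, which bounds the size of the conditions under which pairs are well defined.\<close>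
  define Z where "Z = pbob C pb s (T (T \<gamma>))"
  define q where "q = snd (pb s (T (T \<gamma>)))"
  define a where "a = fst (pb s (T (T \<gamma>)))"
  define b where "b = fst (pb s (T \<gamma>)) \<cdot>\<^bsub>C\<^esub> q"
  define r where "r = snd (pb s (T \<gamma>)) \<cdot>\<^bsub>C\<^esub> q"
  define c where "c = fst (pb s \<gamma>) \<cdot>\<^bsub>C\<^esub> r"
  define x where "x = snd (pb s \<gamma>) \<cdot>\<^bsub>C\<^esub> r"
  have [simp]: "q \<in> Ar C" "Dom C q = Z" "Cod C q = pbob C pb s (T \<gamma>)" by (simp_all add: q_def Z_def)
  have [simp]: "r \<in> Ar C" "Dom C r = Z" "Cod C r = pbob C pb s \<gamma>" by (simp_all add: r_def)
  have elements [simp]: "a \<in> Ar C" "b \<in> Ar C" "c \<in> Ar C" "x \<in> Ar C" "Dom C a = Z" "Dom C b = Z"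
    "Dom C c = Z" "Dom C x = Z" "Cod C a = D\<^sub>1" "Cod C b = D\<^sub>1" "Cod C c = D\<^sub>1" "Cod C x = Dom C \<gamma>"
    by (simp_all add: a_def b_def c_def x_def Z_def)
  have matching [simp]: "s \<cdot>\<^bsub>C\<^esub> a = t \<cdot>\<^bsub>C\<^esub> b" "s \<cdot>\<^bsub>C\<^esub> b = t \<cdot>\<^bsub>C\<^esub> c" "s \<cdot>\<^bsub>C\<^esub> c = \<gamma> \<cdot>\<^bsub>C\<^esub> x"
  proof -
    have "s \<cdot>\<^bsub>C\<^esub> a = T (T \<gamma>) \<cdot>\<^bsub>C\<^esub> q" by (simp add: a_def q_def del: act_tgt_simps(4))
    then show "s \<cdot>\<^bsub>C\<^esub> a = t \<cdot>\<^bsub>C\<^esub> b" by (simp add: b_def)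
    have "s \<cdot>\<^bsub>C\<^esub> b = T \<gamma> \<cdot>\<^bsub>C\<^esub> r" by (simp add: b_def r_def del: act_tgt_simps(4))
    then show "s \<cdot>\<^bsub>C\<^esub> b = t \<cdot>\<^bsub>C\<^esub> c" by (simp add: c_def)
    show "s \<cdot>\<^bsub>C\<^esub> c = \<gamma> \<cdot>\<^bsub>C\<^esub> x" by (simp add: c_def x_def)
  qed
  have r: "r = pbpair C pb s \<gamma> c x" by (simp add: c_def x_def pair_eta)
  have q: "q = pbpair C pb s (T \<gamma>) b (pbpair C pb s \<gamma> c x)"
    unfolding r[symmetric] by (simp add: b_def r_def pair_eta)
  have "act_mult C pb D (T \<gamma>) = pbpair C pb s (T \<gamma>) (m \<cdot>\<^bsub>C\<^esub> pbpair C pb s t a b) (pbpair C pb s \<gamma> c x)"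
    unfolding r[symmetric] by (subst act_mult_eq) (simp_all add: a_def b_def q_def r_def)
  then have "act_mult C pb D \<gamma> \<cdot>\<^bsub>C\<^esub> act_mult C pb D (T \<gamma>)
      = pbpair C pb s \<gamma> (m \<cdot>\<^bsub>C\<^esub> pbpair C pb s t (m \<cdot>\<^bsub>C\<^esub> pbpair C pb s t a b) c) x"
    by (simp add: act_mult_pair del: comp_assoc_elements)
  also have "\<dots> = pbpair C pb s \<gamma> (m \<cdot>\<^bsub>C\<^esub> pbpair C pb s t a (m \<cdot>\<^bsub>C\<^esub> pbpair C pb s t b c)) x"
    by simp
  also have "\<dots> = act_mult C pb D \<gamma> \<cdot>\<^bsub>C\<^esub> pbpair C pb s (T \<gamma>) a
      (pbpair C pb s \<gamma> (m \<cdot>\<^bsub>C\<^esub> pbpair C pb s t b c) x)"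
    by (simp add: act_mult_pair)
  also have "pbpair C pb s \<gamma> (m \<cdot>\<^bsub>C\<^esub> pbpair C pb s t b c) x = act_mult C pb D \<gamma> \<cdot>\<^bsub>C\<^esub> q"
    unfolding q by (simp add: act_mult_pair)
  finally show ?thesis unfolding a_def q_def .
qed

lemma T_monad_monad: "is_monad M"
proof (rule is_monadI, goal_cases)
  case 1 show ?case by (simp add: T_monad_functor)
next
  case 2 show ?case by (simp add: T_monad_def Let_def)
next
  case 3 show ?case by (simp add: T_monad_def Let_def)
next
  case (6 f)
  obtain \<gamma> k \<delta> where e: "f = (\<gamma>, k, \<delta>)" by (cases f)
  have [simp]: "\<delta> \<cdot>\<^bsub>C\<^esub> (k \<cdot>\<^bsub>C\<^esub> z) = \<gamma> \<cdot>\<^bsub>C\<^esub> z" if "z \<in> Ar C" "Cod C z = Dom C \<gamma>" for z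
    by (rule slice_ar_comp) (use 6 that in \<open>simp_all add: e\<close>)
  show ?case using 6 unfolding e by simp
next
  case (7 f)
  obtain \<gamma> k \<delta> where e: "f = (\<gamma>, k, \<delta>)" by (cases f)
  have [simp]: "\<delta> \<cdot>\<^bsub>C\<^esub> (k \<cdot>\<^bsub>C\<^esub> z) = \<gamma> \<cdot>\<^bsub>C\<^esub> z" if "z \<in> Ar C" "Cod C z = Dom C \<gamma>" for z
    by (rule slice_ar_comp) (use 7 that in \<open>simp_all add: e\<close>)
  show ?case using 7 unfolding e by (simp add: act_mult_eq)
next
  case (8 x) then show ?case by (simp add: act_mult_eq)
next
  case (9 x) then show ?case by (simp add: act_mult_eq)
next
  case (10 x) then show ?case using act_mult_assoc[of x] by simp
qed (simp_all add: hom_iff)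

section \<open>Actions as algebras\<close>

lemma ACT_simps [simp]:
  "X \<in> Ob (ACT C pb D) \<longleftrightarrow> is_action C pb D X"
  "Dom (ACT C pb D) (X, f, Z) = X" "Cod (ACT C pb D) (X, f, Z) = Z"
  "Id (ACT C pb D) X = (X, Id C (fst X), X)"
  "(X', g, Z') \<cdot>\<^bsub>ACT C pb D\<^esub> (X, f, Z) = (X, g \<cdot>\<^bsub>C\<^esub> f, Z')"
  by (simp_all add: ACT_def)

lemma is_action_iff:
  "is_action C pb D (X, \<gamma>, \<xi>) \<longleftrightarrow> \<gamma> \<in> Ar C \<and> Dom C \<gamma> = X \<and> Cod C \<gamma> = D\<^sub>0
    \<and> \<xi> \<in> Ar C \<and> Dom C \<xi> = pbob C pb s \<gamma> \<and> Cod C \<xi> = X \<and> \<gamma> \<cdot>\<^bsub>C\<^esub> \<xi> = T \<gamma>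
    \<and> \<xi> \<cdot>\<^bsub>C\<^esub> pbpair C pb s \<gamma> (i \<cdot>\<^bsub>C\<^esub> \<gamma>) (Id C X) = Id C X
    \<and> \<xi> \<cdot>\<^bsub>C\<^esub> act_mult C pb D \<gamma>
      = \<xi> \<cdot>\<^bsub>C\<^esub> pbpair C pb s \<gamma> (fst (pb s (T \<gamma>))) (\<xi> \<cdot>\<^bsub>C\<^esub> snd (pb s (T \<gamma>)))"
proof (cases "\<gamma> \<in> Ar C \<and> Cod C \<gamma> = D\<^sub>0")
  case True
  then show ?thesis by (auto simp: is_action_def hom_iff pbmap_def)
qed (auto simp: is_action_def hom_iff)

lemma ACT_ar_iff:
  "((X, \<gamma>, \<xi>), f, (X', \<gamma>', \<xi>')) \<in> Ar (ACT C pb D) \<longleftrightarrow>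
    is_action C pb D (X, \<gamma>, \<xi>) \<and> is_action C pb D (X', \<gamma>', \<xi>')
    \<and> f \<in> Ar C \<and> Dom C f = X \<and> Cod C f = X' \<and> \<gamma>' \<cdot>\<^bsub>C\<^esub> f = \<gamma>
    \<and> f \<cdot>\<^bsub>C\<^esub> \<xi> = \<xi>' \<cdot>\<^bsub>C\<^esub> pbpair C pb s \<gamma>' (fst (pb s \<gamma>)) (f \<cdot>\<^bsub>C\<^esub> snd (pb s \<gamma>))"
proof (cases "is_action C pb D (X, \<gamma>, \<xi>)")
  case True
  then have "\<gamma> \<in> Ar C" "Cod C \<gamma> = D\<^sub>0" by (simp_all add: is_action_iff)
  then have "Id C D\<^sub>1 \<cdot>\<^bsub>C\<^esub> fst (pb s \<gamma>) = fst (pb s \<gamma>)" by simp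
  then show ?thesis by (auto simp: ACT_def hom_iff pbmap_def)
qed (auto simp: ACT_def)

lemma category_ACT: "category (ACT C pb D)"
proof (rule categoryI, goal_cases)
  case (1 f) then show ?case by (auto simp: ACT_def)
next
  case (2 f) then show ?case by (auto simp: ACT_def)
next
  case (3 x)
  then show ?case by (cases x) (simp add: ACT_ar_iff, simp add: is_action_iff)
next
  case (4 f g)
  obtain X \<gamma> \<xi> f' X' \<gamma>' \<xi>' where f: "f = ((X, \<gamma>, \<xi>), f', (X', \<gamma>', \<xi>'))" by (cases f) auto
  obtain X'' \<gamma>'' \<xi>'' g' where g: "g = ((X', \<gamma>', \<xi>'), g', (X'', \<gamma>'', \<xi>''))"
    using 4(3) unfolding f by (cases g) auto
  note fa = 4(1)[unfolded f ACT_ar_iff] and ga = 4(2)[unfolded g ACT_ar_iff]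
  have act [simp]: "\<gamma> \<in> Ar C" "Dom C \<gamma> = X" "Cod C \<gamma> = D\<^sub>0" "\<xi> \<in> Ar C" "Dom C \<xi> = pbob C pb s \<gamma>" "Cod C \<xi> = X"
    "\<gamma>' \<in> Ar C" "Dom C \<gamma>' = X'" "Cod C \<gamma>' = D\<^sub>0" "\<xi>' \<in> Ar C" "Dom C \<xi>' = pbob C pb s \<gamma>'" "Cod C \<xi>' = X'"
    "\<gamma>'' \<in> Ar C" "Dom C \<gamma>'' = X''" "Cod C \<gamma>'' = D\<^sub>0" "\<xi>'' \<in> Ar C" "Dom C \<xi>'' = pbob C pb s \<gamma>''" "Cod C \<xi>'' = X''"
    using fa ga by (simp_all add: is_action_iff)
  have ar [simp]: "f' \<in> Ar C" "Dom C f' = X" "Cod C f' = X'" "\<gamma>' \<cdot>\<^bsub>C\<^esub> f' = \<gamma>"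
    "g' \<in> Ar C" "Dom C g' = X'" "Cod C g' = X''" "\<gamma>'' \<cdot>\<^bsub>C\<^esub> g' = \<gamma>'"
    using fa ga by simp_all
  have [simp]: "\<gamma>' \<cdot>\<^bsub>C\<^esub> (f' \<cdot>\<^bsub>C\<^esub> z) = \<gamma> \<cdot>\<^bsub>C\<^esub> z" if "z \<in> Ar C" "Cod C z = X" for z
    using comp_eq_extend[of \<gamma>' f' \<gamma> z] that by simp
  have [simp]: "\<gamma>'' \<cdot>\<^bsub>C\<^esub> (g' \<cdot>\<^bsub>C\<^esub> z) = \<gamma>' \<cdot>\<^bsub>C\<^esub> z" if "z \<in> Ar C" "Cod C z = X'" for z
    using comp_eq_extend[of \<gamma>'' g' \<gamma>' z] that by simp
  have fe: "f' \<cdot>\<^bsub>C\<^esub> \<xi> = \<xi>' \<cdot>\<^bsub>C\<^esub> pbpair C pb s \<gamma>' (fst (pb s \<gamma>)) (f' \<cdot>\<^bsub>C\<^esub> snd (pb s \<gamma>))"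
    and ge: "g' \<cdot>\<^bsub>C\<^esub> \<xi>' = \<xi>'' \<cdot>\<^bsub>C\<^esub> pbpair C pb s \<gamma>'' (fst (pb s \<gamma>')) (g' \<cdot>\<^bsub>C\<^esub> snd (pb s \<gamma>'))"
    using fa ga by simp_all
  have "g' \<cdot>\<^bsub>C\<^esub> (f' \<cdot>\<^bsub>C\<^esub> \<xi>)
      = (g' \<cdot>\<^bsub>C\<^esub> \<xi>') \<cdot>\<^bsub>C\<^esub> pbpair C pb s \<gamma>' (fst (pb s \<gamma>)) (f' \<cdot>\<^bsub>C\<^esub> snd (pb s \<gamma>))"
    by (simp add: fe)
  also have "\<dots> = \<xi>'' \<cdot>\<^bsub>C\<^esub> pbpair C pb s \<gamma>'' (fst (pb s \<gamma>)) (g' \<cdot>\<^bsub>C\<^esub> (f' \<cdot>\<^bsub>C\<^esub> snd (pb s \<gamma>)))"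
    unfolding ge by simp
  finally show ?case using fa ga unfolding f g by (simp add: ACT_ar_iff)
next
  case (5 f)
  then show ?case by (cases f) (auto simp: ACT_ar_iff)
next
  case (6 f)
  then show ?case by (cases f) (auto simp: ACT_ar_iff)
next
  case (7 f g h)
  then show ?case by (cases f; cases g; cases h) (auto simp: ACT_ar_iff)
qed

text \<open>
  The structure map of an algebra is a triple whose outer components are forced by its domain and
  codomain in the slice. Once these are split off, the laws of an algebra and of an action coincide.
\<close>

lemma algebra_iff_action:
  "is_algebra M (\<gamma>, a, \<xi>, b) \<longleftrightarrow> a = T \<gamma> \<and> b = \<gamma> \<and> is_action C pb D (Dom C \<gamma>, \<gamma>, \<xi>)"
proof -
  interpret M: eilenberg_moore M by unfold_locales (rule T_monad_monad)
  show ?thesis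
  proof (cases "\<gamma> \<in> Ar C \<and> Cod C \<gamma> = D\<^sub>0 \<and> a = T \<gamma> \<and> b = \<gamma> \<and> \<xi> \<in> Ar C \<and> Dom C \<xi> = pbob C pb s \<gamma>
      \<and> Cod C \<xi> = Dom C \<gamma> \<and> \<gamma> \<cdot>\<^bsub>C\<^esub> \<xi> = T \<gamma>")
    case True
    then show ?thesis by (auto simp: M.is_algebra_iff is_action_iff)
  next
    case False
    then show ?thesis by (auto simp: M.is_algebra_iff is_action_iff)
  qed
qed

end

text \<open>
  A functor that is bijective on objects and on arrows is an isomorphism, since the inverse maps
  are automatically functorial.
\<close>

lemma cat_isomorphismI:
  assumes F: "functor_between A B F" and ob: "bij_betw (fob F) (Ob A) (Ob B)"
    and ar: "bij_betw (far F) (Ar A) (Ar B)"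
  shows "cat_isomorphism A B F"
proof -
  note FS [simp] = functor_between_simps[OF F]
  interpret A: category A by (rule functor_between_cat[OF F])
  interpret B: category B by (rule functor_between_cat[OF F])
  let ?g = "the_inv_into (Ob A) (fob F)" and ?h = "the_inv_into (Ar A) (far F)"
  note ob_inv = the_inv_into_f_f[OF bij_betw_imp_inj_on[OF ob]] f_the_inv_into_f_bij_betw[OF ob]
  note ar_inv = the_inv_into_f_f[OF bij_betw_imp_inj_on[OF ar]] f_the_inv_into_f_bij_betw[OF ar]
  have g [simp]: "?g y \<in> Ob A" if "y \<in> Ob B" for y
    using bij_betw_the_inv_into[OF ob] that by (auto simp: bij_betw_def)
  have h [simp]: "?h y \<in> Ar A" if "y \<in> Ar B" for y
    using bij_betw_the_inv_into[OF ar] that by (auto simp: bij_betw_def)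
  have dom: "Dom A (?h f) = ?g (Dom B f)" "Cod A (?h f) = ?g (Cod B f)" if f: "f \<in> Ar B" for f
    using ob_inv(1)[of "Dom A (?h f)"] ob_inv(1)[of "Cod A (?h f)"] f ar_inv(2)[of f]
      FS(5)[of "?h f"] FS(6)[of "?h f"] by simp_all
  let ?G = "\<lparr>fsrc = B, ftgt = A, fob = restrict ?g (Ob B), far = restrict ?h (Ar B)\<rparr>"
  have G: "functor_between B A ?G"
  proof (rule functor_betweenI)
    fix y assume y: "y \<in> Ob B"
    have "?h (far F (Id A (?g y))) = Id A (?g y)" by (rule ar_inv(1)) (use y in simp)
    then show "far ?G (Id B y) = Id A (fob ?G y)" using y by (simp add: ob_inv)
  next
    fix f k assume fk: "f \<in> Ar B" "k \<in> Ar B" "Dom B k = Cod B f"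
    have "?h (far F (?h k \<cdot>\<^bsub>A\<^esub> ?h f)) = ?h k \<cdot>\<^bsub>A\<^esub> ?h f"
      by (rule ar_inv(1)) (use fk in \<open>simp add: dom\<close>)
    then show "far ?G (k \<cdot>\<^bsub>B\<^esub> f) = far ?G k \<cdot>\<^bsub>A\<^esub> far ?G f" using fk by (simp add: dom ar_inv)
  qed (simp_all add: A.category_axioms B.category_axioms dom)
  have "comp_functr ?G F = id_functr A"
    by (rule functor_between_eqI[OF functor_between_comp[OF F G] functor_between_id[OF A.category_axioms]])
      (simp_all add: ob_inv ar_inv)
  moreover have "comp_functr F ?G = id_functr B"
    by (rule functor_between_eqI[OF functor_between_comp[OF G F] functor_between_id[OF B.category_axioms]])
      (simp_all add: ob_inv ar_inv)
  ultimately show ?thesis using F G by (auto simp: cat_isomorphism_def)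
qed

context internal_cat
begin

lemma ALG_T_monad_ar_iff:
  "((\<gamma>, a, \<xi>, b), (g, f, g'), (\<gamma>', a', \<xi>', b')) \<in> Ar (ALG M) \<longleftrightarrow>
    a = T \<gamma> \<and> b = \<gamma> \<and> g = \<gamma> \<and> a' = T \<gamma>' \<and> b' = \<gamma>' \<and> g' = \<gamma>'
    \<and> ((Dom C \<gamma>, \<gamma>, \<xi>), f, (Dom C \<gamma>', \<gamma>', \<xi>')) \<in> Ar (ACT C pb D)"
proof -
  interpret M: eilenberg_moore M by unfold_locales (rule T_monad_monad)
  show ?thesis
  proof (cases "a = T \<gamma> \<and> b = \<gamma> \<and> g = \<gamma> \<and> a' = T \<gamma>' \<and> b' = \<gamma>' \<and> g' = \<gamma>'
      \<and> is_action C pb D (Dom C \<gamma>, \<gamma>, \<xi>) \<and> is_action C pb D (Dom C \<gamma>', \<gamma>', \<xi>')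
      \<and> f \<in> Ar C \<and> Dom C f = Dom C \<gamma> \<and> Cod C f = Dom C \<gamma>' \<and> \<gamma>' \<cdot>\<^bsub>C\<^esub> f = \<gamma>")
    case True
    then have [simp]: "\<gamma> \<in> Ar C" "Cod C \<gamma> = D\<^sub>0" "\<gamma>' \<in> Ar C" "Cod C \<gamma>' = D\<^sub>0" "f \<in> Ar C" "Dom C f = Dom C \<gamma>"
      "Cod C f = Dom C \<gamma>'" "\<gamma>' \<cdot>\<^bsub>C\<^esub> f = \<gamma>"
      by (simp_all add: is_action_iff)
    show ?thesis using True
      by (simp add: M.ALG_ar_iff ACT_ar_iff algebra_iff_action)
  next
    case False
    then show ?thesis
      by (auto simp: M.ALG_ar_iff ACT_ar_iff algebra_iff_action)
  qed
qed

lemma alg_to_act_simps [simp]: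
  "is_algebra M (\<gamma>, a, \<xi>, b) \<Longrightarrow> fob (alg_to_act C pb D) (\<gamma>, a, \<xi>, b) = (Dom C \<gamma>, \<gamma>, \<xi>)"
  "((\<gamma>, a, \<xi>, b), (g, f, g'), (\<gamma>', a', \<xi>', b')) \<in> Ar (ALG M) \<Longrightarrow>
    far (alg_to_act C pb D) ((\<gamma>, a, \<xi>, b), (g, f, g'), (\<gamma>', a', \<xi>', b'))
    = ((Dom C \<gamma>, \<gamma>, \<xi>), f, (Dom C \<gamma>', \<gamma>', \<xi>'))"
  by (simp_all add: alg_to_act_def Let_def ALG_def)

lemma ALG_arE:
  assumes "h \<in> Ar (ALG M)"
  obtains \<gamma> \<xi> f \<gamma>' \<xi>' where "h = ((\<gamma>, T \<gamma>, \<xi>, \<gamma>), (\<gamma>, f, \<gamma>'), (\<gamma>', T \<gamma>', \<xi>', \<gamma>'))"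
    "((\<gamma>, T \<gamma>, \<xi>, \<gamma>), (\<gamma>, f, \<gamma>'), (\<gamma>', T \<gamma>', \<xi>', \<gamma>')) \<in> Ar (ALG M)"
    "((Dom C \<gamma>, \<gamma>, \<xi>), f, (Dom C \<gamma>', \<gamma>', \<xi>')) \<in> Ar (ACT C pb D)"
proof -
  obtain \<gamma> a \<xi> b g f g' \<gamma>' a' \<xi>' b' where h: "h = ((\<gamma>, a, \<xi>, b), (g, f, g'), (\<gamma>', a', \<xi>', b'))"
    by (metis prod.exhaust)
  have e: "a = T \<gamma>" "b = \<gamma>" "g = \<gamma>" "a' = T \<gamma>'" "b' = \<gamma>'" "g' = \<gamma>'"
    "((Dom C \<gamma>, \<gamma>, \<xi>), f, (Dom C \<gamma>', \<gamma>', \<xi>')) \<in> Ar (ACT C pb D)"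
    using assms unfolding h ALG_T_monad_ar_iff by simp_all
  show ?thesis by (rule that) (use assms e in \<open>simp_all add: h\<close>)
qed

lemma alg_to_act_functor: "functor_between (ALG M) (ACT C pb D) (alg_to_act C pb D)"
proof (rule functor_betweenI)
  interpret M: eilenberg_moore M by unfold_locales (rule T_monad_monad)
  show "category (ALG M)" by (rule M.category_ALG)
  show "category (ACT C pb D)" by (rule category_ACT)
  show "fsrc (alg_to_act C pb D) = ALG M" "ftgt (alg_to_act C pb D) = ACT C pb D"
    "fob (alg_to_act C pb D) \<in> extensional (Ob (ALG M))" "far (alg_to_act C pb D) \<in> extensional (Ar (ALG M))"
    by (simp_all add: alg_to_act_def Let_def)
  fix X assume X: "X \<in> Ob (ALG M)"
  obtain \<gamma> a \<xi> b where e: "X = (\<gamma>, a, \<xi>, b)" by (metis prod.exhaust)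
  show "fob (alg_to_act C pb D) X \<in> Ob (ACT C pb D)"
    using X unfolding e by (simp add: algebra_iff_action)
  have "Id (ALG M) X \<in> Ar (ALG M)" using category.id_ar(1)[OF M.category_ALG X] .
  then show "far (alg_to_act C pb D) (Id (ALG M) X) = Id (ACT C pb D) (fob (alg_to_act C pb D) X)"
    using X unfolding e by simp
next
  interpret M: eilenberg_moore M by unfold_locales (rule T_monad_monad)
  fix h assume "h \<in> Ar (ALG M)"
  then show "far (alg_to_act C pb D) h \<in> Ar (ACT C pb D)
      \<and> Dom (ACT C pb D) (far (alg_to_act C pb D) h) = fob (alg_to_act C pb D) (Dom (ALG M) h)
      \<and> Cod (ACT C pb D) (far (alg_to_act C pb D) h) = fob (alg_to_act C pb D) (Cod (ALG M) h)"
    by (rule ALG_arE) (simp add: M.ALG_ar_iff)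
next
  interpret M: eilenberg_moore M by unfold_locales (rule T_monad_monad)
  fix h k assume hk: "h \<in> Ar (ALG M)" "k \<in> Ar (ALG M)" "Dom (ALG M) k = Cod (ALG M) h"
  then have n: "k \<cdot>\<^bsub>ALG M\<^esub> h \<in> Ar (ALG M)" using category.comp_ar(1)[OF M.category_ALG] by blast
  from hk(1) obtain \<gamma> \<xi> f \<gamma>' \<xi>' where h: "h = ((\<gamma>, T \<gamma>, \<xi>, \<gamma>), (\<gamma>, f, \<gamma>'), (\<gamma>', T \<gamma>', \<xi>', \<gamma>'))"
    by (rule ALG_arE)
  from hk(2) obtain \<delta> \<zeta> g \<gamma>'' \<xi>'' where k: "k = ((\<delta>, T \<delta>, \<zeta>, \<delta>), (\<delta>, g, \<gamma>''), (\<gamma>'', T \<gamma>'', \<xi>'', \<gamma>''))"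
    by (rule ALG_arE)
  show "far (alg_to_act C pb D) (k \<cdot>\<^bsub>ALG M\<^esub> h)
      = far (alg_to_act C pb D) k \<cdot>\<^bsub>ACT C pb D\<^esub> far (alg_to_act C pb D) h"
    using n hk unfolding h k by simp
qed

lemma alg_to_act_isomorphism: "cat_isomorphism (ALG M) (ACT C pb D) (alg_to_act C pb D)"
proof (rule cat_isomorphismI[OF alg_to_act_functor])
  interpret M: eilenberg_moore M by unfold_locales (rule T_monad_monad)
  show "bij_betw (fob (alg_to_act C pb D)) (Ob (ALG M)) (Ob (ACT C pb D))"
  proof (rule bij_betw_byWitness[where f' = "\<lambda>(X, \<gamma>, \<xi>). (\<gamma>, T \<gamma>, \<xi>, \<gamma>)"])
    show "\<forall>X\<in>Ob (ALG M). (\<lambda>(X, \<gamma>, \<xi>). (\<gamma>, T \<gamma>, \<xi>, \<gamma>)) (fob (alg_to_act C pb D) X) = X"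
      by (auto simp: algebra_iff_action)
    show "\<forall>X\<in>Ob (ACT C pb D). fob (alg_to_act C pb D) ((\<lambda>(X, \<gamma>, \<xi>). (\<gamma>, T \<gamma>, \<xi>, \<gamma>)) X) = X"
      "(\<lambda>(X, \<gamma>, \<xi>). (\<gamma>, T \<gamma>, \<xi>, \<gamma>)) ` Ob (ACT C pb D) \<subseteq> Ob (ALG M)"
      by (auto simp: algebra_iff_action is_action_iff)
    show "fob (alg_to_act C pb D) ` Ob (ALG M) \<subseteq> Ob (ACT C pb D)"
      by (auto simp: functor_between_simps(3)[OF alg_to_act_functor] simp del: M.ALG_simps ACT_simps)
  qed
  let ?w = "\<lambda>((X, \<gamma>, \<xi>), f, (X', \<gamma>', \<xi>')). ((\<gamma>, T \<gamma>, \<xi>, \<gamma>), (\<gamma>, f, \<gamma>'), (\<gamma>', T \<gamma>', \<xi>', \<gamma>'))"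
  have act: "?w h \<in> Ar (ALG M) \<and> far (alg_to_act C pb D) (?w h) = h" if "h \<in> Ar (ACT C pb D)" for h
  proof -
    obtain X \<gamma> \<xi> f X' \<gamma>' \<xi>' where h: "h = ((X, \<gamma>, \<xi>), f, (X', \<gamma>', \<xi>'))" by (cases h) auto
    have e: "X = Dom C \<gamma>" "X' = Dom C \<gamma>'" using that unfolding h by (simp_all add: ACT_ar_iff is_action_iff)
    have "((\<gamma>, T \<gamma>, \<xi>, \<gamma>), (\<gamma>, f, \<gamma>'), (\<gamma>', T \<gamma>', \<xi>', \<gamma>')) \<in> Ar (ALG M)"
      using that unfolding h e by (simp add: ALG_T_monad_ar_iff)
    then show ?thesis unfolding h e by simp
  qed
  show "bij_betw (far (alg_to_act C pb D)) (Ar (ALG M)) (Ar (ACT C pb D))"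
  proof (rule bij_betw_byWitness[where f' = ?w])
    show "\<forall>h\<in>Ar (ALG M). ?w (far (alg_to_act C pb D) h) = h"
    proof
      fix h assume "h \<in> Ar (ALG M)"
      then show "?w (far (alg_to_act C pb D) h) = h" by (rule ALG_arE) simp
    qed
    show "\<forall>h\<in>Ar (ACT C pb D). far (alg_to_act C pb D) (?w h) = h" "?w ` Ar (ACT C pb D) \<subseteq> Ar (ALG M)"
      using act by blast+
    show "far (alg_to_act C pb D) ` Ar (ALG M) \<subseteq> Ar (ACT C pb D)"
      using functor_between_simps(4)[OF alg_to_act_functor] by blast
  qed
qed

end

section \<open>Internal functors as comorphisms\<close>

locale internal_fun = pullback_category C pb
  for C :: "('o, 'a) cat" and pb :: "'a \<Rightarrow> 'a \<Rightarrow> 'a \<times> 'a" +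
  fixes F :: "('o, 'a) ifun"
  assumes internal_fun: "internal_functor C pb F"
begin

sublocale D: internal_cat C pb "ifsrc F"
  using internal_fun by unfold_locales (simp add: internal_functor_def Let_def)
sublocale E: internal_cat C pb "iftgt F"
  using internal_fun by unfold_locales (simp add: internal_functor_def Let_def)

abbreviation F\<^sub>0 where "F\<^sub>0 \<equiv> ifob F"
abbreviation F\<^sub>1 where "F\<^sub>1 \<equiv> ifar F"

lemma fun_simps [simp]:
  "F\<^sub>0 \<in> Ar C" "Dom C F\<^sub>0 = D.D\<^sub>0" "Cod C F\<^sub>0 = E.D\<^sub>0" "F\<^sub>1 \<in> Ar C" "Dom C F\<^sub>1 = D.D\<^sub>1" "Cod C F\<^sub>1 = E.D\<^sub>1"
  "E.s \<cdot>\<^bsub>C\<^esub> F\<^sub>1 = F\<^sub>0 \<cdot>\<^bsub>C\<^esub> D.s" "E.t \<cdot>\<^bsub>C\<^esub> F\<^sub>1 = F\<^sub>0 \<cdot>\<^bsub>C\<^esub> D.t" "F\<^sub>1 \<cdot>\<^bsub>C\<^esub> D.i = E.i \<cdot>\<^bsub>C\<^esub> F\<^sub>0"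
  using internal_fun by (simp_all add: internal_functor_def Let_def hom_iff)

lemma fun_comp_simps [simp]:
  "z \<in> Ar C \<Longrightarrow> Cod C z = D.D\<^sub>1 \<Longrightarrow> E.s \<cdot>\<^bsub>C\<^esub> (F\<^sub>1 \<cdot>\<^bsub>C\<^esub> z) = F\<^sub>0 \<cdot>\<^bsub>C\<^esub> (D.s \<cdot>\<^bsub>C\<^esub> z)"
  "z \<in> Ar C \<Longrightarrow> Cod C z = D.D\<^sub>1 \<Longrightarrow> E.t \<cdot>\<^bsub>C\<^esub> (F\<^sub>1 \<cdot>\<^bsub>C\<^esub> z) = F\<^sub>0 \<cdot>\<^bsub>C\<^esub> (D.t \<cdot>\<^bsub>C\<^esub> z)"
  "z \<in> Ar C \<Longrightarrow> Cod C z = D.D\<^sub>0 \<Longrightarrow> F\<^sub>1 \<cdot>\<^bsub>C\<^esub> (D.i \<cdot>\<^bsub>C\<^esub> z) = E.i \<cdot>\<^bsub>C\<^esub> (F\<^sub>0 \<cdot>\<^bsub>C\<^esub> z)"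
  by (simp_all flip: comp_assoc)

text \<open>
  Precomposing the axiom with \<open>\<langle>a, b\<rangle>\<close> eliminates the arrow \<open>F\<^sub>1 \<times> F\<^sub>1\<close> between pullbacks.
\<close>

lemma fun_comp_pair [simp]:
  assumes "a \<in> Ar C" "b \<in> Ar C" "Cod C a = D.D\<^sub>1" "Cod C b = D.D\<^sub>1" "Dom C a = Dom C b"
    and "D.s \<cdot>\<^bsub>C\<^esub> a = D.t \<cdot>\<^bsub>C\<^esub> b"
  shows "F\<^sub>1 \<cdot>\<^bsub>C\<^esub> (D.m \<cdot>\<^bsub>C\<^esub> pbpair C pb D.s D.t a b)
    = E.m \<cdot>\<^bsub>C\<^esub> pbpair C pb E.s E.t (F\<^sub>1 \<cdot>\<^bsub>C\<^esub> a) (F\<^sub>1 \<cdot>\<^bsub>C\<^esub> b)"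
proof -
  have "F\<^sub>1 \<cdot>\<^bsub>C\<^esub> D.m = E.m \<cdot>\<^bsub>C\<^esub> pbmap C pb D.s D.t E.s E.t F\<^sub>1 F\<^sub>1"
    using internal_fun by (simp add: internal_functor_def Let_def)
  then have "(F\<^sub>1 \<cdot>\<^bsub>C\<^esub> D.m) \<cdot>\<^bsub>C\<^esub> pbpair C pb D.s D.t a b
      = (E.m \<cdot>\<^bsub>C\<^esub> pbmap C pb D.s D.t E.s E.t F\<^sub>1 F\<^sub>1) \<cdot>\<^bsub>C\<^esub> pbpair C pb D.s D.t a b"
    by simp
  then show ?thesis using assms by (simp add: pbmap_def del: D.act_tgt_fold)
qed

lemma T_comorphism_simps [simp]:
  "csrc (T_comorphism C pb F) = D.M" "ctgt (T_comorphism C pb F) = E.M"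
  "cfun (T_comorphism C pb F) = postcomp C F\<^sub>0"
  by (simp_all add: T_comorphism_def Let_def)

lemma T_comorphism_cnat [simp]:
  assumes "\<gamma> \<in> Ar C" "Cod C \<gamma> = D.D\<^sub>0"
  shows "cnat (T_comorphism C pb F) \<gamma> = (F\<^sub>0 \<cdot>\<^bsub>C\<^esub> D.T \<gamma>,
    pbpair C pb E.s (F\<^sub>0 \<cdot>\<^bsub>C\<^esub> \<gamma>) (F\<^sub>1 \<cdot>\<^bsub>C\<^esub> fst (pb D.s \<gamma>)) (snd (pb D.s \<gamma>)), E.T (F\<^sub>0 \<cdot>\<^bsub>C\<^esub> \<gamma>))"
  using assms by (simp add: T_comorphism_def Let_def pbmap_def)

lemma T_comorphism_comorphism: "is_comorphism (T_comorphism C pb F)"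
proof (rule is_comorphismI, goal_cases)
  case 3 show ?case using postcomp_functor[of F\<^sub>0] by simp
next
  case 4 show ?case by (simp add: T_comorphism_def Let_def)
next
  case (6 f)
  obtain \<gamma> k \<delta> where e: "f = (\<gamma>, k, \<delta>)" by (cases f)
  have [simp]: "\<delta> \<cdot>\<^bsub>C\<^esub> (k \<cdot>\<^bsub>C\<^esub> z) = \<gamma> \<cdot>\<^bsub>C\<^esub> z" if "z \<in> Ar C" "Cod C z = Dom C \<gamma>" for z
    by (rule slice_ar_comp) (use 6 that in \<open>simp_all add: e\<close>)
  show ?case using 6 unfolding e by simp
next
  case (8 x)
  then show ?case by (simp add: D.act_mult_eq E.act_mult_pair)
qed (simp_all add: D.T_monad_monad E.T_monad_monad hom_iff)

end

context pullback_category
begin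

lemma INT_simps [simp]:
  "D \<in> Ob (INT_CAT C pb) \<longleftrightarrow> internal_category C pb D"
  "F \<in> Ar (INT_CAT C pb) \<longleftrightarrow> internal_functor C pb F"
  "Dom (INT_CAT C pb) = ifsrc" "Cod (INT_CAT C pb) = iftgt"
  "Id (INT_CAT C pb) D = \<lparr>ifsrc = D, iftgt = D, ifob = Id C (iob D), ifar = Id C (iar D)\<rparr>"
  "G \<cdot>\<^bsub>INT_CAT C pb\<^esub> F = \<lparr>ifsrc = ifsrc F, iftgt = iftgt G,
     ifob = ifob G \<cdot>\<^bsub>C\<^esub> ifob F, ifar = ifar G \<cdot>\<^bsub>C\<^esub> ifar F\<rparr>"
  by (simp_all add: INT_CAT_def)

lemma internal_funI: "internal_functor C pb F \<Longrightarrow> internal_fun C pb F"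
  by unfold_locales simp

lemma internal_catI: "internal_category C pb D \<Longrightarrow> internal_cat C pb D"
  by unfold_locales simp

lemma internal_functor_id:
  assumes "internal_category C pb D"
  shows "internal_functor C pb \<lparr>ifsrc = D, iftgt = D, ifob = Id C (iob D), ifar = Id C (iar D)\<rparr>"
proof -
  interpret internal_cat C pb D by (rule internal_catI[OF assms])
  show ?thesis
    by (simp add: internal_functor_def Let_def assms hom_iff pbmap_def del: act_tgt_fold)
qed

lemma internal_functor_comp:
  assumes "internal_functor C pb F" "internal_functor C pb G" and FG: "ifsrc G = iftgt F"
  shows "internal_functor C pb \<lparr>ifsrc = ifsrc F, iftgt = iftgt G,
     ifob = ifob G \<cdot>\<^bsub>C\<^esub> ifob F, ifar = ifar G \<cdot>\<^bsub>C\<^esub> ifar F\<rparr>"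
proof -
  interpret F: internal_fun C pb F by (rule internal_funI[OF assms(1)])
  interpret G: internal_fun C pb G rewrites "ifsrc G = iftgt F"
    by (rule internal_funI[OF assms(2)]) (fact FG)
  have "ifar F \<cdot>\<^bsub>C\<^esub> F.D.m = F.E.m \<cdot>\<^bsub>C\<^esub> pbmap C pb F.D.s F.D.t F.E.s F.E.t (ifar F) (ifar F)"
    using assms(1) by (simp add: internal_functor_def Let_def)
  then show ?thesis
    by (simp add: internal_functor_def Let_def F.D.internal G.E.internal hom_iff pbmap_def del: F.D.act_tgt_fold)
qed

lemma category_INT: "category (INT_CAT C pb)"
proof (rule categoryI, goal_cases)
  case (1 F) then show ?case by (simp add: internal_functor_def Let_def)
next
  case (2 F) then show ?case by (simp add: internal_functor_def Let_def)
next
  case (3 D) then show ?case by (simp add: internal_functor_id)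
next
  case (4 F G) then show ?case by (simp add: internal_functor_comp)
next
  case (5 F)
  then interpret internal_fun C pb F by (simp add: internal_funI)
  show ?case by (cases F) (use fun_simps in simp)
next
  case (6 F)
  then interpret internal_fun C pb F by (simp add: internal_funI)
  show ?case by (cases F) (use fun_simps in simp)
next
  case (7 F G H)
  then interpret F: internal_fun C pb F by (simp add: internal_funI)
  interpret G: internal_fun C pb G rewrites "ifsrc G = iftgt F"
    using 7 by (simp_all add: internal_funI)
  interpret H: internal_fun C pb H rewrites "ifsrc H = iftgt G"
    using 7 by (simp_all add: internal_funI)
  show ?case by simp
qed

text \<open>
  Postcomposition is strictly functorial in \<open>F\<^sub>0\<close>, and the comorphism acts on an element \<open>(a, x)\<close> by
  \<open>(F\<^sub>1 a, x)\<close>; hence identities and composites are preserved on the nose.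
\<close>

lemma T_functr_functor: "functor_between (INT_CAT C pb) MND_co_adj (T_functr C pb)"
proof (rule functor_betweenI)
  show "category (INT_CAT C pb)" "category (MND_co_adj :: (('a, 'a \<times> 'a \<times> 'a) monad, _) cat)"
    by (rule category_INT category_MND)+
  show "fsrc (T_functr C pb) = INT_CAT C pb" "ftgt (T_functr C pb) = MND_co_adj"
    "fob (T_functr C pb) \<in> extensional (Ob (INT_CAT C pb))"
    "far (T_functr C pb) \<in> extensional (Ar (INT_CAT C pb))"
    by (simp_all add: T_functr_def)
  fix D assume D: "D \<in> Ob (INT_CAT C pb)"
  then interpret internal_cat C pb D by (simp add: internal_catI)
  show "fob (T_functr C pb) D \<in> Ob MND_co_adj"
    using D by (simp add: T_functr_def T_monad_monad)
  let ?I = "\<lparr>ifsrc = D, iftgt = D, ifob = Id C (iob D), ifar = Id C (iar D)\<rparr>"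
  have I: "internal_functor C pb ?I" by (rule internal_functor_id[OF internal])
  interpret I: internal_fun C pb ?I rewrites "ifsrc ?I = D" and "iftgt ?I = D"
      and "ifob ?I = Id C (iob D)" and "ifar ?I = Id C (iar D)"
    by (rule internal_funI[OF I]) simp_all
  have "T_comorphism C pb ?I = Id MND_co_adj M"
    by (rule comorphism_eqI)
      (use I.T_comorphism_comorphism comorphism_adj.comorphism[OF comorphism_adj_id[OF T_monad_monad]] in
        \<open>simp_all add: postcomp_id\<close>)
  then show "far (T_functr C pb) (Id (INT_CAT C pb) D) = Id MND_co_adj (fob (T_functr C pb) D)"
    using D I by (simp add: T_functr_def)
next
  fix F assume F: "F \<in> Ar (INT_CAT C pb)"
  then interpret internal_fun C pb F by (simp add: internal_funI)
  show "far (T_functr C pb) F \<in> Ar MND_co_adj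
      \<and> Dom MND_co_adj (far (T_functr C pb) F) = fob (T_functr C pb) (Dom (INT_CAT C pb) F)
      \<and> Cod MND_co_adj (far (T_functr C pb) F) = fob (T_functr C pb) (Cod (INT_CAT C pb) F)"
    using F T_comorphism_comorphism postcomp_right_adjoint[of F\<^sub>0] D.internal E.internal
    by (simp add: T_functr_def MND_ar_iff)
next
  fix F G assume FG: "F \<in> Ar (INT_CAT C pb)" "G \<in> Ar (INT_CAT C pb)"
    "Dom (INT_CAT C pb) G = Cod (INT_CAT C pb) F"
  then have st: "ifsrc G = iftgt F" by simp
  interpret F: internal_fun C pb F using FG by (simp add: internal_funI)
  interpret G: internal_fun C pb G rewrites "ifsrc G = iftgt F"
    using FG by (simp_all add: internal_funI)
  let ?H = "\<lparr>ifsrc = ifsrc F, iftgt = iftgt G, ifob = ifob G \<cdot>\<^bsub>C\<^esub> ifob F, ifar = ifar G \<cdot>\<^bsub>C\<^esub> ifar F\<rparr>"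
  have H: "internal_functor C pb ?H" using internal_functor_comp FG by simp
  interpret H: internal_fun C pb ?H rewrites "ifsrc ?H = ifsrc F" and "iftgt ?H = iftgt G"
      and "ifob ?H = ifob G \<cdot>\<^bsub>C\<^esub> ifob F" and "ifar ?H = ifar G \<cdot>\<^bsub>C\<^esub> ifar F"
    by (rule internal_funI[OF H]) simp_all
  have adj: "comorphism_adj (T_comorphism C pb F) r" "comorphism_adj (T_comorphism C pb G) r'"
    if "right_adjoint (postcomp C (ifob F)) r" "right_adjoint (postcomp C (ifob G)) r'" for r r'
    using that F.T_comorphism_comorphism G.T_comorphism_comorphism by unfold_locales simp_all
  obtain r r' where "right_adjoint (postcomp C (ifob F)) r" "right_adjoint (postcomp C (ifob G)) r'"
    using postcomp_right_adjoint[of "ifob F"] postcomp_right_adjoint[of "ifob G"] by auto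
  note c = comorphism_adj.comorphism[OF comorphism_adj_comp[OF adj[OF this]]]
  have "T_comorphism C pb ?H = T_comorphism C pb G \<odot> T_comorphism C pb F"
    by (rule comorphism_eqI)
      (use H.T_comorphism_comorphism c in \<open>simp_all add: postcomp_comp\<close>)
  then show "far (T_functr C pb) (G \<cdot>\<^bsub>INT_CAT C pb\<^esub> F)
      = far (T_functr C pb) G \<odot> far (T_functr C pb) F"
    using FG H by (simp add: T_functr_def)
qed

end

theorem theorem4p2:
  fixes C :: "('o, 'a) cat"
    and pb :: "'a \<Rightarrow> 'a \<Rightarrow> 'a \<times> 'a"
    and R :: "('a, 'a \<times> 'a \<times> 'a, 'a, 'a \<times> 'a \<times> 'a) functr \<Rightarrow>
              ('a, 'a \<times> 'a \<times> 'a, 'a, 'a \<times> 'a \<times> 'a) radj"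
  assumes "category C" and "has_finite_limits C"
    and "pullback_choice C pb" and "right_adjoint_choice R"
  shows "functor_between (INT_CAT C pb) MND_co_adj (T_functr C pb)
    \<and> pseudofunctor (op_cat MND_co_adj) (ALG_ps R)
    \<and> (\<exists>Act. pseudofunctor (op_cat (INT_CAT C pb)) Act
        \<and> (\<forall>D. internal_category C pb D \<longrightarrow> ps_ob Act D = ACT C pb D)
        \<and> ps_isomorphism (op_cat (INT_CAT C pb))
            (ps_precomp (ALG_ps R) (op_functr (T_functr C pb))) Act (alg_to_act C pb)
        \<and> (split_along (T_functr C pb) R \<longrightarrow>
            functor_between (op_cat (INT_CAT C pb)) CAT (ps_functr (op_cat (INT_CAT C pb)) Act)))"
proof -
  interpret pullback_category C pb
    using assms by (simp add: pullback_category_def pullback_category_axioms_def)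
  interpret right_adjoint_choices R by unfold_locales fact
  let ?I = "INT_CAT C pb" and ?K = "T_functr C pb"
  let ?P = "ps_precomp (ALG_ps R) (op_functr ?K)"
  let ?Act = "ps_transport (op_cat ?I) ?P (ACT C pb) (alg_to_act C pb)"
  note K = T_functr_functor
  have ob: "ps_ob ?P D = ALG (T_monad C pb D)" if "internal_category C pb D" for D
    using that by (simp add: ps_precomp_def op_functr_def T_functr_def)
  interpret transport "op_cat ?I" ?P "ACT C pb" "alg_to_act C pb"
  proof
    show "pseudofunctor (op_cat ?I) ?P"
      by (rule pseudofunctor_precomp[OF ALG_ps_pseudofunctor functor_between_op[OF K]])
    show "cat_isomorphism (ps_ob ?P D) (ACT C pb D) (alg_to_act C pb D)" if "D \<in> Ob (op_cat ?I)" for D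
      using that ob internal_cat.alg_to_act_isomorphism[OF internal_catI, of D] by simp
  qed
  \<comment> \<open>For a split choice the chosen adjunctions are the identity and composite adjunctions themselves.\<close>
  have "functor_between (op_cat ?I) CAT (ps_functr (op_cat ?I) ?Act)" if split: "split_along ?K R"
  proof -
    have ar: "ps_ar ?P F = alg_functr (far ?K F) (R (cfun (far ?K F)))" for F
      by (simp add: ps_precomp_def op_functr_def)
    have id: "ps_ar ?P (Id (op_cat ?I) D) = id_functr (ps_ob ?P D)" if "D \<in> Ob (op_cat ?I)" for D
    proof -
      have D: "D \<in> Ob ?I" "internal_category C pb D" using that by simp_all
      interpret internal_cat C pb D by (rule internal_catI[OF D(2)])
      have e: "fob ?K D = M" using D by (simp add: T_functr_def)
      have f: "far ?K (Id (op_cat ?I) D) = Id MND_co_adj M"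
        using functor_between_simps(7)[OF K D(1)] by (simp add: e)
      have "R (id_functr (mcat (fob ?K D))) = id_radj (mcat (fob ?K D))"
        using split D(1) unfolding split_along_def functor_between_simps(1)[OF K] by blast
      then have s: "R (id_functr (mcat M)) = id_radj (mcat M)" unfolding e .
      have "ps_ar ?P (Id (op_cat ?I) D) = alg_functr (Id MND_co_adj M) (R (id_functr (mcat M)))"
        unfolding ar f by simp
      then show ?thesis unfolding s alg_functr_id[OF T_monad_monad] ob[OF D(2)] .
    qed
    have comp: "ps_ar ?P (G \<cdot>\<^bsub>op_cat ?I\<^esub> F) = comp_functr (ps_ar ?P G) (ps_ar ?P F)"
      if a: "F \<in> Ar (op_cat ?I)" "G \<in> Ar (op_cat ?I)" "Dom (op_cat ?I) G = Cod (op_cat ?I) F" for F G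
    proof -
      have a': "G \<in> Ar ?I" "F \<in> Ar ?I" "Dom ?I F = Cod ?I G" using a by simp_all
      have f: "far ?K (G \<cdot>\<^bsub>op_cat ?I\<^esub> F) = far ?K F \<odot> far ?K G"
        using functor_between_simps(8)[OF K a'] by simp
      have m: "far ?K G \<in> Ar MND_co_adj" "far ?K F \<in> Ar MND_co_adj" "csrc (far ?K F) = ctgt (far ?K G)"
        using functor_between_simps(4-6)[OF K] a' by simp_all
      have s: "R (comp_functr (cfun (far ?K F)) (cfun (far ?K G)))
          = comp_radj (cfun (far ?K F)) (R (cfun (far ?K F))) (cfun (far ?K G)) (R (cfun (far ?K G)))"
        using split a' by (auto simp: split_along_def functor_between_simps(1)[OF K] Let_def)
      show ?thesis
        unfolding ar f MND_simps s
        by (rule alg_functr_comp[OF comorphism_adj_choice[OF m(1)] comorphism_adj_choice[OF m(2)] m(3)])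
    qed
    show ?thesis
      by (rule ps_functr_functor[OF transport_pseudofunctor])
        (use transport_strict[OF id comp] in \<open>simp_all del: INT_simps transport_simps(2)\<close>)
  qed
  then show ?thesis
    using K ALG_ps_pseudofunctor transport_pseudofunctor transport_isomorphism transport_simps(1)
    by auto
qed

end
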